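(* Let $\ell>3$ be prime, $s_\ell=\frac{1}{24}(\ell^2-1)$, and let $B(q)=\frac{E(q)^3}{E(q^2)^2}=\sum_{k\ge0}\beta(k)q^k$, where $E(q)=\prod_{n\ge1}(1-q^n)$, with $\beta(x)=0$ unless $x$ is a nonnegative integer. Define, for $\tau$ in the upper half-plane and $q=e^{2\pi i\tau}$, $$\widetilde W_\ell(\tau)=\frac{1}{B(q)}\sum_{n\ge -s_\ell}\left(\ell\,\beta(\ell^2n-s_\ell)+\left(\frac{3}{\ell}\right)\left(\frac{24n-1}{\ell}\right)\beta(n)+\beta\!\left(\frac{n+s_\ell}{\ell^2}\right)\right)q^n.$$ Then $\widetilde W_\ell$ is a weakly holomorphic modular function on $\Gamma_0(2)$ whose only pole is at the cusp $i\infty$, and consequently $\widetilde W_\ell(\tau)$ is a polynomial in $\Phi_2(\tau)^{-1}$, where $\Phi_2(\tau)=\left(\frac{\eta(2\tau)}{\eta(\tau)}\right)^{24}$.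
   Context: $\eta(\tau)=q^{1/24}\prod_{n\ge1}(1-q^n)$. $\beta(k)=M_e(k)-M_o(k)$ (number of partitions of $k$ with even crank minus those with odd crank), but here $\beta$ is simply defined by the product. $\Gamma_0(2)$ consists of integer matrices of determinant $1$ with lower-left entry even; its inequivalent cusps are $0$ and $i\infty$. A weakly holomorphic modular function is $\Gamma_0(2)$-invariant, holomorphic on the upper half-plane, with poles only at cusps. $\left(\frac{\cdot}{\ell}\right)$ is the Legendre symbol. *)

theory Defs
  imports
    "HOL-Complex_Analysis.Complex_Analysis"
    "HOL-Number_Theory.Number_Theory"
begin

definition upper_half_plane :: "complex set" where
  "upper_half_plane = {\<tau>. Im \<tau> > 0}"

definition SL2Z :: "(int ^ 2 ^ 2) set" where
  "SL2Z = {A. det A = 1}"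

definition Gamma0 :: "nat \<Rightarrow> (int ^ 2 ^ 2) set" where
  "Gamma0 N = {A \<in> SL2Z. int N dvd A $ 2 $ 1}"

definition moebius :: "int ^ 2 ^ 2 \<Rightarrow> complex \<Rightarrow> complex" where
  "moebius A \<tau> = (of_int (A $ 1 $ 1) * \<tau> + of_int (A $ 1 $ 2)) /
                 (of_int (A $ 2 $ 1) * \<tau> + of_int (A $ 2 $ 2))"

text \<open>
  A cusp is represented by any \<open>A \<in> SL2Z\<close> that maps \<open>i\<infinity>\<close> to it, i.e. by the point
  \<open>A $ 1 $ 1 / A $ 2 $ 1\<close> of the projective line over the rationals; \<open>mat 1\<close> represents \<open>i\<infinity>\<close>.
  Two points of the projective line agree iff their primitive integer coordinate vectors agree
  up to sign.
\<close>

definition cusps_equivalent :: "nat \<Rightarrow> int ^ 2 ^ 2 \<Rightarrow> int ^ 2 ^ 2 \<Rightarrow> bool" where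
  "cusps_equivalent N A B \<longleftrightarrow>
     (\<exists>C\<in>Gamma0 N. column 1 (C ** A) = column 1 B \<or> column 1 (C ** A) = - column 1 B)"

text \<open>
  \<open>f \<circ> moebius A\<close> written as a function of \<open>q\<^sub>N = exp (2 \<pi> i \<tau> / N)\<close>. For \<open>f\<close> invariant under
  \<open>Gamma0 N\<close>, \<open>f \<circ> moebius A\<close> has period \<open>N\<close>, so the choice of branch of the logarithm does not
  matter. The width of the cusp divides \<open>N\<close>, so \<open>q\<^sub>N\<close> is a root of the local parameter there and
  detects the same poles.
\<close>

definition cusp_chart :: "nat \<Rightarrow> (complex \<Rightarrow> complex) \<Rightarrow> int ^ 2 ^ 2 \<Rightarrow> complex \<Rightarrow> complex" where
  "cusp_chart N f A q = f (moebius A (of_nat N * Ln q / (2 * of_real pi * \<i>)))"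

definition meromorphic_at_cusp :: "nat \<Rightarrow> (complex \<Rightarrow> complex) \<Rightarrow> int ^ 2 ^ 2 \<Rightarrow> bool" where
  "meromorphic_at_cusp N f A \<longleftrightarrow> cusp_chart N f A meromorphic_on {0}"

definition pole_at_cusp :: "nat \<Rightarrow> (complex \<Rightarrow> complex) \<Rightarrow> int ^ 2 ^ 2 \<Rightarrow> bool" where
  "pole_at_cusp N f A \<longleftrightarrow> is_pole (cusp_chart N f A) 0"

definition weakly_holomorphic_modular_function :: "nat \<Rightarrow> (complex \<Rightarrow> complex) \<Rightarrow> bool" where
  "weakly_holomorphic_modular_function N f \<longleftrightarrow>
     f holomorphic_on upper_half_plane \<and>
     (\<forall>A\<in>Gamma0 N. \<forall>\<tau>\<in>upper_half_plane. f (moebius A \<tau>) = f \<tau>) \<and>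
     (\<forall>A\<in>SL2Z. meromorphic_at_cusp N f A)"

definition nome :: "complex \<Rightarrow> complex" where
  "nome \<tau> = exp (2 * of_real pi * \<i> * \<tau>)"

definition euler_prod :: "complex \<Rightarrow> complex" where
  "euler_prod q = (\<Prod>n. 1 - q ^ Suc n)"

definition eta :: "complex \<Rightarrow> complex" where
  "eta \<tau> = exp (2 * of_real pi * \<i> * \<tau> / 24) * euler_prod (nome \<tau>)"

definition Phi2 :: "complex \<Rightarrow> complex" where
  "Phi2 \<tau> = (eta (2 * \<tau>) / eta \<tau>) ^ 24"

definition B_fun :: "complex \<Rightarrow> complex" where
  "B_fun q = euler_prod q ^ 3 / euler_prod (q\<^sup>2) ^ 2"

definition beta :: "rat \<Rightarrow> complex" where
  "beta x = (if x \<in> \<nat> then fps_nth (fps_expansion B_fun 0) (nat \<lfloor>x\<rfloor>) else 0)"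

lemma euler_prod_convergent:
  assumes "norm q < 1"
  shows "convergent_prod (\<lambda>n. 1 - q ^ Suc n :: complex)"
proof -
  have "summable (\<lambda>n. norm q ^ Suc n)"
    using assms by (subst summable_Suc_iff) (simp add: summable_geometric)
  hence "abs_convergent_prod (\<lambda>n. 1 - q ^ Suc n)"
    unfolding abs_convergent_prod_conv_summable by (simp add: norm_mult norm_power)
  thus ?thesis by (rule abs_convergent_prod_imp_convergent_prod)
qed

lemma euler_prod_nonzero:
  assumes "norm q < 1"
  shows "euler_prod q \<noteq> 0"
  unfolding euler_prod_def
proof (rule prodinf_nonzero[OF euler_prod_convergent[OF assms]])
  fix n
  have "norm (q ^ Suc n) < 1"
    unfolding norm_power using assms by (metis norm_ge_zero power_less_one_iff zero_less_Suc)
  thus "1 - q ^ Suc n \<noteq> 0" by auto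
qed

lemma euler_prod_holomorphic: "euler_prod holomorphic_on ball 0 1"
proof (rule holomorphic_uniform_sequence[where f = "\<lambda>N q. \<Prod>n<N. 1 - q ^ Suc n"])
  fix x :: complex assume x: "x \<in> ball 0 1"
  define d where "d = (1 - norm x) / 2"
  have d: "d > 0" "norm x + d < 1" using x by (auto simp: d_def field_simps)
  have le: "norm y \<le> norm x + d" if "y \<in> cball x d" for y
    using that norm_triangle_sub[of y x] by (simp add: dist_norm norm_minus_commute)
  have "uniformly_convergent_on (cball x d) (\<lambda>N q. \<Prod>n<N. 1 + (- (q ^ Suc n)))"
  proof (rule uniformly_convergent_on_prod)
    show "uniformly_convergent_on (cball x d) (\<lambda>N q. \<Sum>n<N. norm (- (q ^ Suc n)))"
    proof (rule Weierstrass_m_test')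
      show "summable (\<lambda>n. (norm x + d) ^ Suc n)"
        using d by (subst summable_Suc_iff) (simp add: summable_geometric)
      show "norm (norm (- (y ^ Suc n))) \<le> (norm x + d) ^ Suc n" if "y \<in> cball x d" for n y
        using power_mono[OF le[OF that] norm_ge_zero, of "Suc n"]
        by (simp add: norm_mult norm_power)
    qed
  qed (auto intro!: continuous_intros)
  then obtain g where g: "uniform_limit (cball x d) (\<lambda>N q. \<Prod>n<N. 1 - q ^ Suc n) g sequentially"
    by (auto simp: uniformly_convergent_on_def)
  have "g y = euler_prod y" if "y \<in> cball x d" for y
  proof -
    have "(\<lambda>N. \<Prod>n<N. 1 - y ^ Suc n) \<longlonglongrightarrow> g y"
      using tendsto_uniform_limitI[OF g that] .
    moreover have "norm y < 1" using le[OF that] d by simp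
    hence "(\<lambda>N. \<Prod>n\<le>N. 1 - y ^ Suc n) \<longlonglongrightarrow> euler_prod y"
      unfolding euler_prod_def by (intro convergent_prod_LIMSEQ euler_prod_convergent)
    hence "(\<lambda>N. \<Prod>n<N. 1 - y ^ Suc n) \<longlonglongrightarrow> euler_prod y"
      using LIMSEQ_lessThan_iff_atMost by blast
    ultimately show ?thesis by (rule LIMSEQ_unique)
  qed
  hence "uniform_limit (cball x d) (\<lambda>N q. \<Prod>n<N. 1 - q ^ Suc n) euler_prod sequentially"
    using g by (subst uniform_limit_cong'[where g = "\<lambda>N q. \<Prod>n<N. 1 - q ^ Suc n" and i = g]) auto
  moreover have "cball x d \<subseteq> ball 0 1" using le d by fastforce
  ultimately show "\<exists>d>0. cball x d \<subseteq> ball 0 1 \<and>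
      uniform_limit (cball x d) (\<lambda>N q. \<Prod>n<N. 1 - q ^ Suc n) euler_prod sequentially"
    using d by blast
qed (auto intro!: holomorphic_intros)

lemma B_fun_holomorphic: "B_fun holomorphic_on ball 0 1"
proof -
  have sq: "q\<^sup>2 \<in> ball 0 1" if "q \<in> ball 0 1" for q :: complex
    using that by (simp add: norm_power power_less_one_iff)
  have "(euler_prod \<circ> (\<lambda>q. q\<^sup>2)) holomorphic_on ball 0 1"
    using sq by (intro holomorphic_on_compose_gen[OF _ euler_prod_holomorphic])
                (auto intro!: holomorphic_intros)
  hence "(\<lambda>q. euler_prod (q\<^sup>2)) holomorphic_on ball 0 1" by (simp add: o_def)
  moreover have "euler_prod (q\<^sup>2) \<noteq> 0" if "q \<in> ball 0 1" for q
    using sq[OF that] by (intro euler_prod_nonzero) simp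
  ultimately show ?thesis
    unfolding B_fun_def using euler_prod_holomorphic
    by (intro holomorphic_intros) auto
qed

text \<open>The coefficients \<open>beta\<close> are those of the convergent power series of \<open>B_fun\<close>.\<close>

lemma beta_sums_B_fun:
  assumes "norm q < 1"
  shows "(\<lambda>k. beta (of_nat k) * q ^ k) sums B_fun q"
  using holomorphic_power_series[OF B_fun_holomorphic, of q] assms
  by (simp add: beta_def fps_expansion_def)

definition s_ell :: "nat \<Rightarrow> rat" where
  "s_ell l = (of_nat l ^ 2 - 1) / 24"

definition W_tilde :: "nat \<Rightarrow> complex \<Rightarrow> complex" where
  "W_tilde l \<tau> =
     1 / B_fun (nome \<tau>) *
     (\<Sum>\<^sub>\<infinity>n\<in>{n::int. of_int n \<ge> - s_ell l}.
        (of_nat l * beta (of_nat l ^ 2 * of_int n - s_ell l)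
         + of_int (Legendre 3 (int l)) * of_int (Legendre (24 * n - 1) (int l)) * beta (of_int n)
         + beta ((of_int n + s_ell l) / of_nat l ^ 2)) * nome \<tau> powi n)"

end

theory Submission
  imports Defs
begin

text \<open>
  Put \<open>g(\<tau>) = \<eta>(\<tau>)\<^sup>3 / \<eta>(2\<tau>)\<^sup>2 = q\<^bsup>-1/24\<^esup> B(q)\<close>, of weight \<open>1/2\<close>. Then \<open>W_tilde l\<close> is the quotient
  by \<open>g\<close> of the half-integral weight Hecke operator of index \<open>l\<^sup>2\<close> applied to \<open>g\<close>, which is a sum
  of terms \<open>g((\<tau> + 24b)/l\<^sup>2)\<close>, \<open>g(\<tau> + 24y/l)\<close> and \<open>g(l\<^sup>2\<tau>)\<close>. The substitution \<open>\<tau> \<mapsto> -1/\<tau>\<close> permutes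
  these terms, turning \<open>g\<close> into \<open>h(\<tau>) = \<eta>(\<tau>)\<^sup>3 / \<eta>(\<tau>/2)\<^sup>2\<close>, so that \<open>W_tilde l (-1/\<tau>)\<close> is a power
  series in \<open>exp (\<pi>i\<tau>)\<close>. Together with the \<open>q\<close>-expansion at \<open>i\<infinity>\<close> this gives invariance under \<open>\<tau> \<mapsto>
  \<tau> + 1\<close> and \<open>\<tau> \<mapsto> \<tau>/(2\<tau> + 1)\<close>, which generate \<open>Gamma0 2\<close> up to sign, and holomorphy at the cusp
  \<open>0\<close>. Subtracting powers of the Hauptmodul \<open>1/Phi2\<close> removes the pole at \<open>i\<infinity>\<close>, and the maximum
  modulus principle finishes the proof.

  The multipliers in \<open>\<eta>(24y/N - 1/(N\<^sup>2\<tau>)) = \<omega> (-iN\<tau>)\<^bsup>1/2\<^esup> \<eta>(\<tau> + 24x/N)\<close> for \<open>N = l, l\<^sup>2\<close> are found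
  without Dedekind sums or the sign of the Gauss sum. By the pentagonal number theorem, averaging
  \<open>\<eta>(\<tau> + 24b/N)\<close> over \<open>b\<close> gives a multiple of \<open>\<eta>(l\<^sup>2\<tau>)\<close>. Inverting this relation determines the
  Fourier transform of \<open>\<omega>\<close> at the quadratic residues, and \<open>|\<omega>| = 1\<close> leaves only one possibility.
\<close>

section \<open>The pentagonal number theorem\<close>

text \<open>For N = l the multipliers are (x/l) times a unit \<omega>, essentially the inverse of a
  normalised Gauss sum, which is never computed. In g the multipliers of eta enter as a cube over a
  square, so one factor \<omega> survives with a quadratic character. The middle term of the Hecke
  operator therefore carries \<open>cnj \<omega>\<close>, and the coefficient comparison behind
  \<omega> also shows that the sum of (x/l) \<omega> exp(2 pi i m x/l) over x is sqrt l (3/l) (m/l).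
  So \<omega> drops out of the q-expansion and leaves exactly the factor (3/l) ((24n-1)/l) of
  \<open>W_tilde\<close>.

  The averages of eta close up because its exponents are the squares (6k-1)^2 over 24: those with l
  dividing 6k-1 are l^2 times the same set, since l is 1 or -1 modulo 6. For the same reason the
  Fourier transform of \<omega> is seen only at numbers 24n+1 with n pentagonal, that is at squares,
  and the nonresidues need a separate extremal argument.

  All shifts are multiples of 24 so that no 24th roots of unity arise. Inversion pairs shifts x and
  y of eta by 576 x y = -1, where 576 = 24^2, and those of g by 1152 x y = -1, because of the
  argument doubled in eta(2\<tau>).\<close>

definition pent :: "int \<Rightarrow> nat" where
  "pent k = nat (k * (3 * k - 1) div 2)"

lemma pent_double: "2 * int (pent k) = k * (3 * k - 1)"
proof -
  have "k * (3 * k - 1) \<ge> 0"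
    by (cases "k \<le> 0") (auto simp: mult_nonpos_nonpos)
  moreover have "even (k * (3 * k - 1))" by auto
  ultimately show ?thesis unfolding pent_def by (simp add: pos_imp_zdiv_nonneg_iff)
qed

text \<open>Completing the square: with its prefactor q^(1/24), eta becomes a theta series with
  exponents (6k-1)^2/24.\<close>

lemma pent_square: "24 * int (pent k) + 1 = (6 * k - 1)\<^sup>2"
  using pent_double[of k] by (simp add: power2_eq_square algebra_simps)

lemma inj_pent: "inj pent"
proof (rule injI)
  fix j k assume "pent j = pent k"
  hence "(6 * j - 1)\<^sup>2 = (6 * k - 1)\<^sup>2" by (metis pent_square)
  hence "6 * j - 1 = 6 * k - 1 \<or> 6 * j - 1 = - (6 * k - 1)" by (simp add: power2_eq_iff)
  thus "j = k" by presburger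
qed

text \<open>A finite form of Euler's theorem, due to Shanks. As n grows, the term s = 0 tends to the
  infinite product and all other terms die out, while the right side is a symmetric partial sum of
  the pentagonal series.\<close>

lemma shanks_identity:
  fixes q :: complex
  shows "(\<Sum>s\<le>n. (-1) ^ s * (\<Prod>k\<in>{s<..n}. 1 - q ^ k) * q ^ (s * n + \<Sum>{..s})) =
         (\<Sum>k\<in>{- int n..int n}. (-1) ^ nat \<bar>k\<bar> * q ^ pent k)"
proof (induction n)
  case 0
  show ?case by (simp add: pent_def)
next
  case (Suc n)
  define D where "D = (\<lambda>n s. \<Prod>k\<in>{s<..n}. 1 - q ^ k)"
  define T where "T = (\<lambda>s. \<Sum>{..s::nat})"
  have T_Suc: "T (Suc s) = T s + Suc s" for s by (simp add: T_def)
  have T_double: "2 * T s = s * (s + 1)" for s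
    by (induction s) (simp_all add: T_Suc, simp add: T_def)
  have T_int: "2 * int (T s) = int s * (int s + 1)" for s
    by (metis T_double int_ops(2) of_nat_add of_nat_mult of_nat_numeral)
  have D_Suc: "D (Suc n) s = D n s * (1 - q ^ Suc n)" if "s \<le> n" for s
  proof -
    have "{s<..Suc n} = insert (Suc n) {s<..n}" using that by auto
    thus ?thesis by (simp add: D_def)
  qed
  have D_lower: "D n s = (1 - q ^ Suc s) * D n (Suc s)" if "Suc s \<le> n" for s
  proof -
    have "{s<..n} = insert (Suc s) {Suc s<..n}" using that by auto
    thus ?thesis by (simp add: D_def)
  qed
  define t where "t = (\<lambda>n s. (-1) ^ s * D n s * q ^ (s * n + T s))"
  \<comment> \<open>The certificate for telescoping in s: t (n+1) s - t n s = u (s-1) - u s. After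
    summation \<open>u n\<close> and the new top term of \<open>t\<close> are the pentagonal terms
    of index n+1 and -(n+1).\<close>
  define u where "u = (\<lambda>s. (-1) ^ s * D n s * q ^ (Suc s * Suc n + T s))"
  have telescope: "(\<Sum>s\<le>m. t (Suc n) s - t n s) = - u m" if "m \<le> n" for m
    using that
  proof (induction m)
    case 0
    show ?case by (simp add: t_def u_def D_Suc T_def algebra_simps)
  next
    case (Suc m)
    have "t (Suc n) (Suc m) - t n (Suc m) = u m - u (Suc m)"
      using Suc.prems
      by (simp add: t_def u_def D_Suc D_lower[of m] T_Suc algebra_simps power_add)
    thus ?case using Suc by simp
  qed
  have pent_pos: "pent (int (Suc n)) = Suc n * Suc n + T n"
    using pent_double[of "int (Suc n)"] T_int[of n]
    by (intro of_nat_eq_iff[where 'a = int, THEN iffD1]) (simp add: algebra_simps)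
  have pent_neg: "pent (- int (Suc n)) = Suc n * Suc n + T (Suc n)"
    using pent_double[of "- int (Suc n)"] T_int[of "Suc n"]
    by (intro of_nat_eq_iff[where 'a = int, THEN iffD1]) (simp add: algebra_simps)
  have "(\<Sum>s\<le>Suc n. t (Suc n) s) = (\<Sum>s\<le>n. t n s) - u n + t (Suc n) (Suc n)"
    using telescope[of n] by (simp add: sum_subtractf algebra_simps)
  moreover have "u n = - ((-1) ^ Suc n * q ^ pent (int (Suc n)))"
    by (simp only: pent_pos u_def) (simp add: D_def)
  moreover have "t (Suc n) (Suc n) = (-1) ^ Suc n * q ^ pent (- int (Suc n))"
    by (simp only: pent_neg t_def) (simp add: D_def)
  moreover have "(\<Sum>k\<in>{- int (Suc n)..int (Suc n)}. (-1) ^ nat \<bar>k\<bar> * q ^ pent k) =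
      (-1) ^ Suc n * q ^ pent (int (Suc n)) + ((-1) ^ Suc n * q ^ pent (- int (Suc n)) +
      (\<Sum>k\<in>{- int n..int n}. (-1) ^ nat \<bar>k\<bar> * q ^ pent k))"
  proof -
    have "{- int (Suc n)..int (Suc n)} =
        insert (int (Suc n)) (insert (- int (Suc n)) {- int n..int n})" by auto
    moreover have "nat \<bar>int (Suc n)\<bar> = Suc n" "nat \<bar>- int (Suc n)\<bar> = Suc n" by linarith+
    ultimately show ?thesis by (simp del: of_nat_Suc)
  qed
  moreover have "(\<Sum>s\<le>n. t n s) = (\<Sum>k\<in>{- int n..int n}. (-1) ^ nat \<bar>k\<bar> * q ^ pent k)"
    using Suc.IH unfolding t_def D_def T_def .
  ultimately have "(\<Sum>s\<le>Suc n. t (Suc n) s) =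
      (\<Sum>k\<in>{- int (Suc n)..int (Suc n)}. (-1) ^ nat \<bar>k\<bar> * q ^ pent k)"
    by (simp only: algebra_simps minus_minus diff_minus_eq_add)
  thus ?case unfolding t_def D_def T_def .
qed

text \<open>Follows from 1 + x \<le> exp x. The bound is uniform in the index set, as the error
  estimate for \<open>shanks_identity\<close> requires.\<close>

lemma norm_prod_one_minus_le:
  fixes q :: complex
  assumes "norm q < 1" and "finite A"
  shows "norm (\<Prod>k\<in>A. 1 - q ^ k) \<le> exp (1 / (1 - norm q))"
proof -
  have "norm (\<Prod>k\<in>A. 1 - q ^ k) \<le> (\<Prod>k\<in>A. exp (norm q ^ k))"
    unfolding prod_norm[symmetric]
  proof (intro prod_mono conjI)
    fix k
    have "norm (1 - q ^ k) \<le> 1 + norm q ^ k"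
      by (metis norm_one norm_power norm_triangle_ineq4)
    thus "norm (1 - q ^ k) \<le> exp (norm q ^ k)"
      using exp_ge_add_one_self[of "norm q ^ k"] by linarith
  qed auto
  also have "\<dots> = exp (\<Sum>k\<in>A. norm q ^ k)" using assms by (simp add: exp_sum)
  also have "(\<Sum>k\<in>A. norm q ^ k) \<le> (\<Sum>k. norm q ^ k)"
    using assms by (intro sum_le_suminf) (auto intro: summable_geometric)
  also have "\<dots> = 1 / (1 - norm q)" using assms by (simp add: suminf_geometric)
  finally show ?thesis by simp
qed

lemma summable_norm_power:
  fixes q :: complex
  assumes "norm q < 1"
  shows "(\<lambda>n. norm (q ^ n)) summable_on UNIV"
  using assms by (intro norm_summable_imp_summable_on) (simp add: norm_power summable_geometric)

text \<open>The series over all integers rewritten as a power series in q, so that coefficients can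
  be compared later on.\<close>

definition pent_coeff :: "nat \<Rightarrow> complex" where
  "pent_coeff n = (if n \<in> range pent then (-1) ^ nat \<bar>inv_into UNIV pent n\<bar> else 0)"

lemma pent_coeff_pent: "pent_coeff (pent k) = (-1) ^ nat \<bar>k\<bar>"
  by (simp add: pent_coeff_def inv_f_f[OF inj_pent])

theorem pentagonal_number_theorem:
  assumes "norm q < 1"
  shows "((\<lambda>k. (-1) ^ nat \<bar>k\<bar> * q ^ pent k) has_sum euler_prod q) UNIV"
proof -
  let ?f = "\<lambda>k. (-1) ^ nat \<bar>k\<bar> * q ^ pent k"
  have "(\<lambda>n. norm (q ^ n)) summable_on range pent"
    using summable_norm_power[OF assms] by (rule summable_on_subset) auto
  hence "(\<lambda>k. norm (q ^ pent k)) summable_on UNIV"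
    by (subst (asm) summable_on_reindex[OF inj_pent]) (simp add: o_def)
  hence "?f summable_on UNIV"
    by (intro abs_summable_summable[where f = ?f]) (simp add: norm_mult norm_power)
  then obtain S where S: "(?f has_sum S) UNIV" by (auto simp: summable_on_def)
  have "filterlim (\<lambda>n. {- int n..int n}) (finite_subsets_at_top UNIV) sequentially"
    unfolding filterlim_finite_subsets_at_top
  proof safe
    fix X :: "int set" assume X: "finite X"
    define m where "m = Max (abs ` X)"
    have m: "\<bar>k\<bar> \<le> m" if "k \<in> X" for k using that X by (auto simp: m_def)
    show "\<forall>\<^sub>F n in sequentially. finite {- int n..int n} \<and> X \<subseteq> {- int n..int n} \<and>
            {- int n..int n} \<subseteq> UNIV"
      using eventually_ge_at_top[of "nat m"]
    proof eventually_elim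
      case (elim n)
      thus ?case using m by fastforce
    qed
  qed
  with S have "(\<lambda>n. sum ?f {- int n..int n}) \<longlonglongrightarrow> S"
    unfolding has_sum_def by (rule filterlim_compose)
  moreover have "(\<lambda>n. sum ?f {- int n..int n}) \<longlonglongrightarrow> euler_prod q"
  proof -
    let ?P = "\<lambda>n. \<Prod>k\<in>{0<..n}. 1 - q ^ k"
    let ?M = "exp (1 / (1 - norm q))"
    have P: "?P \<longlonglongrightarrow> euler_prod q"
    proof -
      have "(\<lambda>N. \<Prod>n\<le>N. 1 - q ^ Suc n) \<longlonglongrightarrow> euler_prod q"
        unfolding euler_prod_def by (intro convergent_prod_LIMSEQ euler_prod_convergent assms)
      hence "(\<lambda>N. \<Prod>n<N. 1 - q ^ Suc n) \<longlonglongrightarrow> euler_prod q"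
        using LIMSEQ_lessThan_iff_atMost by blast
      moreover have "(\<Prod>n<N. 1 - q ^ Suc n) = ?P N" for N
        by (rule prod.reindex_bij_witness[of _ "\<lambda>k. k - 1" Suc]) auto
      ultimately show ?thesis by simp
    qed
    \<comment> \<open>Each of the n terms with s \<ge> 1 in \<open>shanks_identity\<close> has an
      exponent s n + ... of size at least n.\<close>
    have "norm (sum ?f {- int n..int n} - ?P n) \<le> ?M * (of_nat n * norm q ^ n)" for n
    proof -
      let ?t = "\<lambda>s. (-1) ^ s * (\<Prod>k\<in>{s<..n}. 1 - q ^ k) * q ^ (s * n + \<Sum>{..s})"
      have "sum ?f {- int n..int n} - ?P n = (\<Sum>s\<in>{0<..n}. ?t s)"
      proof -
        have "{..n} = insert 0 {0<..n}" by auto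
        hence "sum ?t {..n} = ?t 0 + (\<Sum>s\<in>{0<..n}. ?t s)" by simp
        thus ?thesis by (subst (asm) shanks_identity) simp
      qed
      also have "norm \<dots> \<le> (\<Sum>s\<in>{0<..n}. ?M * norm q ^ n)"
      proof (intro sum_norm_le)
        fix s assume s: "s \<in> {0<..n}"
        have "norm q ^ (s * n + \<Sum>{..s}) \<le> norm q ^ n"
          using assms s by (intro power_decreasing) (auto intro: trans_le_add1)
        thus "norm (?t s) \<le> ?M * norm q ^ n"
          using norm_prod_one_minus_le[OF assms, of "{s<..n}"]
          by (simp add: norm_mult norm_power mult_mono)
      qed
      finally show ?thesis by (simp add: algebra_simps)
    qed
    hence "\<forall>\<^sub>F n in sequentially.
        norm (sum ?f {- int n..int n} - ?P n) \<le> ?M * (of_nat n * norm q ^ n)" by simp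
    moreover have "(\<lambda>n. ?M * (of_nat n * norm q ^ n)) \<longlonglongrightarrow> ?M * 0"
      using assms by (intro tendsto_mult_left powser_times_n_limit_0) simp
    ultimately have "(\<lambda>n. sum ?f {- int n..int n} - ?P n) \<longlonglongrightarrow> 0"
      by (rule Lim_null_comparison[OF _ tendsto_eq_rhs]) simp
    from tendsto_add[OF this P] show ?thesis by simp
  qed
  ultimately have "S = euler_prod q" by (rule LIMSEQ_unique)
  with S show ?thesis by simp
qed

corollary euler_prod_has_sum_pent_coeff:
  assumes "norm q < 1"
  shows "((\<lambda>n. pent_coeff n * q ^ n) has_sum euler_prod q) UNIV"
proof -
  have "((\<lambda>n. pent_coeff n * q ^ n) has_sum euler_prod q) (range pent)"
    using pentagonal_number_theorem[OF assms]
    by (subst has_sum_reindex[OF inj_pent]) (simp add: o_def pent_coeff_pent)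
  thus ?thesis
    by (rule has_sum_cong_neutral[THEN iffD1, rotated -1]) (auto simp: pent_coeff_def)
qed

section \<open>Inversion of the odd theta function\<close>

definition qpoch :: "complex \<Rightarrow> complex \<Rightarrow> complex" where
  "qpoch a q = (\<Prod>n. 1 - a * q ^ n)"

lemma qpoch_convergent:
  assumes "norm q < 1"
  shows "convergent_prod (\<lambda>n. 1 - a * q ^ n :: complex)"
proof -
  have "summable (\<lambda>n. norm a * norm q ^ n)"
    using assms by (intro summable_mult summable_geometric) simp
  hence "abs_convergent_prod (\<lambda>n. 1 - a * q ^ n)"
    unfolding abs_convergent_prod_conv_summable by (simp add: norm_mult norm_power)
  thus ?thesis by (rule abs_convergent_prod_imp_convergent_prod)
qed

lemma qpoch_LIMSEQ:
  assumes "norm q < 1"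
  shows "(\<lambda>N. \<Prod>n<N. 1 - a * q ^ n) \<longlonglongrightarrow> qpoch a q"
  using convergent_prod_LIMSEQ[OF qpoch_convergent[OF assms, of a]]
  unfolding qpoch_def LIMSEQ_lessThan_iff_atMost[of "\<lambda>A. \<Prod>n\<in>A. 1 - a * q ^ n"] .

lemma euler_prod_eq_qpoch: "euler_prod q = qpoch q q"
  by (simp add: euler_prod_def qpoch_def)

lemma qpoch_nonzero:
  assumes "norm q < 1" and "\<And>n. a * q ^ n \<noteq> 1"
  shows "qpoch a q \<noteq> 0"
  unfolding qpoch_def
  by (rule prodinf_nonzero[OF qpoch_convergent[OF assms(1)]]) (metis assms(2) right_minus_eq)

lemma qpoch_rec:
  assumes "norm q < 1"
  shows "qpoch a q = (1 - a) * qpoch (a * q) q"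
proof (rule LIMSEQ_unique)
  show "(\<lambda>N. \<Prod>n<Suc N. 1 - a * q ^ n) \<longlonglongrightarrow> qpoch a q"
    using qpoch_LIMSEQ[OF assms, of a] by (rule LIMSEQ_Suc)
  have "(\<lambda>N. (1 - a) * (\<Prod>n<N. 1 - a * q * q ^ n)) \<longlonglongrightarrow> (1 - a) * qpoch (a * q) q"
    by (intro tendsto_mult_left qpoch_LIMSEQ assms)
  thus "(\<lambda>N. \<Prod>n<Suc N. 1 - a * q ^ n) \<longlonglongrightarrow> (1 - a) * qpoch (a * q) q"
    by (simp add: prod.lessThan_Suc_shift mult.assoc del: prod.lessThan_Suc)
qed

lemma qpoch_mult_minus:
  assumes "norm q < 1"
  shows "qpoch a q * qpoch (- a) q = qpoch (a\<^sup>2) (q\<^sup>2)"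
proof (rule LIMSEQ_unique)
  show "(\<lambda>N. (\<Prod>n<N. 1 - a * q ^ n) * (\<Prod>n<N. 1 - (- a) * q ^ n)) \<longlonglongrightarrow> qpoch a q * qpoch (- a) q"
    by (intro tendsto_mult qpoch_LIMSEQ assms)
  have "(1 - a * q ^ n) * (1 - (- a) * q ^ n) = 1 - a\<^sup>2 * (q\<^sup>2) ^ n" for n
    by (simp add: algebra_simps power2_eq_square power_mult_distrib)
  moreover have "norm (q\<^sup>2) < 1" using assms by (simp add: norm_power power_less_one_iff)
  ultimately show "(\<lambda>N. (\<Prod>n<N. 1 - a * q ^ n) * (\<Prod>n<N. 1 - (- a) * q ^ n)) \<longlonglongrightarrow>
      qpoch (a\<^sup>2) (q\<^sup>2)"
    unfolding prod.distrib[symmetric] using qpoch_LIMSEQ[of "q\<^sup>2" "a\<^sup>2"] by simp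
qed

lemma qpoch_split:
  assumes "norm q < 1"
  shows "qpoch a q = qpoch a (q\<^sup>2) * qpoch (a * q) (q\<^sup>2)"
proof (rule LIMSEQ_unique)
  have "filterlim (\<lambda>N::nat. 2 * N) at_top at_top"
    by (rule filterlim_subseq) (simp add: strict_mono_def)
  from filterlim_compose[OF qpoch_LIMSEQ[OF assms] this]
  show "(\<lambda>N. \<Prod>n<2 * N. 1 - a * q ^ n) \<longlonglongrightarrow> qpoch a q" .
  have "norm (q\<^sup>2) < 1" using assms by (simp add: norm_power power_less_one_iff)
  hence "(\<lambda>N. (\<Prod>n<N. 1 - a * (q\<^sup>2) ^ n) * (\<Prod>n<N. 1 - a * q * (q\<^sup>2) ^ n)) \<longlonglongrightarrow>
      qpoch a (q\<^sup>2) * qpoch (a * q) (q\<^sup>2)"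
    by (intro tendsto_mult qpoch_LIMSEQ)
  moreover have "(\<Prod>n<N. 1 - a * (q\<^sup>2) ^ n) * (\<Prod>n<N. 1 - a * q * (q\<^sup>2) ^ n) =
      (\<Prod>n<2 * N. 1 - a * q ^ n)" for N
    by (induction N) (simp_all add: power_mult[symmetric] power_Suc mult.assoc)
  ultimately show "(\<lambda>N. \<Prod>n<2 * N. 1 - a * q ^ n) \<longlonglongrightarrow> qpoch a (q\<^sup>2) * qpoch (a * q) (q\<^sup>2)"
    by simp
qed

text \<open>Euler's theorem that partitions into distinct parts and into odd parts are equinumerous.
  It removes all q-products from \<open>odd_theta_half_periods\<close>.\<close>

lemma qpoch_euler_identity:
  assumes "norm q < 1"
  shows "qpoch (- q) q * qpoch q (q\<^sup>2) = 1"
proof -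
  have q2: "norm (q\<^sup>2) < 1" using assms by (simp add: norm_power power_less_one_iff)
  have "qpoch q q * qpoch (- q) q = qpoch (q\<^sup>2) (q\<^sup>2)" by (rule qpoch_mult_minus[OF assms])
  moreover have "qpoch q q = qpoch q (q\<^sup>2) * qpoch (q\<^sup>2) (q\<^sup>2)"
    using qpoch_split[OF assms, of q] by (simp add: power2_eq_square)
  moreover have "qpoch (q\<^sup>2) (q\<^sup>2) \<noteq> 0"
    using euler_prod_nonzero[OF q2] by (simp add: euler_prod_eq_qpoch)
  ultimately show ?thesis by (auto simp: mult.commute)
qed

lemma qpoch_holomorphic:
  assumes "norm q < 1"
  shows "(\<lambda>a. qpoch a q) holomorphic_on UNIV"
proof (rule holomorphic_uniform_sequence[where f = "\<lambda>N a. \<Prod>n<N. 1 - a * q ^ n"])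
  fix x :: complex assume "x \<in> UNIV"
  have le: "norm y \<le> norm x + 1" if "y \<in> cball x 1" for y
    using that norm_triangle_sub[of y x] by (simp add: dist_norm norm_minus_commute)
  have "uniformly_convergent_on (cball x 1) (\<lambda>N a. \<Prod>n<N. 1 + (- (a * q ^ n)))"
  proof (rule uniformly_convergent_on_prod)
    show "uniformly_convergent_on (cball x 1) (\<lambda>N a. \<Sum>n<N. norm (- (a * q ^ n)))"
    proof (rule Weierstrass_m_test')
      show "summable (\<lambda>n. (norm x + 1) * norm q ^ n)"
        using assms by (intro summable_mult summable_geometric) simp
      show "norm (norm (- (y * q ^ n))) \<le> (norm x + 1) * norm q ^ n" if "y \<in> cball x 1" for n y
        using le[OF that] by (simp add: norm_mult norm_power mult_right_mono)
    qed
  qed (auto intro!: continuous_intros)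
  then obtain g where g: "uniform_limit (cball x 1) (\<lambda>N a. \<Prod>n<N. 1 - a * q ^ n) g sequentially"
    by (auto simp: uniformly_convergent_on_def)
  have "g y = qpoch y q" if "y \<in> cball x 1" for y
    using tendsto_uniform_limitI[OF g that] qpoch_LIMSEQ[OF assms] by (rule LIMSEQ_unique)
  hence "uniform_limit (cball x 1) (\<lambda>N a. \<Prod>n<N. 1 - a * q ^ n) (\<lambda>a. qpoch a q) sequentially"
    using g by (subst uniform_limit_cong'[where g = "\<lambda>N a. \<Prod>n<N. 1 - a * q ^ n" and i = g]) auto
  thus "\<exists>d>0. cball x d \<subseteq> UNIV \<and>
      uniform_limit (cball x d) (\<lambda>N a. \<Prod>n<N. 1 - a * q ^ n) (\<lambda>a. qpoch a q) sequentially"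
    by (intro exI[of _ 1]) auto
qed (auto intro!: holomorphic_intros)

lemma holomorphic_on_qpoch [holomorphic_intros]:
  assumes "norm q < 1" and "f holomorphic_on S"
  shows "(\<lambda>z. qpoch (f z) q) holomorphic_on S"
  using holomorphic_on_compose_gen[OF assms(2) qpoch_holomorphic[OF assms(1)]]
  by (simp add: o_def)

section \<open>The nome and the elementary properties of the odd theta function\<close>

lemma nome_add: "nome (x + y) = nome x * nome y"
  by (simp add: nome_def ring_distribs exp_add)

lemma nome_minus: "nome (- x) = inverse (nome x)"
  by (simp add: nome_def exp_minus)

lemma nome_diff: "nome (x - y) = nome x / nome y"
  by (simp add: nome_def ring_distribs exp_diff)

lemma nome_nonzero [simp]: "nome x \<noteq> 0"
  by (simp add: nome_def)

lemma nome_of_nat_mult: "nome (of_nat n * x) = nome x ^ n"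
  by (simp add: nome_def exp_of_nat_mult[symmetric] mult_ac)

lemma nome_eq_1_iff: "nome z = 1 \<longleftrightarrow> (\<exists>n::int. z = of_int n)"
proof -
  have "nome z = 1 \<longleftrightarrow> (\<exists>n::int. 2 * of_real pi * \<i> * z = of_int (2 * n) * of_real pi * \<i>)"
    using exp_eq[of "2 * of_real pi * \<i> * z" 0] by (simp add: nome_def)
  also have "\<dots> \<longleftrightarrow> (\<exists>n::int. z = of_int n)" by auto
  finally show ?thesis .
qed

lemma nome_of_int [simp]: "nome (of_int n) = 1"
  using nome_eq_1_iff by blast

lemma nome_1 [simp]: "nome 1 = 1" and nome_0 [simp]: "nome 0 = 1"
  using nome_of_int[of 1] nome_of_int[of 0] by simp_all

lemma nome_half: "nome (1 / 2) = - 1"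
  by (simp add: nome_def)

lemma nome_minus_quarter: "nome (- (1 / 4)) = - \<i>"
proof -
  have "nome (- (1 / 4)) = cis (- (pi / 2))" by (simp add: nome_def cis_conv_exp field_simps)
  also have "\<dots> = - \<i>" by (simp add: complex_eq_iff)
  finally show ?thesis .
qed

lemma norm_nome: "norm (nome \<tau>) = exp (- 2 * pi * Im \<tau>)"
  by (simp add: nome_def norm_exp_eq_Re)

lemma norm_nome_less_1: "Im \<tau> > 0 \<Longrightarrow> norm (nome \<tau>) < 1"
  by (simp add: norm_nome)

lemma holomorphic_on_nome [holomorphic_intros]:
  "f holomorphic_on S \<Longrightarrow> (\<lambda>z. nome (f z)) holomorphic_on S"
  unfolding nome_def by (intro holomorphic_intros)

lemma Im_minus_inverse_pos: "Im \<tau> > 0 \<Longrightarrow> Im (- 1 / \<tau>) > 0"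
  by (auto simp: Im_divide complex_eq_iff divide_simps sum_power2_gt_zero_iff)

text \<open>Up to a factor depending only on \<open>\<tau>\<close>, this is the odd Jacobi theta function.\<close>

definition odd_theta :: "complex \<Rightarrow> complex \<Rightarrow> complex" where
  "odd_theta z \<tau> = nome (- z / 2) * qpoch (nome z) (nome \<tau>) * qpoch (nome (\<tau> - z)) (nome \<tau>)"

text \<open>Splits off the simple zero at z = 0, which makes oddness visible and limits of theta
  quotients at 0 computable.\<close>

lemma odd_theta_factor:
  assumes "Im \<tau> > 0"
  shows "odd_theta z \<tau> = (1 - nome z) *
    (nome (- z / 2) * qpoch (nome (z + \<tau>)) (nome \<tau>) * qpoch (nome (\<tau> - z)) (nome \<tau>))"
  unfolding odd_theta_def
  by (subst qpoch_rec[OF norm_nome_less_1[OF assms], of "nome z"]) (simp add: nome_add mult_ac)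

lemma odd_theta_holomorphic:
  assumes "Im \<tau> > 0"
  shows "(\<lambda>z. odd_theta z \<tau>) holomorphic_on UNIV"
  unfolding odd_theta_def using norm_nome_less_1[OF assms] by (intro holomorphic_intros) auto

lemma odd_theta_plus_1: "odd_theta (z + 1) \<tau> = - odd_theta z \<tau>"
proof -
  have "nome (- (z + 1) / 2) = nome (- z / 2) * nome (- (1 / 2))"
    unfolding nome_add[symmetric] by (simp add: field_simps)
  moreover have "nome (\<tau> - (z + 1)) = nome (\<tau> - z)"
    by (simp add: nome_diff nome_add)
  ultimately show ?thesis
    unfolding odd_theta_def by (simp only: nome_minus nome_half) (simp add: nome_add)
qed

lemma odd_theta_plus_period:
  assumes "Im \<tau> > 0"
  shows "odd_theta (z + \<tau>) \<tau> = - nome (- \<tau> / 2 - z) * odd_theta z \<tau>"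
proof -
  let ?q = "nome \<tau>" and ?w = "nome z"
  note q = norm_nome_less_1[OF assms]
  have 1: "(1 - ?w) * qpoch (?w * ?q) ?q = qpoch ?w ?q" using qpoch_rec[OF q, of ?w] by simp
  have 2: "qpoch (1 / ?w) ?q = (1 - 1 / ?w) * qpoch (?q / ?w) ?q"
    using qpoch_rec[OF q, of "1 / ?w"] by simp
  have "odd_theta (z + \<tau>) \<tau> = nome (- z / 2) * nome (- \<tau> / 2) * qpoch (?w * ?q) ?q *
      qpoch (1 / ?w) ?q"
    unfolding odd_theta_def by (simp add: nome_add nome_diff nome_minus field_simps flip: nome_add)
  also have "\<dots> = - nome (- z / 2) * nome (- \<tau> / 2) / ?w * ((1 - ?w) * qpoch (?w * ?q) ?q) *
      qpoch (?q / ?w) ?q"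
    unfolding 2 by (simp add: field_simps)
  also have "\<dots> = - nome (- \<tau> / 2 - z) * odd_theta z \<tau>"
    unfolding 1 odd_theta_def by (simp add: nome_diff)
  finally show ?thesis .
qed

lemma odd_theta_minus:
  assumes "Im \<tau> > 0"
  shows "odd_theta (- z) \<tau> = - odd_theta z \<tau>"
proof -
  have w: "nome (z / 2) * nome (z / 2) = nome z" by (simp flip: nome_add)
  have "nome (z / 2) * (1 - nome (- z)) = - (nome (- z / 2) * (1 - nome z))"
    by (simp add: nome_minus field_simps flip: w)
  hence "nome (z / 2) * (1 - nome (- z)) * X = - (nome (- z / 2) * (1 - nome z)) * X" for X
    by (rule arg_cong)
  from this[of "qpoch (nome (\<tau> - z)) (nome \<tau>) * qpoch (nome (\<tau> + z)) (nome \<tau>)"] show ?thesis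
    unfolding odd_theta_factor[OF assms] by (simp add: add.commute mult_ac)
qed

definition period_lattice :: "complex \<Rightarrow> complex set" where
  "period_lattice \<tau> = {of_int m + of_int n * \<tau> | m n. True}"

lemma odd_theta_nonzero:
  assumes "Im \<tau> > 0" and "z \<notin> period_lattice \<tau>"
  shows "odd_theta z \<tau> \<noteq> 0"
proof -
  have "nome z * nome \<tau> ^ n \<noteq> 1" for n
  proof
    assume "nome z * nome \<tau> ^ n = 1"
    hence "nome (z + of_nat n * \<tau>) = 1" by (simp add: nome_add nome_of_nat_mult)
    then obtain m :: int where "z + of_nat n * \<tau> = of_int m" by (auto simp: nome_eq_1_iff)
    hence "z = of_int m + of_int (- int n) * \<tau>" by (simp add: algebra_simps)
    thus False using assms(2) unfolding period_lattice_def by blast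
  qed
  moreover have "nome (\<tau> - z) * nome \<tau> ^ n \<noteq> 1" for n
  proof
    assume "nome (\<tau> - z) * nome \<tau> ^ n = 1"
    hence "nome (\<tau> - z + of_nat n * \<tau>) = 1" by (simp add: nome_add nome_of_nat_mult)
    then obtain m :: int where "\<tau> - z + of_nat n * \<tau> = of_int m" by (auto simp: nome_eq_1_iff)
    hence "z = of_int (- m) + of_int (int n + 1) * \<tau>" by (simp add: algebra_simps)
    thus False using assms(2) unfolding period_lattice_def by blast
  qed
  ultimately show ?thesis
    unfolding odd_theta_def using qpoch_nonzero[OF norm_nome_less_1[OF assms(1)]] by simp
qed

text \<open>Each of the three values is an elementary factor times the square of a q-product, and
  the three q-products multiply to 1 by \<open>qpoch_euler_identity\<close>. This elimination is
  what later isolates the constant in the inversion formula.\<close>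

lemma odd_theta_half_periods:
  assumes "Im \<tau> > 0"
  shows "odd_theta (1 / 2) \<tau> * odd_theta (\<tau> / 2) \<tau> * odd_theta ((1 + \<tau>) / 2) \<tau> =
      - 2 * nome (- \<tau> / 2)"
proof -
  note q = norm_nome_less_1[OF assms]
  define p where "p = nome (\<tau> / 2)"
  have p2: "p\<^sup>2 = nome \<tau>" unfolding p_def power2_eq_square by (simp flip: nome_add)
  note quarter = nome_minus_quarter
  have 1: "odd_theta (1 / 2) \<tau> = - 2 * \<i> * (qpoch (- nome \<tau>) (nome \<tau>))\<^sup>2"
    unfolding odd_theta_def
    by (subst qpoch_rec[OF q, of "nome (1 / 2)"])
       (simp add: nome_half nome_diff power2_eq_square quarter)
  have 2: "odd_theta (\<tau> / 2) \<tau> = nome (- \<tau> / 4) * (qpoch p (nome \<tau>))\<^sup>2"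
    unfolding odd_theta_def by (simp add: p_def power2_eq_square)
  have 3: "odd_theta ((1 + \<tau>) / 2) \<tau> = - \<i> * nome (- \<tau> / 4) * (qpoch (- p) (nome \<tau>))\<^sup>2"
  proof -
    have "nome ((1 + \<tau>) / 2) = - p" by (simp add: p_def add_divide_distrib nome_add nome_half)
    moreover have "\<tau> - (1 + \<tau>) / 2 = \<tau> / 2 - 1 / 2" by (simp add: field_simps)
    hence "nome (\<tau> - (1 + \<tau>) / 2) = - p" by (simp only: nome_diff nome_half p_def) simp
    moreover have "- ((1 + \<tau>) / 2) / 2 = - (1 / 4) + (- \<tau> / 4)" by (simp add: field_simps)
    hence "nome (- ((1 + \<tau>) / 2) / 2) = - \<i> * nome (- \<tau> / 4)" by (simp only: nome_add quarter)
    ultimately show ?thesis unfolding odd_theta_def by (simp add: power2_eq_square)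
  qed
  have "qpoch p (nome \<tau>) * qpoch (- p) (nome \<tau>) = qpoch (nome \<tau>) ((nome \<tau>)\<^sup>2)"
    using qpoch_mult_minus[OF q, of p] by (simp add: p2)
  hence "qpoch (- nome \<tau>) (nome \<tau>) * (qpoch p (nome \<tau>) * qpoch (- p) (nome \<tau>)) = 1"
    using qpoch_euler_identity[OF q] by simp
  moreover have "odd_theta (1 / 2) \<tau> * odd_theta (\<tau> / 2) \<tau> * odd_theta ((1 + \<tau>) / 2) \<tau> =
      - 2 * (nome (- \<tau> / 4) * nome (- \<tau> / 4)) *
      (qpoch (- nome \<tau>) (nome \<tau>) * (qpoch p (nome \<tau>) * qpoch (- p) (nome \<tau>)))\<^sup>2"
    unfolding 1 2 3 by (simp add: power2_eq_square field_simps)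
  moreover have "nome (- \<tau> / 4) * nome (- \<tau> / 4) = nome (- \<tau> / 2)" by (simp flip: nome_add)
  ultimately show ?thesis by simp
qed

lemma nome_deriv_0: "((\<lambda>z. (nome (z * c) - 1) / z) \<longlongrightarrow> 2 * of_real pi * \<i> * c) (at 0)"
proof -
  have "((\<lambda>z. nome (z * c)) has_field_derivative 2 * of_real pi * \<i> * c) (at 0)"
    unfolding nome_def by (auto intro!: derivative_eq_intros)
  thus ?thesis by (simp add: has_field_derivative_iff)
qed

text \<open>As functions of z, both sides pick up the same factors under z + 1 and z + \<tau>. Their
  quotient is doubly periodic, and its only possible singularities, at lattice points, are
  removable. By Liouville it is constant, with the value given by the ratio of the two simple zeros
  at z = 0.\<close>

lemma odd_theta_inversion:
  assumes \<tau>: "Im \<tau> > 0" and z: "z \<notin> period_lattice \<tau>"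
  shows "nome (- z\<^sup>2 / (2 * \<tau>)) * odd_theta (z / \<tau>) (- 1 / \<tau>) =
    (euler_prod (nome (- 1 / \<tau>)))\<^sup>2 / (\<tau> * (euler_prod (nome \<tau>))\<^sup>2) * odd_theta z \<tau>"
proof -
  define \<tau>' where "\<tau>' = - 1 / \<tau>"
  have \<tau>': "Im \<tau>' > 0" unfolding \<tau>'_def by (rule Im_minus_inverse_pos[OF \<tau>])
  have \<tau>0: "\<tau> \<noteq> 0" using \<tau> by auto
  define L where "L = (euler_prod (nome \<tau>'))\<^sup>2 / (\<tau> * (euler_prod (nome \<tau>))\<^sup>2)"
  define N where "N = (\<lambda>z. nome (- z\<^sup>2 / (2 * \<tau>)) * odd_theta (z / \<tau>) \<tau>')"
  \<comment> \<open>The default value \<open>L\<close> is the limit at 0 found in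
    \<open>R_lim\<close>, so that \<open>R\<close> is the continuous extension of the
    quotient.\<close>
  define R where "R = (\<lambda>z. if odd_theta z \<tau> = 0 then L else N z / odd_theta z \<tau>)"
  have hol_N: "N holomorphic_on UNIV"
  proof -
    have "((\<lambda>z. odd_theta z \<tau>') \<circ> (\<lambda>z. z / \<tau>)) holomorphic_on UNIV"
      by (rule holomorphic_on_compose_gen[OF _ odd_theta_holomorphic[OF \<tau>']])
         (auto intro!: holomorphic_intros simp: \<tau>0)
    thus ?thesis unfolding N_def by (auto intro!: holomorphic_intros simp: \<tau>0 o_def)
  qed
  have N_1: "N (z + 1) = - N z" for z
  proof -
    have "odd_theta (z / \<tau>) \<tau>' = - nome (\<tau>' / 2 - z / \<tau>) * odd_theta ((z + 1) / \<tau>) \<tau>'"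
    proof -
      have "(z + 1) / \<tau> + \<tau>' = z / \<tau>" "- \<tau>' / 2 - (z + 1) / \<tau> = \<tau>' / 2 - z / \<tau>"
        using \<tau>0 by (simp_all add: \<tau>'_def field_simps)
      thus ?thesis using odd_theta_plus_period[OF \<tau>', of "(z + 1) / \<tau>"] by (simp only:)
    qed
    hence "odd_theta ((z + 1) / \<tau>) \<tau>' = - nome (z / \<tau> - \<tau>' / 2) * odd_theta (z / \<tau>) \<tau>'"
      by (simp add: nome_diff)
    moreover have "- (z + 1)\<^sup>2 / (2 * \<tau>) = - z\<^sup>2 / (2 * \<tau>) - (z / \<tau> - \<tau>' / 2)"
      using \<tau>0 by (simp add: \<tau>'_def field_simps power2_eq_square)
    ultimately show ?thesis unfolding N_def by (simp only: nome_diff) simp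
  qed
  have N_\<tau>: "N (z + \<tau>) = - nome (- \<tau> / 2 - z) * N z" for z
  proof -
    have "(z + \<tau>) / \<tau> = z / \<tau> + 1" using \<tau>0 by (simp add: field_simps)
    moreover have "- (z + \<tau>)\<^sup>2 / (2 * \<tau>) = - z\<^sup>2 / (2 * \<tau>) + (- \<tau> / 2 - z)"
      using \<tau>0 by (simp add: field_simps power2_eq_square)
    ultimately show ?thesis unfolding N_def
      by (simp only: nome_add odd_theta_plus_1) simp
  qed
  have R_1: "R (z + 1) = R z" for z
    by (simp add: R_def N_1 odd_theta_plus_1)
  have R_\<tau>: "R (z + \<tau>) = R z" for z
    by (simp add: R_def N_\<tau> odd_theta_plus_period[OF \<tau>])
  interpret one: periodic_fun_simple R 1 by unfold_locales (rule R_1)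
  interpret tau: periodic_fun_simple R \<tau> by unfold_locales (rule R_\<tau>)
  have R_lattice: "R (z + (of_int m + of_int n * \<tau>)) = R z" for z m n
    using one.plus_of_int[of "z + of_int n * \<tau>" m] tau.plus_of_int[of z n]
    by (simp add: add_ac)
  \<comment> \<open>Theta without its zero at the origin. Its value at 0 is the square of the Euler
    product, the source of both squares in \<open>L\<close>.\<close>
  define F where "F = (\<lambda>\<tau> z. nome (- z / 2) * qpoch (nome (z + \<tau>)) (nome \<tau>) * qpoch (nome (\<tau> -
      z)) (nome \<tau>))"
  have F_0: "(F t \<longlongrightarrow> (euler_prod (nome t))\<^sup>2) (at 0)" if "Im t > 0" for t
  proof -
    have "F t holomorphic_on UNIV"
      unfolding F_def using norm_nome_less_1[OF that] by (intro holomorphic_intros) auto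
    hence "continuous_on UNIV (F t)" by (rule holomorphic_on_imp_continuous_on)
    hence "isCont (F t) 0" by (simp add: continuous_on_eq_continuous_at)
    thus ?thesis
      by (simp add: isCont_def F_def euler_prod_eq_qpoch power2_eq_square)
  qed
  have F_\<tau>'_0: "((\<lambda>z. F \<tau>' (z / \<tau>)) \<longlongrightarrow> (euler_prod (nome \<tau>'))\<^sup>2) (at 0)"
  proof (rule filterlim_compose[OF F_0[OF \<tau>']])
    show "filterlim (\<lambda>z. z / \<tau>) (at 0) (at 0)"
      using \<tau>0 by (auto simp: filterlim_at eventually_at_filter intro!: tendsto_eq_intros)
  qed
  have theta_F: "odd_theta z t = (1 - nome z) * F t z" if "Im t > 0" for t z
    unfolding F_def by (rule odd_theta_factor[OF that])
  have E0: "euler_prod (nome \<tau>) \<noteq> 0" by (rule euler_prod_nonzero[OF norm_nome_less_1[OF \<tau>]])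
  have nome_lim: "((\<lambda>z. (nome z - 1) / z) \<longlongrightarrow> 2 * of_real pi * \<i>) (at 0)"
    using nome_deriv_0[of 1] by simp
  have ev_nz: "eventually (\<lambda>z. odd_theta z \<tau> \<noteq> 0) (at 0)"
  proof -
    have "eventually (\<lambda>z. (nome z - 1) / z \<noteq> 0) (at 0)"
      by (rule tendsto_imp_eventually_ne[OF nome_lim]) simp
    moreover have "eventually (\<lambda>z. F \<tau> z \<noteq> 0) (at 0)"
      by (rule tendsto_imp_eventually_ne[OF F_0[OF \<tau>]]) (simp add: E0)
    ultimately show ?thesis
      by eventually_elim (auto simp: theta_F[OF \<tau>])
  qed
  have R_lim: "(R \<longlongrightarrow> L) (at 0)"
  proof -
    have "((\<lambda>z. nome (- z\<^sup>2 / (2 * \<tau>)) * (((nome (z * (1 / \<tau>)) - 1) / z) / ((nome z - 1) / z) *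
            (F \<tau>' (z / \<tau>) / F \<tau> z))) \<longlongrightarrow>
          nome 0 * ((2 * of_real pi * \<i> * (1 / \<tau>)) / (2 * of_real pi * \<i>) *
            ((euler_prod (nome \<tau>'))\<^sup>2 / (euler_prod (nome \<tau>))\<^sup>2))) (at 0)"
    proof (intro tendsto_intros nome_lim nome_deriv_0 F_\<tau>'_0 F_0 \<tau>)
      have "isCont (\<lambda>z. nome (- z\<^sup>2 / (2 * \<tau>))) 0"
        unfolding nome_def by (intro continuous_intros) (simp add: \<tau>0)
      thus "((\<lambda>z. nome (- z\<^sup>2 / (2 * \<tau>))) \<longlongrightarrow> nome 0) (at 0)" by (simp add: isCont_def)
    qed (simp_all add: E0)
    moreover have "eventually (\<lambda>z. nome (- z\<^sup>2 / (2 * \<tau>)) * (((nome (z * (1 / \<tau>)) -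
        1) / z) / ((nome z - 1) / z) *
            (F \<tau>' (z / \<tau>) / F \<tau> z)) = R z) (at 0)"
      using ev_nz eventually_neq_at_within[of 0]
    proof eventually_elim
      case (elim z)
      hence "nome z \<noteq> 1" "F \<tau> z \<noteq> 0" by (auto simp: theta_F[OF \<tau>])
      thus ?case using elim
        by (simp add: R_def N_def theta_F[OF \<tau>] theta_F[OF \<tau>'] divide_simps) (simp add:
            algebra_simps)
    qed
    ultimately show ?thesis
      by (rule Lim_transform_eventually[THEN tendsto_eq_rhs]) (simp add: L_def)
  qed
  have R_0: "R 0 = L" by (simp add: R_def theta_F[OF \<tau>])
  have cont_theta: "continuous_on UNIV (\<lambda>z. odd_theta z \<tau>)"
    by (rule holomorphic_on_imp_continuous_on[OF odd_theta_holomorphic[OF \<tau>]])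
  define S where "S = {z. odd_theta z \<tau> \<noteq> 0}"
  have open_S: "open S" unfolding S_def using cont_theta by (intro open_Collect_neq) auto
  have hol_S: "R holomorphic_on S"
  proof -
    have "(\<lambda>z. N z / odd_theta z \<tau>) holomorphic_on S"
      using hol_N odd_theta_holomorphic[OF \<tau>]
      by (intro holomorphic_on_divide) (auto simp: S_def intro: holomorphic_on_subset)
    thus ?thesis by (rule holomorphic_transform) (simp add: R_def S_def)
  qed
  have diff_0: "R field_differentiable at 0"
  proof -
    obtain e where e: "e > 0" "\<And>z. z \<in> ball 0 e \<Longrightarrow> z \<noteq> 0 \<Longrightarrow> z \<in> S"
      using ev_nz by (auto simp: eventually_at S_def dist_norm)
    have "R holomorphic_on ball 0 e"
    proof (rule no_isolated_singularity'[where K = "{0}"])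
      show "(R \<longlongrightarrow> R z) (at z within ball 0 e)" if "z \<in> {0}" for z
        using that R_lim R_0 by (auto intro: tendsto_within_subset)
      show "R holomorphic_on ball 0 e - {0}"
        by (rule holomorphic_on_subset[OF hol_S]) (use e(2) in blast)
    qed auto
    thus ?thesis using e by (intro holomorphic_on_imp_differentiable_at) auto
  qed
  have "R field_differentiable at w" for w
  proof (cases "w \<in> S")
    case True
    thus ?thesis using hol_S open_S by (intro holomorphic_on_imp_differentiable_at)
  next
    case False
    hence "w \<in> period_lattice \<tau>" using odd_theta_nonzero[OF \<tau>] by (auto simp: S_def)
    then obtain m n where w: "w = of_int m + of_int n * \<tau>" by (auto simp: period_lattice_def)
    have "(\<lambda>z. R (z - w)) = R"
    proof
      fix z show "R (z - w) = R z" using R_lattice[of "z - w" m n] by (simp add: w)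
    qed
    moreover have "(R \<circ> (\<lambda>z. z - w)) field_differentiable at w"
      using diff_0 by (intro field_differentiable_compose) (auto intro!: derivative_intros
          field_differentiable_diff)
    ultimately show ?thesis by (simp add: o_def)
  qed
  hence hol: "R holomorphic_on UNIV" by (simp add: holomorphic_on_def)
  have "bounded (range R)"
  proof -
    define K where "K = (\<lambda>(s, t). of_real s + of_real t * \<tau>) ` ({0..1} \<times> {0..1::real})"
    have "compact K" unfolding K_def
      by (intro compact_continuous_image compact_Times) (auto intro!: continuous_intros simp:
          case_prod_unfold)
    hence "compact (R ` K)"
      by (intro compact_continuous_image continuous_on_subset[OF
          holomorphic_on_imp_continuous_on[OF hol]]) auto
    moreover have "range R \<subseteq> R ` K"
    proof safe
      fix w
      define t where "t = Im w / Im \<tau>"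
      define s where "s = Re w - t * Re \<tau>"
      have "w = of_real s + of_real t * \<tau>"
        using \<tau> by (simp add: complex_eq_iff s_def t_def)
      also have "\<dots> = (of_real (frac s) + of_real (frac t) * \<tau>) + (of_int \<lfloor>s\<rfloor> + of_int \<lfloor>t\<rfloor> * \<tau>)"
        by (simp add: frac_def algebra_simps)
      finally have "R w = R (of_real (frac s) + of_real (frac t) * \<tau>)"
        using R_lattice by simp
      moreover have "of_real (frac s) + of_real (frac t) * \<tau> \<in> K"
        unfolding K_def using frac_ge_0[of s] frac_lt_1[of s] frac_ge_0[of t] frac_lt_1[of t]
        by (intro image_eqI[of _ _ "(frac s, frac t)"]) auto
      ultimately show "R w \<in> R ` K" by simp
    qed
    ultimately show ?thesis using compact_imp_bounded bounded_subset by blast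
  qed
  with hol have "R constant_on UNIV" by (rule Liouville_theorem)
  hence "R z = R 0" by (auto simp: constant_on_def)
  thus ?thesis using odd_theta_nonzero[OF \<tau> z] unfolding R_0
    by (simp add: R_def N_def L_def \<tau>'_def field_simps)
qed

section \<open>Inversion of the eta function\<close>

lemma eta_eq: "eta \<tau> = nome (\<tau> / 24) * euler_prod (nome \<tau>)"
  by (simp add: eta_def nome_def)

lemma eta_nonzero: "Im \<tau> > 0 \<Longrightarrow> eta \<tau> \<noteq> 0"
  using euler_prod_nonzero[OF norm_nome_less_1] by (simp add: eta_eq)

lemma connected_upper_half_plane: "connected upper_half_plane"
  unfolding upper_half_plane_def by (rule connected_halfspace_Im_gt)

lemma holomorphic_on_disc_nome:
  assumes "F holomorphic_on ball 0 1" and "f holomorphic_on S" and "\<And>z. z \<in> S \<Longrightarrow> Im (f z) > 0"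
  shows "(\<lambda>z. F (nome (f z))) holomorphic_on S"
proof -
  have "(F \<circ> (\<lambda>z. nome (f z))) holomorphic_on S"
    using assms norm_nome_less_1
    by (intro holomorphic_on_compose_gen[OF _ assms(1)] holomorphic_intros) auto
  thus ?thesis by (simp add: o_def)
qed

lemma holomorphic_on_eta:
  assumes "f holomorphic_on S" and "\<And>z. z \<in> S \<Longrightarrow> Im (f z) > 0"
  shows "(\<lambda>z. eta (f z)) holomorphic_on S"
  unfolding eta_eq using assms
  by (intro holomorphic_intros holomorphic_on_disc_nome[OF euler_prod_holomorphic]) auto

text \<open>A continuous function into the finite set of n-th roots of c cannot jump on a connected
  set. This is how identities known for a power of eta descend to eta itself.\<close>

lemma constant_if_power_constant:
  fixes f :: "complex \<Rightarrow> complex"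
  assumes "continuous_on S f" and "connected S" and "\<And>z. z \<in> S \<Longrightarrow> f z ^ n = c" and "n > 0"
  shows "f constant_on S"
proof (rule continuous_finite_range_constant[OF assms(2,1)])
  have "finite {z::complex. z ^ n = c}" using assms(4) by (rule finite_nth_roots)
  thus "finite (f ` S)" by (rule finite_subset[rotated]) (use assms(3) in auto)
qed

text \<open>Multiplying \<open>odd_theta_inversion\<close> over the three half periods lets
  \<open>odd_theta_half_periods\<close> cancel all theta values. What remains is the cube of
  \<open>L\<close>, and \<open>L\<close> contains squares of Euler products; hence the sixth
  power.\<close>

lemma eta_inversion_power6:
  assumes \<tau>: "Im \<tau> > 0"
  shows "eta (- 1 / \<tau>) ^ 6 = (- \<i> * \<tau>) ^ 3 * eta \<tau> ^ 6"
proof -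
  define \<tau>' where "\<tau>' = - 1 / \<tau>"
  have \<tau>': "Im \<tau>' > 0" unfolding \<tau>'_def by (rule Im_minus_inverse_pos[OF \<tau>])
  have \<tau>0: "\<tau> \<noteq> 0" using \<tau> by auto
  define E where "E = euler_prod (nome \<tau>)"
  define E' where "E' = euler_prod (nome \<tau>')"
  define L where "L = E'\<^sup>2 / (\<tau> * E\<^sup>2)"
  have E0: "E \<noteq> 0" unfolding E_def by (rule euler_prod_nonzero[OF norm_nome_less_1[OF \<tau>]])
  have not_lattice: "z \<notin> period_lattice \<tau>" if "2 * z =
      of_int a + of_int b * \<tau>" "odd a \<or> odd b" for z a b
  proof
    assume "z \<in> period_lattice \<tau>"
    then obtain m n where "z = of_int m + of_int n * \<tau>" by (auto simp: period_lattice_def)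
    with that(1) have eq: "of_int (2 * m) + of_int (2 * n) * \<tau> = of_int a + of_int b * \<tau>"
      by (simp add: algebra_simps)
    have "Im (of_int (2 * m) + of_int (2 * n) * \<tau>) = Im (of_int a + of_int b * \<tau>)"
      by (simp only: eq)
    hence "of_int (2 * n) = (of_int b :: real)" using \<tau> by simp
    hence n: "2 * n = b" by (simp only: of_int_eq_iff)
    with eq have "of_int (2 * m) = (of_int a :: complex)" by simp
    hence "2 * m = a" by (simp only: of_int_eq_iff)
    with n that(2) show False by auto
  qed
  have inv: "nome (- z\<^sup>2 / (2 * \<tau>)) * odd_theta (z / \<tau>) \<tau>' =
      L * odd_theta z \<tau>" if "z \<notin> period_lattice \<tau>" for z
    using odd_theta_inversion[OF \<tau> that] by (simp add: \<tau>'_def L_def E_def E'_def)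
  \<comment> \<open>Division by \<tau> carries the half periods of the lattice of \<tau> to those of
    the lattice of \<tau>': 1/2 and \<tau>/2 change places, and (1+\<tau>)/2 keeps its type, up to
    sign and a period.\<close>
  have 1: "nome (- (1 / 2)\<^sup>2 / (2 * \<tau>)) * - odd_theta (\<tau>' / 2) \<tau>' = L * odd_theta (1 / 2) \<tau>"
  proof -
    have "(1 / 2) / \<tau> = - (\<tau>' / 2)" by (simp add: \<tau>'_def)
    thus ?thesis using inv[OF not_lattice[of _ 1 0], of "1 / 2"] odd_theta_minus[OF \<tau>'] by simp
  qed
  have 2: "nome (- (\<tau> / 2)\<^sup>2 / (2 * \<tau>)) * odd_theta (1 / 2) \<tau>' = L * odd_theta (\<tau> / 2) \<tau>"
  proof -
    have "(\<tau> / 2) / \<tau> = 1 / 2" using \<tau>0 by simp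
    thus ?thesis using inv[OF not_lattice[of _ 0 1], of "\<tau> / 2"] by (simp add: \<tau>0)
  qed
  have 3: "nome (- ((1 + \<tau>) / 2)\<^sup>2 / (2 * \<tau>)) * odd_theta ((1 + \<tau>') / 2) \<tau>' =
           L * odd_theta ((1 + \<tau>) / 2) \<tau>"
  proof -
    have "((1 + \<tau>) / 2) / \<tau> = - ((1 + \<tau>') / 2) + 1" using \<tau>0 by (simp add: \<tau>'_def field_simps)
    hence "odd_theta (((1 + \<tau>) / 2) / \<tau>) \<tau>' = odd_theta ((1 + \<tau>') / 2) \<tau>'"
      using odd_theta_minus[OF \<tau>'] by (simp only: odd_theta_plus_1) simp
    moreover have "(1 + \<tau>) / 2 \<notin> period_lattice \<tau>" by (rule not_lattice[of _ 1 1]) simp_all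
    ultimately show ?thesis using inv[of "(1 + \<tau>) / 2"] by metis
  qed
  have "L ^ 3 * (- 2 * nome (- \<tau> / 2)) =
      (L * odd_theta (1 / 2) \<tau>) * (L * odd_theta (\<tau> / 2) \<tau>) * (L * odd_theta ((1 + \<tau>) / 2) \<tau>)"
    unfolding odd_theta_half_periods[OF \<tau>, symmetric] by (simp add: power3_eq_cube)
  also have "\<dots> = - (nome (- (1 / 2)\<^sup>2 / (2 * \<tau>)) * nome (- (\<tau> / 2)\<^sup>2 / (2 * \<tau>)) * nome (- ((1 +
      \<tau>) / 2)\<^sup>2 / (2 * \<tau>))) *
      (odd_theta (1 / 2) \<tau>' * odd_theta (\<tau>' / 2) \<tau>' * odd_theta ((1 + \<tau>') / 2) \<tau>')"
    unfolding 1[symmetric] 2[symmetric] 3[symmetric] by simp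
  also have "\<dots> = 2 * nome (- (1 / 2)\<^sup>2 / (2 * \<tau>) + - (\<tau> / 2)\<^sup>2 / (2 * \<tau>) + - ((1 +
      \<tau>) / 2)\<^sup>2 / (2 * \<tau>) + - \<tau>' / 2)"
    unfolding odd_theta_half_periods[OF \<tau>'] nome_add by simp
  also have "- (1 / 2)\<^sup>2 / (2 * \<tau>) + - (\<tau> / 2)\<^sup>2 / (2 * \<tau>) + - ((1 + \<tau>) / 2)\<^sup>2 / (2 * \<tau>) +
      - \<tau>' / 2 =
      - (1 / 4) + (\<tau> - \<tau>') / 4 + - \<tau> / 2"
    using \<tau>0 by (simp add: \<tau>'_def power2_eq_square field_simps)
  also have "2 * nome (- (1 / 4) + (\<tau> - \<tau>') / 4 + - \<tau> / 2) =
      \<i> * nome ((\<tau> - \<tau>') / 4) * (- 2 * nome (- \<tau> / 2))"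
    by (simp only: nome_add nome_minus_quarter) simp
  finally have "L ^ 3 = \<i> * nome ((\<tau> - \<tau>') / 4)" by simp
  hence E': "E' ^ 6 = \<i> * \<tau> ^ 3 * nome ((\<tau> - \<tau>') / 4) * E ^ 6"
    using \<tau>0 E0 by (simp add: L_def power_divide power_mult_distrib field_simps flip: power_mult)
  have p6: "nome (x / 24) ^ 6 = nome (x / 4)" for x
    using nome_of_nat_mult[of 6 "x / 24"] by simp
  have "eta \<tau>' ^ 6 = nome (\<tau>' / 4) * E' ^ 6"
    by (simp add: eta_eq E'_def power_mult_distrib p6)
  also have "\<dots> = \<i> * \<tau> ^ 3 * (nome (\<tau>' / 4) * nome ((\<tau> - \<tau>') / 4)) * E ^ 6" by (simp add: E')
  also have "nome (\<tau>' / 4) * nome ((\<tau> - \<tau>') / 4) = nome (\<tau> / 4)"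
    by (simp add: diff_divide_distrib flip: nome_add)
  also have "\<i> * \<tau> ^ 3 * nome (\<tau> / 4) * E ^ 6 = (- \<i> * \<tau>) ^ 3 * eta \<tau> ^ 6"
  proof -
    have "(- \<i>) ^ 3 = \<i>" by (simp add: power3_eq_cube)
    thus ?thesis by (simp only: eta_eq E_def power_mult_distrib p6 mult.assoc)
  qed
  finally show ?thesis by (simp add: \<tau>'_def)
qed

text \<open>For \<tau> in the upper half-plane, -\<i>\<tau> lies in the right half-plane, away from
  the branch cut.\<close>

lemma csqrt_minus_i_holomorphic: "(\<lambda>\<tau>. csqrt (- \<i> * \<tau>)) holomorphic_on upper_half_plane"
  by (rule holomorphic_on_csqrt'[of "\<lambda>\<tau>. - \<i> * \<tau>"])
     (auto simp: complex_nonpos_Reals_iff upper_half_plane_def intro!: holomorphic_intros)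

lemma csqrt_of_real_mult:
  assumes "c > 0" and "Re z > 0"
  shows "csqrt (of_real c * z) = of_real (sqrt c) * csqrt z"
proof -
  have "(of_real (sqrt c) * csqrt z)\<^sup>2 = of_real c * z"
    using assms by (simp add: power_mult_distrib flip: of_real_power)
  moreover have "Re (of_real (sqrt c) * csqrt z) > 0"
    using assms csqrt_principal[of z] by (auto simp: complex_eq_iff add_pos_nonneg add_nonneg_pos)
  ultimately show ?thesis by (metis csqrt_unique)
qed

theorem eta_inversion:
  assumes "Im \<tau> > 0"
  shows "eta (- 1 / \<tau>) = csqrt (- \<i> * \<tau>) * eta \<tau>"
proof -
  define f where "f = (\<lambda>\<tau>. eta (- 1 / \<tau>) / (csqrt (- \<i> * \<tau>) * eta \<tau>))"
  have nz: "csqrt (- \<i> * \<tau>) * eta \<tau> \<noteq> 0" if "Im \<tau> > 0" for \<tau>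
    using that eta_nonzero[OF that] by auto
  have "f holomorphic_on upper_half_plane" unfolding f_def
    by (intro holomorphic_intros holomorphic_on_eta csqrt_minus_i_holomorphic)
       (use nz Im_minus_inverse_pos in \<open>auto simp: upper_half_plane_def\<close>)
  hence "f constant_on upper_half_plane"
  proof (rule constant_if_power_constant[OF holomorphic_on_imp_continuous_on
      connected_upper_half_plane])
    fix z assume "z \<in> upper_half_plane"
    hence z: "Im z > 0" by (simp add: upper_half_plane_def)
    have "csqrt (- \<i> * z) ^ 6 = (- \<i> * z) ^ 3" by (subst csqrt_power_even) simp_all
    thus "f z ^ 6 = 1"
      unfolding f_def power_divide power_mult_distrib eta_inversion_power6[OF z]
      using nz[OF z] by (simp add: eta_nonzero[OF z])
  qed simp
  then obtain c where c: "\<And>z. Im z > 0 \<Longrightarrow> f z = c"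
    by (auto simp: constant_on_def upper_half_plane_def)
  \<comment> \<open>\<i> is the fixed point of inversion, and -\<i> * \<i> = 1 has principal root 1;
    this singles out the sixth root of unity.\<close>
  have "f \<i> = 1" using eta_nonzero[of \<i>] by (simp add: f_def)
  hence "f \<tau> = 1" using c[of \<i>] c[OF assms] by simp
  thus ?thesis using nz[OF assms] by (simp add: f_def)
qed

section \<open>The eta multiplier at rational cusps\<close>

lemma eta_plus_int: "eta (\<tau> + of_int n) = nome (of_int n / 24) * eta \<tau>"
  by (simp add: eta_eq add_divide_distrib nome_add)

text \<open>The reason for all shifts by 24: they carry no multiplier, so eta (\<tau> + 24 b/N)
  depends only on b modulo N.\<close>

lemma eta_plus_24_int: "eta (\<tau> + 24 * of_int n) = eta \<tau>"
  using eta_plus_int[of \<tau> "24 * n"] by simp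

lemma norm_nome_of_real [simp]: "norm (nome (of_real x)) = 1"
  by (simp add: norm_nome)

lemma norm_nome_of_int_divide [simp]: "norm (nome (of_int x / numeral n)) = 1"
  using norm_nome_of_real[of "of_int x / numeral n"] by simp

lemma SL2_denominator_nonzero:
  assumes "Im \<tau> > 0" and "a * d - b * c = (1::int)"
  shows "of_int c * \<tau> + of_int d \<noteq> 0"
proof
  assume eq: "of_int c * \<tau> + of_int d = 0"
  hence "Im (of_int c * \<tau> + of_int d) = 0" by simp
  hence "c = 0" using assms by simp
  with eq assms(2) show False by simp
qed

text \<open>The Euclidean algorithm on the lower row reduces a matrix to translations and inversion.
  Squaring eta turns the square root of the automorphy factor into the factor itself, so that no
  branch has to be followed.\<close>

lemma eta_SL2_multiplier:
  fixes a b c d :: int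
  assumes "a * d - b * c = 1"
  shows "\<exists>\<epsilon>. norm \<epsilon> = 1 \<and> (\<forall>\<tau>. Im \<tau> > 0 \<longrightarrow>
    (eta ((of_int a * \<tau> + of_int b) / (of_int c * \<tau> + of_int d)))\<^sup>2 =
    \<epsilon> * (of_int c * \<tau> + of_int d) * (eta \<tau>)\<^sup>2)"
  using assms
proof (induction "nat \<bar>c\<bar>" arbitrary: a b c d rule: less_induct)
  case less
  show ?case
  proof (cases "c = 0")
    case True
    hence "a * d = 1" using less.prems by simp
    hence ad: "a = d" "d = 1 \<or> d = - 1" by (auto simp: zmult_eq_1_iff)
    have "norm (of_int d * nome (of_int (b * d) / 12)) = 1"
      using ad(2) norm_nome_of_int_divide[of "b *
          d" "num.Bit0 (num.Bit0 (num.Bit1 num.One))"] by (auto simp: norm_mult)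
    moreover have "(eta ((of_int a * \<tau> + of_int b) / (of_int c * \<tau> + of_int d)))\<^sup>2 =
       (of_int d * nome (of_int (b * d) / 12)) * (of_int c * \<tau> + of_int d) * (eta \<tau>)\<^sup>2" for \<tau>
    proof -
      have "(of_int a * \<tau> + of_int b) / (of_int c * \<tau> + of_int d) = \<tau> + of_int (b * d)"
        using ad True by auto
      moreover have "(nome (of_int (b * d) / 24))\<^sup>2 = nome (of_int (b * d) / 12)"
        using nome_of_nat_mult[of 2 "of_int (b * d) / 24"] by simp
      ultimately show ?thesis using ad(2) True
        by (auto simp only: eta_plus_int power_mult_distrib) auto
    qed
    ultimately show ?thesis by blast
  next
    case False
    \<comment> \<open>Division with remainder in the lower row: the matrix acts as the one with rows
      (b', -a) and (d', -c), applied to -1/(\<tau> + k).\<close>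
    define k where "k = d div c"
    define d' where "d' = d mod c"
    define b' where "b' = b - a * k"
    have d: "d = c * k + d'" by (simp add: k_def d'_def)
    have b: "b = b' + a * k" by (simp add: b'_def)
    have "nat \<bar>d'\<bar> < nat \<bar>c\<bar>" using False by (simp add: d'_def abs_mod_less)
    moreover have "b' * (- c) - (- a) * d' = 1"
      using less.prems unfolding b d by (simp add: algebra_simps)
    ultimately obtain \<epsilon> where \<epsilon>: "norm \<epsilon> = 1" "\<And>\<tau>. Im \<tau> > 0 \<Longrightarrow>
        (eta ((of_int b' * \<tau> + of_int (- a)) / (of_int d' * \<tau> + of_int (- c))))\<^sup>2 =
        \<epsilon> * (of_int d' * \<tau> + of_int (- c)) * (eta \<tau>)\<^sup>2"
      using less.hyps by blast
    have "(eta ((of_int a * \<tau> + of_int b) / (of_int c * \<tau> + of_int d)))\<^sup>2 =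
        (\<epsilon> * \<i> * nome (of_int k / 12)) * (of_int c * \<tau> +
            of_int d) * (eta \<tau>)\<^sup>2" if \<tau>: "Im \<tau> > 0" for \<tau>
    proof -
      define \<rho> where "\<rho> = \<tau> + of_int k"
      have \<rho>: "Im \<rho> > 0" "\<rho> \<noteq> 0" using \<tau> by (auto simp: \<rho>_def complex_eq_iff)
      have cancel: "(- P / \<rho>) / (- Q / \<rho>) = P / Q" for P Q using \<rho>(2) by simp
      have "of_int b' * (- 1 / \<rho>) + of_int (- a) = - (of_int a * \<tau> + of_int b) / \<rho>"
        using \<rho>(2) by (simp add: field_simps b) (simp add: \<rho>_def algebra_simps)
      moreover have den: "of_int d' * (- 1 / \<rho>) + of_int (- c) = - (of_int c * \<tau> + of_int d) / \<rho>"
        using \<rho>(2) by (simp add: field_simps d) (simp add: \<rho>_def algebra_simps)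
      ultimately have "(of_int b' * (- 1 / \<rho>) + of_int (- a)) / (of_int d' * (- 1 / \<rho>) +
          of_int (- c)) =
          (of_int a * \<tau> + of_int b) / (of_int c * \<tau> + of_int d)"
        using \<open>\<rho> \<noteq> 0\<close> by (simp only: cancel)
      hence "(eta ((of_int a * \<tau> + of_int b) / (of_int c * \<tau> + of_int d)))\<^sup>2 =
          \<epsilon> * (- (of_int c * \<tau> + of_int d) / \<rho>) * (eta (- 1 / \<rho>))\<^sup>2"
        using \<epsilon>(2)[OF Im_minus_inverse_pos[OF \<rho>(1)]] den by simp
      also have "(eta (- 1 / \<rho>))\<^sup>2 = - \<i> * \<rho> * (eta \<rho>)\<^sup>2"
        by (subst eta_inversion[OF \<rho>(1)]) (simp add: power_mult_distrib)
      also have "(eta \<rho>)\<^sup>2 = nome (of_int k / 12) * (eta \<tau>)\<^sup>2"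
        using nome_of_nat_mult[of 2 "of_int k / 24"]
        by (simp add: \<rho>_def eta_plus_int power_mult_distrib)
      also have "\<epsilon> * (- D / \<rho>) * (- \<i> * \<rho> * (n * e)) = \<epsilon> * \<i> * n * D * e" for D n e
        using \<rho>(2) by simp
      finally show ?thesis .
    qed
    moreover have "norm (\<epsilon> * \<i> * nome (of_int k / 12)) = 1" using \<epsilon>(1) by (simp add: norm_mult)
    ultimately show ?thesis by blast
  qed
qed

text \<open>Let 576 x y + 1 = N b. Then the argument on the left is the image of \<tau> + 24 x/N
  under the matrix with rows (24 y, -b) and (N, -24 x), which has determinant 1. In these
  coordinates the automorphy factor is N \<tau>, free of x and y.\<close>

definition is_eta_mult :: "nat \<Rightarrow> int \<Rightarrow> int \<Rightarrow> complex \<Rightarrow> bool" where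
  "is_eta_mult N y x \<omega> \<longleftrightarrow> norm \<omega> = 1 \<and> (\<forall>\<tau>. Im \<tau> > 0 \<longrightarrow>
     eta (24 * of_int y / of_nat N - 1 / ((of_nat N)\<^sup>2 * \<tau>)) =
     \<omega> * of_real (sqrt N) * csqrt (- \<i> * \<tau>) * eta (\<tau> + 24 * of_int x / of_nat N))"

definition eta_mult :: "nat \<Rightarrow> int \<Rightarrow> int \<Rightarrow> complex" where
  "eta_mult N y x = (SOME \<omega>. is_eta_mult N y x \<omega>)"

lemma Im_cusp_pos:
  assumes "Im \<tau> > 0" and "N > 0"
  shows "Im (24 * of_int y / of_nat N - 1 / ((of_nat N)\<^sup>2 * \<tau>)) > 0"
proof -
  have "Im (1 / ((of_nat N)\<^sup>2 * \<tau>)) = Im (1 / \<tau>) / (of_nat N)\<^sup>2"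
  proof -
    have "1 / ((of_nat N)\<^sup>2 * \<tau>) = (1 / \<tau>) / of_real ((of_nat N)\<^sup>2)" by (simp add: mult.commute)
    thus ?thesis by (simp only: Im_divide_of_real)
  qed
  moreover have "Im (1 / \<tau>) < 0" using Im_minus_inverse_pos[OF assms(1)] by simp
  ultimately have "Im (1 / ((of_nat N)\<^sup>2 * \<tau>)) < 0"
    using assms(2) by (simp add: divide_neg_pos)
  thus ?thesis by simp
qed

text \<open>\<open>eta_SL2_multiplier\<close> shows that the square of the quotient of the two sides
  is constant; by connectedness the quotient is constant too.\<close>

lemma eta_mult:
  assumes N: "N > 0" and dvd: "int N dvd 576 * x * y + 1"
  shows "is_eta_mult N y x (eta_mult N y x)"
  unfolding eta_mult_def
proof (rule someI_ex)
  obtain b where b: "576 * x * y + 1 = int N * b" using dvd by (auto elim: dvdE)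
  obtain \<epsilon> where \<epsilon>: "norm \<epsilon> = 1" "\<And>\<tau>. Im \<tau> > 0 \<Longrightarrow>
      (eta ((of_int (24 * y) * \<tau> + of_int (- b)) / (of_int (int N) * \<tau> + of_int (- 24 * x))))\<^sup>2 =
      \<epsilon> * (of_int (int N) * \<tau> + of_int (- 24 * x)) * (eta \<tau>)\<^sup>2"
    using eta_SL2_multiplier[of "24 * y" "- 24 * x" "- b" "int N"] b by (auto simp: algebra_simps)
  have N0: "of_nat N \<noteq> (0 :: complex)" using N by simp
  define A where "A = (\<lambda>\<tau>. eta (24 * of_int y / of_nat N - 1 / ((of_nat N)\<^sup>2 * \<tau>)))"
  define B where "B = (\<lambda>\<tau>. of_real (sqrt N) * csqrt (- \<i> * \<tau>) * eta (\<tau> + 24 * of_int x / of_nat N))"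
  have B0: "B \<tau> \<noteq> 0" if "Im \<tau> > 0" for \<tau>
    using that N eta_nonzero[of "\<tau> + 24 * of_int x / of_nat N"] by (auto simp: B_def)
  have sq: "(A \<tau> / B \<tau>) ^ 2 = \<epsilon> * \<i>" if \<tau>: "Im \<tau> > 0" for \<tau>
  proof -
    have \<tau>0: "\<tau> \<noteq> 0" using \<tau> by auto
    define \<rho> where "\<rho> = \<tau> + 24 * of_int x / of_nat N"
    have \<rho>: "Im \<rho> > 0" using \<tau> by (simp add: \<rho>_def)
    have den: "of_int (int N) * \<rho> + of_int (- 24 * x) = of_nat N * \<tau>"
      using N0 by (simp add: \<rho>_def field_simps)
    have b': "of_int (int N * b) = (of_int (576 * x * y + 1) :: complex)" by (simp only: b)
    have num: "of_int (24 * y) * \<rho> + of_int (- b) = 24 * of_int y * \<tau> - 1 / of_nat N"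
      using N0 b' by (simp add: \<rho>_def field_simps)
    have "(of_int (24 * y) * \<rho> + of_int (- b)) / (of_int (int N) * \<rho> + of_int (- 24 * x)) =
        24 * of_int y / of_nat N - 1 / ((of_nat N)\<^sup>2 * \<tau>)"
      unfolding num den using N0 \<tau>0 by (simp add: field_simps power2_eq_square)
    hence "(A \<tau>)\<^sup>2 = \<epsilon> * (of_nat N * \<tau>) * (eta \<rho>)\<^sup>2"
      using \<epsilon>(2)[OF \<rho>] unfolding den by (simp add: A_def)
    moreover have "(B \<tau>)\<^sup>2 = of_nat N * (- \<i> * \<tau>) * (eta \<rho>)\<^sup>2"
      by (simp add: B_def power_mult_distrib \<rho>_def flip: of_real_power)
    ultimately show ?thesis using B0[OF \<tau>] \<tau>0 N0 eta_nonzero[OF \<rho>]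
      by (simp add: power_divide field_simps)
  qed
  have "(\<lambda>\<tau>. A \<tau> / B \<tau>) holomorphic_on upper_half_plane"
    unfolding A_def
  proof (intro holomorphic_on_divide holomorphic_on_eta)
    show "B holomorphic_on upper_half_plane" unfolding B_def
      by (intro holomorphic_intros csqrt_minus_i_holomorphic holomorphic_on_eta) (auto simp: N0
          upper_half_plane_def)
  qed (use N B0 Im_cusp_pos in \<open>auto simp: upper_half_plane_def intro!: holomorphic_intros\<close>)
  hence "(\<lambda>\<tau>. A \<tau> / B \<tau>) constant_on upper_half_plane"
    by (intro constant_if_power_constant[OF holomorphic_on_imp_continuous_on
        connected_upper_half_plane, where n = 2])
       (use sq in \<open>auto simp: upper_half_plane_def\<close>)
  then obtain \<omega> where \<omega>: "\<And>\<tau>. Im \<tau> > 0 \<Longrightarrow> A \<tau> / B \<tau> = \<omega>"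
    by (auto simp: constant_on_def upper_half_plane_def)
  have "\<omega>\<^sup>2 = \<epsilon> * \<i>" using sq[of \<i>] \<omega>[of \<i>] by simp
  hence "norm \<omega> ^ 2 = 1" using \<epsilon>(1) by (metis mult.right_neutral norm_ii norm_mult norm_power)
  hence "norm \<omega> = 1" using norm_ge_zero[of \<omega>] by (auto simp: power2_eq_1_iff)
  moreover have "A \<tau> = \<omega> * B \<tau>" if "Im \<tau> > 0" for \<tau>
    using \<omega>[OF that] B0[OF that] by (simp add: field_simps)
  ultimately show "\<exists>\<omega>. is_eta_mult N y x \<omega>"
    unfolding is_eta_mult_def A_def B_def by (auto simp: mult.assoc)
qed

lemma norm_eta_mult:
  assumes "N > 0" and "int N dvd 576 * x * y + 1"
  shows "norm (eta_mult N y x) = 1"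
  using eta_mult[OF assms] by (simp add: is_eta_mult_def)

lemma eta_mult_eq:
  assumes "N > 0" and "int N dvd 576 * x * y + 1" and "Im \<tau> > 0"
  shows "eta (24 * of_int y / of_nat N - 1 / ((of_nat N)\<^sup>2 * \<tau>)) =
     eta_mult N y x * of_real (sqrt N) * csqrt (- \<i> * \<tau>) * eta (\<tau> + 24 * of_int x / of_nat N)"
  using eta_mult[OF assms(1,2)] assms(3) by (simp add: is_eta_mult_def)

lemma eta_plus_24_frac_cong:
  assumes "[x = x'] (mod int N)" and "N > 0"
  shows "eta (\<tau> + 24 * of_int x / of_nat N) = eta (\<tau> + 24 * of_int x' / of_nat N)"
proof -
  obtain k where "x = x' + int N * k" using assms(1) by (metis cong_iff_lin cong_sym mult.commute)
  hence "\<tau> + 24 * of_int x / of_nat N = \<tau> + 24 * of_int x' / of_nat N + 24 * of_int k"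
    using assms(2) by (simp add: field_simps)
  thus ?thesis by (simp only: eta_plus_24_int)
qed

text \<open>By the period 24 of eta, the predicate inside \<open>SOME\<close> is literally the same
  for congruent arguments.\<close>

lemma eta_mult_cong:
  assumes "[x = x'] (mod int N)" and "[y = y'] (mod int N)" and "N > 0"
  shows "eta_mult N y x = eta_mult N y' x'"
proof -
  have "eta (24 * of_int y / of_nat N - w) = eta (24 * of_int y' / of_nat N - w)" for w
    using eta_plus_24_frac_cong[OF assms(2,3), of "- w"] by (simp add: algebra_simps)
  thus ?thesis unfolding eta_mult_def is_eta_mult_def
    by (simp only: eta_plus_24_frac_cong[OF assms(1,3)])
qed

section \<open>Residues, Legendre symbols and roots of unity\<close>

lemma Legendre_cases: "Legendre a p \<in> {-1, 0, 1}"
  by (simp add: Legendre_def)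

lemma Legendre_eqI:
  assumes "p > 2" and "a \<in> {-1, 0, 1}" and "b \<in> {-1, 0, 1}" and "[a = b] (mod p)"
  shows "a = (b::int)"
proof -
  have "p dvd a - b" using assms(4) by (simp add: cong_iff_dvd_diff)
  hence "a - b = 0 \<or> p \<le> \<bar>a - b\<bar>" using dvd_imp_le_int[of "a - b" p] assms(1) by auto
  thus ?thesis using assms(1-3) by auto
qed

lemma Legendre_mult:
  assumes "prime p" and "p > 2"
  shows "Legendre (a * b) (int p) = Legendre a (int p) * Legendre b (int p)"
proof (rule Legendre_eqI)
  show "int p > 2" using assms by simp
  note e = euler_criterion[OF assms]
  show "[Legendre (a * b) (int p) = Legendre a (int p) * Legendre b (int p)] (mod int p)"
    using cong_trans[OF e[of "a * b"]] cong_sym[OF cong_mult[OF e[of a] e[of b]]]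
    by (simp add: power_mult_distrib)
  show "Legendre (a * b) (int p) \<in> {-1, 0, 1}" by (rule Legendre_cases)
  show "Legendre a (int p) * Legendre b (int p) \<in> {-1, 0, 1}"
    using Legendre_cases[of a "int p"] Legendre_cases[of b "int p"] by auto
qed

lemma Legendre_cong:
  assumes "[a = b] (mod p)"
  shows "Legendre a p = Legendre b p"
proof -
  have "[a = 0] (mod p) \<longleftrightarrow> [b = 0] (mod p)" using assms by (metis cong_sym cong_trans)
  moreover have "QuadRes p a \<longleftrightarrow> QuadRes p b" unfolding QuadRes_def
    using assms by (metis cong_sym cong_trans)
  ultimately show ?thesis by (simp add: Legendre_def)
qed

lemma Legendre_eq_0_iff: "Legendre a p = 0 \<longleftrightarrow> p dvd a"
  by (auto simp: Legendre_def cong_0_iff)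

lemma Legendre_square:
  assumes "\<not> p dvd a"
  shows "(Legendre a p)\<^sup>2 = 1"
  using assms Legendre_cases[of a p] Legendre_eq_0_iff[of a p] by auto

lemma Legendre_one: "p > 1 \<Longrightarrow> Legendre 1 p = 1"
  unfolding Legendre_def QuadRes_def
  by (auto simp: cong_def intro: exI[of _ 1])

text \<open>Quadratic reciprocity for 3 and l. The sign is expressed through u because u is, up to
  sign, the index at which (6k-1)^2 equals l^2, so the same sign occurs as a coefficient of the
  pentagonal series.\<close>

lemma Legendre_3:
  assumes l: "prime l" "l > 3" and u: "int l = 6 * u + e" "e = 1 \<or> e = - 1"
  shows "Legendre 3 (int l) = (-1) ^ nat u"
proof -
  have u0: "u \<ge> 1" using u l by auto
  define w where "w = nat u"
  have w: "u = int w" "w \<ge> 1" using u0 by (auto simp: w_def)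
  have QR: "Legendre 3 (int l) * Legendre (int l) 3 = (-1) ^ ((l - 1) div 2)"
    using Quadratic_Reciprocity[of 3 l] l by simp
  from u(2) show ?thesis
  proof
    assume e: "e = 1"
    have "[int l = 1] (mod 3)" using u e by (simp add: cong_def) presburger
    hence 1: "Legendre (int l) 3 = 1" using Legendre_cong Legendre_one by fastforce
    have "l = 2 * (3 * w) + 1" using u e w by linarith
    hence "(l - 1) div 2 = 3 * w" by simp
    with QR 1 show ?thesis by (simp add: w_def[symmetric] power_mult)
  next
    assume e: "e = - 1"
    have m: "[int l = 2] (mod 3)" using u e by (simp add: cong_def) presburger
    have "\<not> [y\<^sup>2 = 2] (mod 3)" for y :: int
    proof -
      have "y mod 3 = 0 \<or> y mod 3 = 1 \<or> y mod 3 = 2" by presburger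
      moreover have "y\<^sup>2 mod 3 = (y mod 3)\<^sup>2 mod 3" by (simp add: power_mod)
      ultimately show ?thesis by (auto simp: cong_def)
    qed
    hence "Legendre 2 3 = -1" by (simp add: Legendre_def QuadRes_def cong_def)
    hence 1: "Legendre (int l) 3 = - 1" using Legendre_cong[OF m] by simp
    obtain v where v: "w = Suc v" using w(2) by (cases w) auto
    have "int l = 2 * (3 * int v + 2) + 1" using u(1) e w(1) v by simp
    hence "l = 2 * (3 * v + 2) + 1" by presburger
    hence "(l - 1) div 2 = 3 * v + 2" by simp
    hence "(-1) ^ ((l - 1) div 2) = (-1 :: int) ^ v" by (simp add: power_add power_mult)
    thus ?thesis using QR 1 by (simp add: w_def[symmetric] v)
  qed
qed

lemma nome_frac_mult_nat: "nome (of_int k / of_nat N) ^ n = nome (of_int k * of_nat n / of_nat N)"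
  using nome_of_nat_mult[of n "of_int k / of_nat N"] by (simp add: mult.commute)

lemma nome_frac_cong:
  assumes "[k = m] (mod int N)"
  shows "nome (of_int k / of_nat N) = nome (of_int m / of_nat N)"
proof (cases "N = 0")
  case False
  obtain j where "k = m + int N * j" using assms by (metis cong_iff_lin cong_sym mult.commute)
  hence "of_int k / of_nat N = of_int m / of_nat N + (of_int j :: complex)"
    using False by (simp add: field_simps)
  thus ?thesis by (simp only: nome_add) simp
qed simp

lemma nome_frac_eq_1_iff:
  assumes "N > 0"
  shows "nome (of_int k / of_nat N) = 1 \<longleftrightarrow> int N dvd k"
proof
  assume "nome (of_int k / of_nat N) = 1"
  then obtain n :: int where "of_int k / of_nat N =
      (of_int n :: complex)" by (auto simp: nome_eq_1_iff)
  hence "of_int k = (of_int (int N * n) :: complex)" using assms by (simp add: field_simps)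
  thus "int N dvd k" by (simp only: of_int_eq_iff) simp
next
  assume "int N dvd k"
  thus "nome (of_int k / of_nat N) = 1" using nome_frac_cong[of k 0 N] by (simp add: cong_0_iff)
qed

lemma sum_nome_frac:
  assumes "N > 0"
  shows "(\<Sum>b\<in>{0..<int N}. nome (of_int (k * b) / of_nat N)) = (if int N dvd k then of_nat N else 0)"
proof -
  have "(\<Sum>b\<in>{0..<int N}. nome (of_int (k * b) / of_nat N)) = (\<Sum>n<N. nome (of_int k / of_nat N) ^ n)"
    by (rule sum.reindex_bij_witness[of _ int nat]) (auto simp: nome_frac_mult_nat)
  also have "\<dots> = (if int N dvd k then of_nat N else 0)"
  proof (cases "int N dvd k")
    case True
    hence "nome (of_int k / of_nat N) = 1" using nome_frac_eq_1_iff[OF assms] by simp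
    thus ?thesis using True by simp
  next
    case False
    have "nome (of_int k / of_nat N) ^ N = 1"
      using assms by (simp add: nome_frac_mult_nat)
    thus ?thesis using False nome_frac_eq_1_iff[OF assms, of k] by (simp add: geometric_sum)
  qed
  finally show ?thesis .
qed

definition units :: "nat \<Rightarrow> int set" where
  "units N = {x \<in> {0..<int N}. coprime x (int N)}"

lemma finite_units [simp]: "finite (units N)"
  by (rule finite_subset[of _ "{0..<int N}"]) (auto simp: units_def)

text \<open>The permutation of the shifts caused by inversion, which pairs x and y as in the
  solvability condition of \<open>eta_mult\<close>. It is used with \<kappa> = 576 for eta and
  \<kappa> = 1152 for \<open>g_fun\<close>. The map is an involution because the condition is
  symmetric.\<close>

lemma neg_inverse_bij:
  fixes \<kappa> :: int
  assumes "coprime \<kappa> (int N)" and "N > 1"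
  obtains \<nu> where "bij_betw \<nu> (units N) (units N)" "\<And>x. x \<in> units N \<Longrightarrow> int N dvd \<kappa> * x * \<nu> x + 1"
proof -
  have ex: "\<exists>y\<in>units N. int N dvd \<kappa> * x * y + 1" if x: "x \<in> units N" for x
  proof -
    have "coprime (\<kappa> * x) (int N)" using x assms by (simp add: units_def)
    then obtain z where z: "[\<kappa> * x * z = 1] (mod int N)" using cong_solve_coprime_int by blast
    define y where "y = (- z) mod int N"
    have "[\<kappa> * x * y = \<kappa> * x * (- z)] (mod int N)" unfolding y_def by (intro cong_mult) auto
    also have "[\<kappa> * x * (- z) = - 1] (mod int N)" using z by (simp add: cong_minus_minus_iff)
    finally have dvd: "int N dvd \<kappa> * x * y + 1" by (simp add: cong_iff_dvd_diff)
    have "coprime y (int N)"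
    proof (rule coprimeI)
      fix c assume "c dvd y" "c dvd int N"
      hence "c dvd \<kappa> * x * y + 1" "c dvd \<kappa> * x * y" using dvd dvd_trans by auto
      thus "is_unit c" by (metis dvd_add_right_iff)
    qed
    moreover have "y \<in> {0..<int N}" using assms(2) by (simp add: y_def)
    ultimately show ?thesis using dvd by (auto simp: units_def)
  qed
  have uniq: "y = y'" if "x \<in> units N" "y \<in> units N" "y' \<in> units N"
    "int N dvd \<kappa> * x * y + 1" "int N dvd \<kappa> * x * y' + 1" for x y y'
  proof -
    have "int N dvd (\<kappa> * x * y + 1) - (\<kappa> * x * y' + 1)" using that by (intro dvd_diff)
    hence "int N dvd (\<kappa> * x) * (y - y')" by (simp add: algebra_simps)
    moreover have "coprime (int N) (\<kappa> * x)" using that assms by (simp add: units_def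
        coprime_commute)
    ultimately have "int N dvd y - y'" by (simp add: coprime_dvd_mult_right_iff)
    hence "y mod int N = y' mod int N" by (simp add: mod_eq_dvd_iff)
    thus ?thesis using that by (simp add: units_def)
  qed
  define \<nu> where "\<nu> = (\<lambda>x. SOME y. y \<in> units N \<and> int N dvd \<kappa> * x * y + 1)"
  have \<nu>: "\<nu> x \<in> units N \<and> int N dvd \<kappa> * x * \<nu> x + 1" if "x \<in> units N" for x
    unfolding \<nu>_def by (rule someI_ex) (use ex[OF that] in blast)
  have "\<nu> (\<nu> x) = x" if "x \<in> units N" for x
    using uniq[of "\<nu> x" "\<nu> (\<nu> x)" x] \<nu>[OF that] \<nu>[of "\<nu> x"] that by (simp add: mult_ac)
  hence "bij_betw \<nu> (units N) (units N)"
    using \<nu> by (intro bij_betw_byWitness[where f' = \<nu>]) auto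
  thus ?thesis using that \<nu> by blast
qed

lemma coprime_int_prime_iff:
  assumes "prime l"
  shows "coprime x (int l) \<longleftrightarrow> \<not> int l dvd x"
  using assms by (metis coprime_commute prime_imp_coprime not_coprimeI dvd_refl not_prime_unit
      prime_nat_int_transfer)

lemma units_prime:
  assumes "prime l"
  shows "units l = {1..<int l}"
proof -
  have "units l = {x \<in> {0..<int l}. \<not> int l dvd x}"
    unfolding units_def coprime_int_prime_iff[OF assms] ..
  also have "\<dots> = {1..<int l}"
  proof (intro equalityI subsetI)
    fix x assume "x \<in> {1..<int l}"
    thus "x \<in> {x \<in> {0..<int l}. \<not> int l dvd x}" using zdvd_imp_le[of "int l" x] by auto
  next
    fix x assume x: "x \<in> {x \<in> {0..<int l}. \<not> int l dvd x}"
    hence "x \<noteq> 0" by auto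
    thus "x \<in> {1..<int l}" using x by auto
  qed
  finally show ?thesis .
qed

text \<open>Sorts the fractions b/l^2 by their reduced denominator: units keep l^2, and the
  multiples of l become fractions c/l.\<close>

lemma sum_prime_square_residues:
  fixes f :: "int \<Rightarrow> complex"
  assumes "prime l"
  shows "(\<Sum>b\<in>{0..<int (l\<^sup>2)}. f b) = (\<Sum>b\<in>units (l\<^sup>2). f b) + (\<Sum>c\<in>{0..<int l}. f (int l * c))"
proof -
  have l0: "int l > 0" using assms by (simp add: prime_gt_0_nat)
  have cop: "coprime x (int (l\<^sup>2)) \<longleftrightarrow> \<not> int l dvd x" for x
    using coprime_int_prime_iff[OF assms] by simp
  have "{0..<int (l\<^sup>2)} = units (l\<^sup>2) \<union> (\<lambda>c. int l * c) ` {0..<int l}"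
  proof (intro equalityI subsetI)
    fix x assume x: "x \<in> {0..<int (l\<^sup>2)}"
    show "x \<in> units (l\<^sup>2) \<union> (\<lambda>c. int l * c) ` {0..<int l}"
    proof (cases "int l dvd x")
      case True
      then obtain c where c: "x = int l * c" by (auto elim: dvdE)
      have "0 \<le> c" "c < int l" using x l0 by (auto simp: c power2_eq_square zero_le_mult_iff)
      thus ?thesis using c by auto
    qed (use x cop in \<open>auto simp: units_def\<close>)
  qed (use l0 in \<open>auto simp: units_def power2_eq_square\<close>)
  moreover have "units (l\<^sup>2) \<inter> (\<lambda>c. int l * c) ` {0..<int l} = {}"
  proof (rule equals0I)
    fix x assume "x \<in> units (l\<^sup>2) \<inter> (\<lambda>c. int l * c) ` {0..<int l}"
    hence "x \<in> units (l\<^sup>2)" "x \<in> (\<lambda>c. int l * c) ` {0..<int l}" by simp_all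
    hence "coprime x (int (l\<^sup>2))" "int l dvd x" by (simp add: units_def, auto)
    with cop show False by blast
  qed
  moreover have "inj_on (\<lambda>c. int l * c) {0..<int l}" using l0 by (auto simp: inj_on_def)
  ultimately show ?thesis by (simp add: sum.union_disjoint sum.reindex del: of_nat_power)
qed

lemma card_units_prime_square:
  assumes "prime l"
  shows "card (units (l\<^sup>2)) = l\<^sup>2 - l"
proof -
  have "of_nat (l\<^sup>2) = (of_nat (card (units (l\<^sup>2))) + of_nat l :: complex)"
    using sum_prime_square_residues[OF assms, of "\<lambda>_. 1"] by simp
  hence "l\<^sup>2 = card (units (l\<^sup>2)) + l" by (simp only: of_nat_eq_iff flip: of_nat_add)
  thus ?thesis by simp
qed

text \<open>The point q = 0 is left out of the hypotheses because a nome never vanishes. The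
  constant terms are therefore compared first, by a limit, before uniqueness of expansions applies
  on the whole disc.\<close>

lemma power_series_unique:
  fixes c d :: "nat \<Rightarrow> complex"
  assumes "\<And>q. 0 < norm q \<Longrightarrow> norm q < 1 \<Longrightarrow> (\<lambda>n. c n * q ^ n) sums f q"
    and "\<And>q. 0 < norm q \<Longrightarrow> norm q < 1 \<Longrightarrow> (\<lambda>n. d n * q ^ n) sums f q"
  shows "c = d"
proof -
  define e where "e = (\<lambda>n. c n - d n)"
  have sums: "(\<lambda>n. e n * q ^ n) sums 0" if "q \<noteq> 0" "norm q < 1" for q
    using sums_diff[OF assms(1)[of q] assms(2)[of q]] that by (simp add: e_def ring_distribs)
  have "(\<lambda>_::complex. 0::complex) \<midarrow>0\<rightarrow> e 0"
    by (rule powser_limit_0_strong[of 1]) (use sums in auto)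
  hence e0: "e 0 = 0" using LIM_unique[OF _ tendsto_const] by blast
  have "(\<lambda>n. e n * q ^ n) sums 0" if "norm q < 1" for q
  proof (cases "q = 0")
    case True
    have "(\<lambda>n. e n * q ^ n) = (\<lambda>_. 0)" using e0 True by (auto simp: fun_eq_iff power_0_left)
    thus ?thesis by simp
  qed (use sums that in auto)
  hence "eventually (\<lambda>q. (\<lambda>n. fps_nth (Abs_fps e) n * q ^ n) sums 0) (nhds 0)"
    by (intro eventually_nhds_in_open[of "ball 0 1", THEN eventually_mono]) auto
  hence "(\<lambda>_. 0) has_fps_expansion Abs_fps e" by (rule has_fps_expansionI)
  moreover have "(\<lambda>_. 0 :: complex) has_fps_expansion 0" by simp
  ultimately have "Abs_fps e = 0" by (rule fps_expansion_unique_complex)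
  hence "e n = 0" for n by (metis fps_nth_Abs_fps fps_zero_nth)
  thus ?thesis by (auto simp: e_def fun_eq_iff)
qed

lemma ex_nome:
  assumes "0 < norm q" and "norm q < 1"
  obtains \<tau> where "Im \<tau> > 0" "nome \<tau> = q"
proof -
  define \<tau> where "\<tau> = Ln q / (2 * of_real pi * \<i>)"
  have q0: "q \<noteq> 0" using assms(1) by auto
  hence "nome \<tau> = q" by (simp add: nome_def \<tau>_def)
  moreover have "Im \<tau> > 0"
  proof -
    have "exp (- 2 * pi * Im \<tau>) < 1" using \<open>nome \<tau> = q\<close> assms(2) norm_nome[of \<tau>] by simp
    thus ?thesis by (simp add: zero_less_mult_iff)
  qed
  ultimately show ?thesis using that by blast
qed

section \<open>A characterisation of the quadratic character\<close>

lemma cnj_nome_frac: "cnj (nome (of_int k / of_nat N)) = nome (- (of_int k / of_nat N))"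
  by (simp add: nome_def exp_cnj)

lemma dvd_diff_units_iff:
  assumes "x \<in> units N" and "y \<in> units N"
  shows "int N dvd x - y \<longleftrightarrow> x = y"
proof
  assume "int N dvd x - y"
  hence "x mod int N = y mod int N" by (simp add: mod_eq_dvd_iff)
  thus "x = y" using assms by (simp add: units_def)
qed simp

lemma parseval_units:
  fixes \<omega> :: "int \<Rightarrow> complex"
  assumes "N > 0"
  shows "(\<Sum>m\<in>{0..<int N}. (norm (\<Sum>x\<in>units N. \<omega> x * nome (of_int (m * x) / of_nat N)))\<^sup>2) =
         of_nat N * (\<Sum>x\<in>units N. (norm (\<omega> x))\<^sup>2)"
proof -
  have "complex_of_real (\<Sum>m\<in>{0..<int N}. (norm (\<Sum>x\<in>units N. \<omega> x * nome (of_int (m *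
      x) / of_nat N)))\<^sup>2) =
      (\<Sum>m\<in>{0..<int N}. \<Sum>x\<in>units N. \<Sum>y\<in>units N. \<omega> x * cnj (\<omega> y) * nome (of_int ((x -
          y) * m) / of_nat N))"
  proof -
    have "complex_of_real ((norm (\<Sum>x\<in>units N. \<omega> x * nome (of_int (m * x) / of_nat N)))\<^sup>2) =
        (\<Sum>x\<in>units N. \<Sum>y\<in>units N. \<omega> x * cnj (\<omega> y) * nome (of_int ((x - y) * m) / of_nat N))" for m
    proof -
      have "nome (of_int (m * x) / of_nat N) * nome (- (of_int (m * y) / of_nat N)) =
          nome (of_int ((x - y) * m) / of_nat N)" for x y
        unfolding nome_add[symmetric] by (simp add: field_simps diff_divide_distrib)
      hence "\<omega> x * nome (of_int (m * x) / of_nat N) * (cnj (\<omega> y) * nome (- (of_int (m *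
          y) / of_nat N))) =
          \<omega> x * cnj (\<omega> y) * nome (of_int ((x - y) * m) / of_nat N)" for x y
        by (metis (no_types, opaque_lifting) mult.assoc mult.left_commute)
      thus ?thesis
        unfolding complex_norm_square cnj_sum complex_cnj_mult cnj_nome_frac sum_product by (simp
            only:)
    qed
    thus ?thesis by simp
  qed
  also have "\<dots> = (\<Sum>x\<in>units N. \<Sum>y\<in>units N. \<omega> x * cnj (\<omega> y) *
      (\<Sum>m\<in>{0..<int N}. nome (of_int ((x - y) * m) / of_nat N)))"
    unfolding sum_distrib_left by (rule trans[OF sum.swap]) (rule sum.cong[OF refl], rule sum.swap)
  also have "\<dots> = (\<Sum>x\<in>units N. \<omega> x * cnj (\<omega> x) * of_nat N)"
  proof (intro sum.cong refl)
    fix x assume x: "x \<in> units N"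
    have "(\<Sum>y\<in>units N. \<omega> x * cnj (\<omega> y) * (\<Sum>m\<in>{0..<int N}. nome (of_int ((x - y) * m) / of_nat N))) =
        (\<Sum>y\<in>units N. if y = x then \<omega> x * cnj (\<omega> x) * of_nat N else 0)"
      unfolding sum_nome_frac[OF assms]
      by (intro sum.cong refl) (use x in \<open>auto simp: dvd_diff_units_iff\<close>)
    thus "(\<Sum>y\<in>units N. \<omega> x * cnj (\<omega> y) * (\<Sum>m\<in>{0..<int N}. nome (of_int ((x - y) * m) / of_nat N))) =
        \<omega> x * cnj (\<omega> x) * of_nat N" using x by simp
  qed
  also have "\<dots> = complex_of_real (of_nat N * (\<Sum>x\<in>units N. (norm (\<omega> x))\<^sup>2))"
    by (simp add: complex_norm_square sum_distrib_left mult.commute del: of_real_power)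
  finally show ?thesis by (simp only: of_real_eq_iff)
qed

lemma fourier_inversion_units:
  fixes \<omega> :: "int \<Rightarrow> complex"
  assumes "N > 0" and "x \<in> units N"
  shows "(\<Sum>m\<in>{0..<int N}. (\<Sum>y\<in>units N. \<omega> y * nome (of_int (m * y) / of_nat N)) *
            nome (- of_int (m * x) / of_nat N)) = of_nat N * \<omega> x"
proof -
  have "nome (of_int (m * y) / of_nat N) * nome (- of_int (m * x) / of_nat N) =
      nome (of_int ((y - x) * m) / of_nat N)" for m y
    unfolding nome_add[symmetric] by (simp add: field_simps diff_divide_distrib)
  hence "(\<Sum>m\<in>{0..<int N}. (\<Sum>y\<in>units N. \<omega> y * nome (of_int (m * y) / of_nat N)) *
      nome (- of_int (m * x) / of_nat N)) =
      (\<Sum>m\<in>{0..<int N}. \<Sum>y\<in>units N. \<omega> y * nome (of_int ((y - x) * m) / of_nat N))"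
    unfolding sum_distrib_right by (simp only: mult.assoc)
  also have "\<dots> = (\<Sum>y\<in>units N. \<omega> y * (\<Sum>m\<in>{0..<int N}. nome (of_int ((y - x) * m) / of_nat N)))"
    unfolding sum_distrib_left by (rule sum.swap)
  also have "\<dots> = (\<Sum>y\<in>units N. if y = x then of_nat N * \<omega> x else 0)"
    unfolding sum_nome_frac[OF assms(1)]
    by (intro sum.cong refl) (use assms in \<open>auto simp: dvd_diff_units_iff\<close>)
  also have "\<dots> = of_nat N * \<omega> x" using assms by simp
  finally show ?thesis .
qed

text \<open>Multiplication by one fixed nonresidue maps the nonresidues injectively into the
  residues.\<close>

lemma card_nonresidues_le:
  assumes l: "prime l" "l > 2"
  shows "card {m \<in> {1..<int l}. Legendre m (int l) = - 1} \<le>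
      card {m \<in> {1..<int l}. Legendre m (int l) = 1}"
proof -
  define Q where "Q = {m \<in> {1..<int l}. Legendre m (int l) = 1}"
  define N where "N = {m \<in> {1..<int l}. Legendre m (int l) = - 1}"
  have "card N \<le> card Q"
  proof (cases "N = {}")
    case False
    then obtain k where k: "k \<in> N" by blast
    have "k \<in> units l" unfolding units_prime[OF l(1)] using k by (simp add: N_def)
    hence cop: "coprime k (int l)" by (simp add: units_def)
    show ?thesis
    proof (rule card_inj_on_le[of "\<lambda>m. (k * m) mod int l"])
      show "inj_on (\<lambda>m. (k * m) mod int l) N"
      proof (rule inj_onI)
        fix m n assume mn: "m \<in> N" "n \<in> N" and "(k * m) mod int l = (k * n) mod int l"
        hence "[k * m = k * n] (mod int l)" by (simp add: cong_def)
        hence "[m = n] (mod int l)" using cop by (simp add: cong_mult_lcancel)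
        thus "m = n" using mn by (simp add: cong_def N_def)
      qed
      show "(\<lambda>m. (k * m) mod int l) ` N \<subseteq> Q"
      proof (rule image_subsetI)
        fix m assume m: "m \<in> N"
        have "Legendre ((k * m) mod int l) (int l) = Legendre (k * m) (int l)"
          by (rule Legendre_cong) simp
        hence 1: "Legendre ((k * m) mod int l) (int l) = 1"
          using k m Legendre_mult[OF l] by (simp add: N_def)
        have "(k * m) mod int l \<noteq> 0"
        proof
          assume "(k * m) mod int l = 0"
          with 1 have "Legendre 0 (int l) = 1" by simp
          thus False by (simp add: Legendre_def)
        qed
        moreover have "0 \<le> (k * m) mod int l" "(k * m) mod int l < int l" using l by simp_all
        ultimately have "(k * m) mod int l \<in> {1..<int l}" by auto
        with 1 show "(k * m) mod int l \<in> Q" by (simp add: Q_def)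
      qed
      show "finite Q" by (rule finite_subset[of _ "{1..<int l}"]) (auto simp: Q_def)
    qed
  qed simp
  thus ?thesis by (simp only: Q_def N_def)
qed

text \<open>
  The values \<open>H m\<close> at the quadratic residues already exhaust the \<open>L\<^sup>2\<close>-mass and force the sum over
  the non-residues, so that the Cauchy--Schwarz inequality is tight on the non-residues.
\<close>

lemma quadratic_fourier_transform:
  fixes \<omega> :: "int \<Rightarrow> complex" and c :: complex
  assumes l: "prime l" "l > 2" and norm: "\<And>x. x \<in> units l \<Longrightarrow> norm (\<omega> x) = 1"
  defines "H \<equiv> \<lambda>m. \<Sum>x\<in>units l. \<omega> x * nome (of_int (m * x) / of_nat l)"
  assumes c: "norm c = sqrt l" and res: "\<And>r. \<not> int l dvd r \<Longrightarrow> H (r\<^sup>2) = c" and H0: "H 0 = 0"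
  shows "H m = c * of_int (Legendre m (int l))"
proof -
  let ?l = "int l"
  define Q where "Q = {m \<in> {1..<?l}. Legendre m ?l = 1}"
  define N where "N = {m \<in> {1..<?l}. Legendre m ?l = - 1}"
  have l0: "l > 0" using l by simp
  have split: "{0..<?l} = insert 0 (Q \<union> N)" "Q \<inter> N = {}" "0 \<notin> Q \<union> N"
    using l0 Legendre_cases[of _ ?l] Legendre_eq_0_iff[of _ ?l]
    by (auto simp: Q_def N_def) (metis atLeastLessThan_iff int_one_le_iff_zero_less le_less
        zdvd_not_zless)
  have "Q \<subseteq> {1..<?l}" "N \<subseteq> {1..<?l}" by (auto simp: Q_def N_def)
  hence fin: "finite Q" "finite N" by (auto intro: finite_subset)
  have H_cong: "H m = H n" if "[m = n] (mod ?l)" for m n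
  proof -
    have "[m * x = n * x] (mod ?l)" for x using that by (intro cong_mult) simp_all
    thus ?thesis unfolding H_def using nome_frac_cong by (metis (no_types, lifting))
  qed
  have HQ: "H m = c" if "Legendre m ?l = 1" for m
  proof -
    have "QuadRes ?l m" using that by (auto simp: Legendre_def split: if_splits)
    then obtain r where r: "[r\<^sup>2 = m] (mod ?l)" by (auto simp: QuadRes_def)
    have "\<not> ?l dvd r"
    proof
      assume "?l dvd r"
      hence "[r\<^sup>2 = 0] (mod ?l)" by (simp add: cong_0_iff power2_eq_square)
      hence "[m = 0] (mod ?l)" using r by (metis cong_sym cong_trans)
      thus False using that by (simp add: Legendre_def)
    qed
    thus ?thesis using res H_cong[OF r] by simp
  qed
  have sum_all: "sum f {0..<?l} = f 0 + sum f Q + sum f N" for f :: "int \<Rightarrow> 'a::comm_monoid_add"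
    using split fin by (simp add: sum.union_disjoint add.assoc)
  \<comment> \<open>The sum of the transform over all m is l times the value of the transformed
    function at 0, and 0 is not in \<open>units l\<close>. This determines the sum of
    \<open>H\<close> over \<open>N\<close>.\<close>
  have "sum H {0..<?l} = (\<Sum>x\<in>units l. \<omega> x * (\<Sum>m\<in>{0..<?l}. nome (of_int (x * m) / of_nat l)))"
    unfolding H_def sum_distrib_left by (subst sum.swap) (simp add: mult.commute)
  also have "\<dots> = 0"
    unfolding sum_nome_frac[OF l0]
    by (intro sum.neutral) (use units_prime[OF l(1)] zdvd_not_zless in \<open>auto dest: zdvd_imp_le\<close>)
  finally have sumN: "sum H N = - (of_nat (card Q) * c)"
    unfolding sum_all using H0 HQ by (simp add: Q_def add_eq_0_iff)
  have card_units: "card (units l) = l - 1" using units_prime[OF l(1)] by simp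
  have "(\<Sum>m\<in>{0..<?l}. (norm (H m))\<^sup>2) = l * (l - 1)"
    unfolding H_def parseval_units[OF l0] using norm card_units by simp
  moreover have "(\<Sum>m\<in>Q. (norm (H m))\<^sup>2) = card Q * l"
    using HQ c by (simp add: Q_def)
  moreover have card: "card Q + card N = l - 1"
  proof -
    have "card {0..<?l} = card Q + card N + 1" using split fin by (simp add: card_Un_disjoint)
    thus ?thesis by simp
  qed
  ultimately have sqN: "(\<Sum>m\<in>N. (norm (H m))\<^sup>2) = card N * l"
  proof -
    assume a: "(\<Sum>m\<in>{0..<?l}. (norm (H m))\<^sup>2) = l * (l - 1)" "(\<Sum>m\<in>Q. (norm (H m))\<^sup>2) = card Q * l"
    have "(\<Sum>m\<in>N. (norm (H m))\<^sup>2) = real (l * (card Q + card N)) - real (card Q * l)"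
      using a unfolding sum_all card[symmetric] H0 by simp
    thus ?thesis by (simp add: algebra_simps)
  qed
  \<comment> \<open>By Parseval the mass on \<open>N\<close> is card N times l, and the sum over
    \<open>N\<close> is known. Expanding the square yields 2 l (card N - card Q), which is at most
    0, so every summand vanishes.\<close>
  have "(\<Sum>m\<in>N. (norm (H m + c))\<^sup>2) = (\<Sum>m\<in>N. (norm (H m))\<^sup>2) + 2 * Re (sum H N * cnj c) +
      card N * (norm c)\<^sup>2"
  proof -
    have "(norm (z + c))\<^sup>2 = (norm z)\<^sup>2 + 2 * Re (z * cnj c) + (norm c)\<^sup>2" for z
      unfolding cmod_power2 by (simp add: power2_eq_square algebra_simps)
    thus ?thesis by (simp add: sum.distrib sum_distrib_left sum_distrib_right Re_sum)
  qed
  also have "sum H N * cnj c = - of_real (card Q * l)"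
    unfolding sumN using c complex_norm_square[of c] by (simp add: algebra_simps)
  finally have "(\<Sum>m\<in>N. (norm (H m + c))\<^sup>2) = 2 * l * (real (card N) - real (card Q))"
    using sqN c by (simp add: algebra_simps)
  also have "\<dots> \<le> 0"
    using card_nonresidues_le[OF l] by (simp add: mult_le_0_iff N_def Q_def)
  finally have le: "(\<Sum>m\<in>N. (norm (H m + c))\<^sup>2) \<le> 0" .
  have "(\<Sum>m\<in>N. (norm (H m + c))\<^sup>2) = 0" by (rule antisym[OF le]) (simp add: sum_nonneg)
  hence HN: "H m = - c" if "m \<in> N" for m
    using that fin by (subst (asm) sum_nonneg_eq_0_iff) (auto simp: add_eq_0_iff2)
  define m' where "m' = m mod ?l"
  have m': "[m = m'] (mod ?l)" by (simp add: m'_def cong_def)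
  have "m' \<in> {0..<?l}" using l0 by (simp add: m'_def)
  hence "m' = 0 \<or> m' \<in> Q \<or> m' \<in> N" unfolding split(1) by blast
  hence "H m' = c * of_int (Legendre m' ?l)"
    using H0 HQ HN by (auto simp: Q_def N_def Legendre_def cong_def)
  thus ?thesis using H_cong[OF m'] Legendre_cong[OF m'] by simp
qed

text \<open>Fourier inversion expresses \<omega> x as a multiple of the Gauss sum with additive
  parameter x; substituting m x for m pulls out the Legendre symbol of x.\<close>

lemma quadratic_character_from_transform:
  fixes \<omega> :: "int \<Rightarrow> complex" and c :: complex
  assumes l: "prime l" "l > 2"
    and H: "\<And>m. (\<Sum>x\<in>units l. \<omega> x * nome (of_int (m * x) / of_nat l)) =
        c * of_int (Legendre m (int l))"
    and x: "x \<in> units l"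
  shows "\<omega> x = of_int (Legendre x (int l)) * \<omega> 1"
proof -
  let ?l = "int l"
  have l0: "l > 0" using l by simp
  have inv: "of_nat l * \<omega> y = c * (\<Sum>m\<in>{0..<?l}. of_int (Legendre m ?l) * nome (- of_int (m *
      y) / of_nat l))"
    if "y \<in> units l" for y
    using fourier_inversion_units[OF l0 that, of \<omega>] unfolding H by (simp add: sum_distrib_left
        mult.assoc)
  have ndvd: "\<not> ?l dvd x" using x coprime_int_prime_iff[OF l(1)] by (simp add: units_def)
  have bij: "bij_betw (\<lambda>m. (m * x) mod ?l) {0..<?l} {0..<?l}"
  proof -
    have "inj_on (\<lambda>m. (m * x) mod ?l) {0..<?l}"
    proof (rule inj_onI)
      fix m n assume mn: "m \<in> {0..<?l}" "n \<in> {0..<?l}" "(m * x) mod ?l = (n * x) mod ?l"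
      have "coprime x ?l" using x by (simp add: units_def)
      hence "[m = n] (mod ?l)" using mn(3) by (simp add: cong_def cong_mult_rcancel[unfolded
          cong_def])
      thus "m = n" using mn by (simp add: cong_def)
    qed
    moreover have "(\<lambda>m. (m * x) mod ?l) ` {0..<?l} \<subseteq> {0..<?l}" using l0 by auto
    ultimately show ?thesis by (simp add: bij_betw_def endo_inj_surj)
  qed
  have "(\<Sum>m\<in>{0..<?l}. of_int (Legendre m ?l) * nome (- of_int (m * 1) / of_nat l)) =
      (\<Sum>m\<in>{0..<?l}. of_int (Legendre ((m * x) mod ?l) ?l) * nome (- of_int (((m * x) mod ?l) *
          1) / of_nat l))"
    by (rule sum.reindex_bij_betw[OF bij, symmetric])
  also have "\<dots> = of_int (Legendre x ?l) * (\<Sum>m\<in>{0..<?l}. of_int (Legendre m ?l) *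
      nome (- of_int (m * x) / of_nat l))"
    unfolding sum_distrib_left
  proof (intro sum.cong refl)
    fix m
    have "Legendre ((m * x) mod ?l) ?l = Legendre (m * x) ?l" by (rule Legendre_cong) simp
    moreover have "nome (of_int (- ((m * x) mod ?l)) / of_nat l) =
        nome (of_int (- (m * x)) / of_nat l)"
      by (rule nome_frac_cong) (simp add: cong_def mod_minus_eq)
    ultimately show "of_int (Legendre ((m * x) mod ?l) ?l) * nome (- of_int (((m * x) mod ?l) *
        1) / of_nat l) =
        of_int (Legendre x ?l) * (of_int (Legendre m ?l) * nome (- of_int (m * x) / of_nat l))"
      by (simp add: Legendre_mult[OF l])
  qed
  finally have "of_nat l * \<omega> 1 = of_int (Legendre x ?l) * (of_nat l * \<omega> x)"
    using inv[OF x] inv[of 1] l units_prime[OF l(1)] by simp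
  hence "\<omega> 1 = of_int (Legendre x ?l) * \<omega> x" using l0 by simp
  moreover have "(of_int (Legendre x ?l))\<^sup>2 = (1 :: complex)"
    using Legendre_square[OF ndvd] by (metis of_int_1 of_int_power)
  ultimately show ?thesis by (simp add: power2_eq_square flip: mult.assoc)
qed

section \<open>Evaluation of the eta multiplier\<close>

lemma eta_has_sum:
  assumes "Im \<tau> > 0"
  shows "((\<lambda>k::int. (-1) ^ nat \<bar>k\<bar> * nome (of_int ((6 * k - 1)\<^sup>2) * \<tau> / 24)) has_sum eta \<tau>) UNIV"
proof -
  have "nome (\<tau> / 24) * ((-1) ^ nat \<bar>k\<bar> * nome \<tau> ^ pent k) =
      (-1) ^ nat \<bar>k\<bar> * nome (of_int ((6 * k - 1)\<^sup>2) * \<tau> / 24)" for k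
  proof -
    have "nome (\<tau> / 24) * nome \<tau> ^ pent k = nome (\<tau> / 24 + of_nat (pent k) * \<tau>)"
      by (simp only: nome_add nome_of_nat_mult)
    also have "\<tau> / 24 + of_nat (pent k) * \<tau> = of_int (24 * int (pent k) + 1) * \<tau> / 24"
      by (simp add: field_simps)
    finally show ?thesis unfolding pent_square by simp
  qed
  moreover have "((\<lambda>k. nome (\<tau> / 24) * ((-1) ^ nat \<bar>k\<bar> * nome \<tau> ^ pent k)) has_sum
      nome (\<tau> / 24) * euler_prod (nome \<tau>)) UNIV"
    by (intro has_sum_cmult_right pentagonal_number_theorem norm_nome_less_1 assms)
  ultimately show ?thesis by (simp only: eta_eq)
qed

lemma has_sum_finite_sum:
  fixes f :: "'b \<Rightarrow> 'a \<Rightarrow> complex"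
  assumes "finite B" and "\<And>b. b \<in> B \<Longrightarrow> (f b has_sum S b) A"
  shows "((\<lambda>k. \<Sum>b\<in>B. f b k) has_sum (\<Sum>b\<in>B. S b)) A"
  using assms by (induction B rule: finite_induct) (auto intro: has_sum_add)

lemma prime_mod_6:
  assumes "prime l" and "l > (3::nat)"
  obtains u e :: int where "int l = 6 * u + e" "e = 1 \<or> e = - 1" "u \<ge> 1"
proof -
  have "\<not> 2 dvd l" "\<not> 3 dvd l"
    using assms primes_dvd_imp_eq[of 2 l] primes_dvd_imp_eq[of 3 l] by auto
  hence "\<not> (2::int) dvd int l" "\<not> (3::int) dvd int l"
    by (metis int_dvd_int_iff of_nat_numeral)+
  hence "int l mod 6 = 1 \<or> int l mod 6 = 5" by presburger
  thus ?thesis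
  proof
    assume "int l mod 6 = 1"
    hence "int l = 6 * (int l div 6) + 1" by presburger
    moreover have "int l div 6 \<ge> 1" using assms(2) \<open>int l mod 6 = 1\<close> by presburger
    ultimately show ?thesis using that[of "int l div 6" 1] by blast
  next
    assume "int l mod 6 = 5"
    hence "int l = 6 * (int l div 6 + 1) + - 1" by presburger
    moreover have "int l div 6 + 1 \<ge> 1" by simp
    ultimately show ?thesis using that[of "int l div 6 + 1" "- 1"] by blast
  qed
qed

lemma minus_one_power_abs: "(-1) ^ nat \<bar>k\<bar> = (if even k then 1 else - 1 :: complex)"
  by (simp add: minus_one_power_iff even_nat_iff)

text \<open>Averaging keeps the exponents (6k-1)^2 divisible by N, which by \<open>dvd\<close> means
  l dividing 6k-1. On that progression 6k-1 = e l (6j-1), so the series of eta reappears at l^2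
  \<tau>, up to a constant sign. The hypothesis \<open>dvd\<close> covers N = l and N = l^2 at
  once.\<close>

lemma eta_shift_sum:
  assumes l: "prime l" "l > 3" and N: "N > 0" and dvd: "\<And>m. int N dvd m\<^sup>2 \<longleftrightarrow> int l dvd m"
    and \<tau>: "Im \<tau> > 0"
  shows "(\<Sum>b\<in>{0..<int N}. eta (\<tau> + 24 * of_int b / of_nat N)) =
         of_nat N * of_int (Legendre 3 (int l)) * eta ((of_nat l)\<^sup>2 * \<tau>)"
proof -
  let ?\<chi> = "of_int (Legendre 3 (int l)) :: complex"
  obtain u e where ue: "int l = 6 * u + e" "e = 1 \<or> e = - 1" "u \<ge> 1" using prime_mod_6[OF l] .
  define f where "f = (\<lambda>k::int. (-1) ^ nat \<bar>k\<bar> * nome (of_int ((6 * k - 1)\<^sup>2) * \<tau> / 24))"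
  have "((\<lambda>k. f k * nome (of_int ((6 * k - 1)\<^sup>2 * b) / of_nat N)) has_sum
      eta (\<tau> + 24 * of_int b / of_nat N)) UNIV" for b
  proof -
    have "f k * nome (of_int ((6 * k - 1)\<^sup>2 * b) / of_nat N) = (-1) ^ nat \<bar>k\<bar> *
        nome (of_int ((6 * k - 1)\<^sup>2) * (\<tau> + 24 * of_int b / of_nat N) / 24)" for k
      unfolding f_def mult.assoc nome_add[symmetric] by (simp add: algebra_simps add_divide_distrib)
    thus ?thesis using eta_has_sum[of "\<tau> + 24 * of_int b / of_nat N"] \<tau> by simp
  qed
  hence "((\<lambda>k. \<Sum>b\<in>{0..<int N}. f k * nome (of_int ((6 * k - 1)\<^sup>2 * b) / of_nat N)) has_sum
      (\<Sum>b\<in>{0..<int N}. eta (\<tau> + 24 * of_int b / of_nat N))) UNIV"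
    by (intro has_sum_finite_sum) auto
  hence "((\<lambda>k. f k * (if int l dvd 6 * k - 1 then of_nat N else 0)) has_sum
      (\<Sum>b\<in>{0..<int N}. eta (\<tau> + 24 * of_int b / of_nat N))) UNIV"
    unfolding sum_distrib_left[symmetric] sum_nome_frac[OF N] dvd .
  hence "((\<lambda>k. f k * of_nat N) has_sum
      (\<Sum>b\<in>{0..<int N}. eta (\<tau> + 24 * of_int b / of_nat N))) {k. int l dvd 6 * k - 1}"
    by (rule has_sum_cong_neutral[THEN iffD1, rotated -1]) auto
  moreover have "((\<lambda>k. f k * of_nat N) has_sum
      of_nat N * ?\<chi> * eta ((of_nat l)\<^sup>2 * \<tau>)) {k. int l dvd 6 * k - 1}"
  proof -
    \<comment> \<open>Solves 6 \<phi>(j) - 1 = e l (6j - 1), using e^2 = 1.\<close>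
    define \<phi> where "\<phi> = (\<lambda>j. e * (int l * j - u))"
    have l0: "int l \<noteq> 0" using l by simp
    have \<phi>: "6 * \<phi> j - 1 = e * int l * (6 * j - 1)" for j
      using ue(2) unfolding \<phi>_def ue(1) by (auto simp: algebra_simps)
    have inj: "inj \<phi>" using l0 ue(2) by (auto simp: inj_def \<phi>_def)
    have range: "range \<phi> = {k. int l dvd 6 * k - 1}"
    proof (intro equalityI subsetI)
      fix k assume "k \<in> {k. int l dvd 6 * k - 1}"
      then obtain m where m: "6 * k - 1 = int l * m" by (auto elim: dvdE)
      hence "6 dvd e * m + 1"
      proof -
        have "e * m + 1 = 6 * (k - u * m)" using m unfolding ue(1) by (simp add: algebra_simps)
        thus ?thesis by simp
      qed
      then obtain j where j: "e * m + 1 = 6 * j" by (auto elim: dvdE)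
      have ee: "e * e = 1" using ue(2) by auto
      have "6 * \<phi> j - 1 = e * int l * (e * m)" using \<phi>[of j] j by simp
      also have "\<dots> = (e * e) * (int l * m)" by (simp add: mult_ac)
      also have "\<dots> = 6 * k - 1" by (simp add: ee m)
      finally have "\<phi> j = k" by simp
      thus "k \<in> range \<phi>" by blast
    qed (auto simp: \<phi>)
    have f\<phi>: "f (\<phi> j) * of_nat N = of_nat N * ?\<chi> *
        ((-1) ^ nat \<bar>j\<bar> * nome (of_int ((6 * j - 1)\<^sup>2) * ((of_nat l)\<^sup>2 * \<tau>) / 24))" for j
    proof -
      \<comment> \<open>Since l is odd, \<phi>(j) has the parity of j + u, and the sign splits into
        (-1)^u = (3/l) and (-1)^j.\<close>
      have "odd (int l)" using ue(1,2) by auto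
      hence "even (\<phi> j) \<longleftrightarrow> (even j \<longleftrightarrow> even u)" using ue(2) by (auto simp: \<phi>_def)
      moreover have "Legendre 3 (int l) = (if even u then 1 else - 1)"
        using Legendre_3[OF l ue(1,2)] ue(3) by (simp add: minus_one_power_iff even_nat_iff)
      ultimately have "(-1) ^ nat \<bar>\<phi> j\<bar> = ?\<chi> * (-1) ^ nat \<bar>j\<bar>"
        unfolding minus_one_power_abs by simp
      moreover have "(6 * \<phi> j - 1)\<^sup>2 = (6 * j - 1)\<^sup>2 * (int l)\<^sup>2"
        unfolding \<phi> using ue(2) by (auto simp: power_mult_distrib)
      hence "nome (of_int ((6 * \<phi> j - 1)\<^sup>2) * \<tau> / 24) =
          nome (of_int ((6 * j - 1)\<^sup>2) * ((of_nat l)\<^sup>2 * \<tau>) / 24)"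
        by (simp add: mult_ac)
      ultimately show ?thesis unfolding f_def by simp
    qed
    have "Im ((of_nat l)\<^sup>2 * \<tau>) > 0"
      using \<tau> l by (simp flip: of_nat_power)
    hence "((\<lambda>j. f (\<phi> j) * of_nat N) has_sum of_nat N * ?\<chi> * eta ((of_nat l)\<^sup>2 * \<tau>)) UNIV"
      unfolding f\<phi> by (intro has_sum_cmult_right eta_has_sum)
    thus ?thesis unfolding range[symmetric] by (subst has_sum_reindex[OF inj]) (simp add: o_def)
  qed
  ultimately show ?thesis by (rule has_sum_unique)
qed

lemma eta_inversion_scaled:
  assumes "Im \<tau> > 0" and "c > 0"
  shows "eta (- 1 / (of_real c * \<tau>)) = of_real (sqrt c) * csqrt (- \<i> * \<tau>) * eta (of_real c * \<tau>)"
proof -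
  have "Im (of_real c * \<tau>) > 0" using assms by simp
  from eta_inversion[OF this] have "eta (- 1 / (of_real c * \<tau>)) =
      csqrt (of_real c * (- \<i> * \<tau>)) * eta (of_real c * \<tau>)"
    by (simp add: mult_ac)
  also have "csqrt (of_real c * (- \<i> * \<tau>)) = of_real (sqrt c) * csqrt (- \<i> * \<tau>)"
    by (rule csqrt_of_real_mult) (use assms in auto)
  finally show ?thesis .
qed

lemma eta_inversion_square:
  assumes "Im \<tau> > 0" and "n > 0"
  shows "eta (- 1 / ((of_nat n)\<^sup>2 * \<tau>)) = of_nat n * csqrt (- \<i> * \<tau>) * eta ((of_nat n)\<^sup>2 * \<tau>)"
  using eta_inversion_scaled[of \<tau> "(real n)\<^sup>2"] assms by (simp add: real_sqrt_abs)

lemma Im_minus_inverse_square_pos: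
  assumes "Im \<tau> > 0" and "n > 0"
  shows "Im (- 1 / ((of_nat n)\<^sup>2 * \<tau>)) > 0"
  using assms by (intro Im_minus_inverse_pos) (simp flip: of_nat_power)

text \<open>\<open>eta_shift_sum\<close> at -1/(l^2 \<tau>), with every term inverted. The shift 0
  gives eta (l^2 \<tau>), the shifts coprime to l bring in the unknown multipliers, and the right
  side gives eta \<tau>: a linear relation for the multipliers.\<close>

lemma eta_mult_twisted_sum_prime:
  assumes l: "prime l" "l > 3" and \<tau>: "Im \<tau> > 0"
    and \<nu>: "bij_betw \<nu> (units l) (units l)" "\<And>x. x \<in> units l \<Longrightarrow> int l dvd 576 * x * \<nu> x + 1"
  shows "of_real (sqrt l) * (\<Sum>x\<in>units l. eta_mult l (\<nu> x) x * eta (\<tau> + 24 * of_int x / of_nat l)) =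
    of_nat l * of_int (Legendre 3 (int l)) * eta \<tau> - of_nat l * eta ((of_nat l)\<^sup>2 * \<tau>)"
proof -
  have l0: "l > 0" using l by simp
  let ?r = "csqrt (- \<i> * \<tau>)" and ?\<chi> = "of_int (Legendre 3 (int l)) :: complex"
  let ?t = "- 1 / ((of_nat l)\<^sup>2 * \<tau>)"
  have r0: "?r \<noteq> 0" using \<tau> by auto
  have "int l dvd m\<^sup>2 \<longleftrightarrow> int l dvd m" for m
    using l(1) by (simp add: prime_dvd_power_iff)
  from eta_shift_sum[OF l l0 this Im_minus_inverse_square_pos[OF \<tau> l0]]
  have "(\<Sum>b\<in>{0..<int l}. eta (?t + 24 * of_int b / of_nat l)) =
      of_nat l * ?\<chi> * eta ((of_nat l)\<^sup>2 * ?t)" .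
  also have "(of_nat l)\<^sup>2 * ?t = - 1 / \<tau>" using l0 by simp
  also have "eta (- 1 / \<tau>) = ?r * eta \<tau>" by (rule eta_inversion[OF \<tau>])
  also have "{0..<int l} = insert 0 (units l)" using units_prime[OF l(1)] l0 by auto
  also have "(\<Sum>b\<in>insert 0 (units l). eta (?t + 24 * of_int b / of_nat l)) =
      eta ?t + (\<Sum>b\<in>units l. eta (?t + 24 * of_int b / of_nat l))"
    using units_prime[OF l(1)] by simp
  also have "eta ?t = of_nat l * ?r * eta ((of_nat l)\<^sup>2 *
      \<tau>)" by (rule eta_inversion_square[OF \<tau> l0])
  also have "(\<Sum>b\<in>units l. eta (?t + 24 * of_int b / of_nat l)) =
      (\<Sum>x\<in>units l. eta (?t + 24 * of_int (\<nu> x) / of_nat l))"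
    by (rule sum.reindex_bij_betw[OF \<nu>(1), symmetric])
  also have "\<dots> = (\<Sum>x\<in>units l. eta_mult l (\<nu> x) x * of_real (sqrt l) * ?r * eta (\<tau> +
      24 * of_int x / of_nat l))"
    by (intro sum.cong refl, subst eta_mult_eq[OF l0 \<nu>(2) \<tau>, symmetric]) simp_all
  also have "\<dots> = ?r * (of_real (sqrt l) * (\<Sum>x\<in>units l. eta_mult l (\<nu> x) x * eta (\<tau> +
      24 * of_int x / of_nat l)))"
    by (simp add: sum_distrib_left mult_ac)
  finally have "?r * (of_nat l * eta ((of_nat l)\<^sup>2 * \<tau>) +
      of_real (sqrt l) * (\<Sum>x\<in>units l. eta_mult l (\<nu> x) x * eta (\<tau> + 24 * of_int x / of_nat l))) =
      ?r * (of_nat l * ?\<chi> * eta \<tau>)" by (simp add: algebra_simps)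
  hence "of_nat l * eta ((of_nat l)\<^sup>2 * \<tau>) +
      of_real (sqrt l) * (\<Sum>x\<in>units l. eta_mult l (\<nu> x) x * eta (\<tau> + 24 * of_int x / of_nat l)) =
      of_nat l * ?\<chi> * eta \<tau>" using r0 by (simp only: mult_cancel_left) simp
  thus ?thesis by (simp add: algebra_simps)
qed

text \<open>The difference of \<open>eta_shift_sum\<close> for N = l^2 and for N = l, both at
  -1/(l^4 \<tau>), isolates the shifts coprime to l.\<close>

lemma eta_mult_twisted_sum_prime_square:
  assumes l: "prime l" "l > 3" and \<tau>: "Im \<tau> > 0"
    and \<nu>: "bij_betw \<nu> (units (l\<^sup>2)) (units (l\<^sup>2))"
      "\<And>x. x \<in> units (l\<^sup>2) \<Longrightarrow> int (l\<^sup>2) dvd 576 * x * \<nu> x + 1"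
  shows "(\<Sum>x\<in>units (l\<^sup>2). eta_mult (l\<^sup>2) (\<nu> x) x * eta (\<tau> + 24 * of_int x / of_nat (l\<^sup>2))) =
    of_nat (l\<^sup>2 - l) * of_int (Legendre 3 (int l)) * eta ((of_nat l)\<^sup>2 * \<tau>)"
proof -
  have l0: "l > 0" "l\<^sup>2 > 0" using l by simp_all
  let ?r = "csqrt (- \<i> * \<tau>)" and ?\<chi> = "of_int (Legendre 3 (int l)) :: complex"
  define t where "t = - 1 / ((of_nat (l\<^sup>2))\<^sup>2 * \<tau>)"
  have t: "Im t > 0" unfolding t_def by (rule Im_minus_inverse_square_pos[OF \<tau> l0(2)])
  have r0: "?r \<noteq> 0" using \<tau> by auto
  have "(of_nat l)\<^sup>2 * t = - 1 / ((of_nat l)\<^sup>2 * \<tau>)" using l0 by (simp add: t_def power2_eq_square)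
  hence e: "eta ((of_nat l)\<^sup>2 * t) = of_nat l * ?r * eta ((of_nat l)\<^sup>2 * \<tau>)"
    using eta_inversion_square[OF \<tau> l0(1)] by simp
  have "int l dvd m\<^sup>2 \<longleftrightarrow> int l dvd m" for m
    using l(1) by (simp add: prime_dvd_power_iff)
  note 1 = eta_shift_sum[OF l l0(1) this t, unfolded e]
  have "int (l\<^sup>2) dvd m\<^sup>2 \<longleftrightarrow> int l dvd m" for m by simp
  note 2 = eta_shift_sum[OF l l0(2) this t, unfolded e]
  have "eta (t + 24 * of_int (int l * c) / of_nat (l\<^sup>2)) = eta (t + 24 * of_int c / of_nat l)" for c
    using l0 by (simp add: power2_eq_square)
  hence "(\<Sum>b\<in>units (l\<^sup>2). eta (t + 24 * of_int b / of_nat (l\<^sup>2))) =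
      of_nat (l\<^sup>2) * ?\<chi> * (of_nat l * ?r * eta ((of_nat l)\<^sup>2 * \<tau>)) -
      of_nat l * ?\<chi> * (of_nat l * ?r * eta ((of_nat l)\<^sup>2 * \<tau>))"
    using 2[unfolded sum_prime_square_residues[OF l(1)]] 1 by (simp add: eq_diff_eq)
  also have "\<dots> = of_nat l * ?r * (of_nat (l\<^sup>2 - l) * ?\<chi> * eta ((of_nat l)\<^sup>2 * \<tau>))"
  proof -
    have "l \<le> l\<^sup>2" using l0(1) by (simp add: power2_eq_square)
    hence diff: "of_nat (l\<^sup>2 - l) = (of_nat (l\<^sup>2) - of_nat l :: complex)" by (rule of_nat_diff)
    show ?thesis unfolding diff by (simp only: algebra_simps)
  qed
  also have "(\<Sum>b\<in>units (l\<^sup>2). eta (t + 24 * of_int b / of_nat (l\<^sup>2))) =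
      (\<Sum>x\<in>units (l\<^sup>2). eta (t + 24 * of_int (\<nu> x) / of_nat (l\<^sup>2)))"
    by (rule sum.reindex_bij_betw[OF \<nu>(1), symmetric])
  also have "\<dots> = (\<Sum>x\<in>units (l\<^sup>2). eta_mult (l\<^sup>2) (\<nu> x) x * of_real (sqrt (l\<^sup>2)) * ?r * eta (\<tau> +
      24 * of_int x / of_nat (l\<^sup>2)))"
    by (intro sum.cong refl, subst eta_mult_eq[OF l0(2) \<nu>(2) \<tau>, symmetric]) (simp_all add: t_def)
  also have "\<dots> = of_nat l * ?r * (\<Sum>x\<in>units (l\<^sup>2). eta_mult (l\<^sup>2) (\<nu> x) x * eta (\<tau> +
      24 * of_int x / of_nat (l\<^sup>2)))"
    by (simp add: sum_distrib_left mult_ac)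
  finally show ?thesis using r0 l0 by (simp only: mult_cancel_left) simp
qed

text \<open>After division by exp (2 pi i \<tau>/24), every shift of eta is a power series in the
  nome, whose n-th coefficient is twisted by a phase that sees x only through (24n+1) x. This makes
  relations between shifts comparable coefficient by coefficient.\<close>

lemma eta_shift_sums:
  assumes "Im \<tau> > 0"
  shows "(\<lambda>n. pent_coeff n * nome (of_int ((24 * int n + 1) * x) / of_nat N) * nome \<tau> ^ n) sums
    (eta (\<tau> + 24 * of_int x / of_nat N) / nome (\<tau> / 24))"
proof (cases "N = 0")
  \<comment> \<open>Division by zero being zero, this case is the unshifted series;
    \<open>eta_mult_prime\<close> uses it in that role.\<close>
  case True
  have "(\<lambda>n. pent_coeff n * nome \<tau> ^ n) sums euler_prod (nome \<tau>)"
    by (rule has_sum_imp_sums[OF euler_prod_has_sum_pent_coeff[OF norm_nome_less_1[OF assms]]])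
  thus ?thesis using True by (simp add: eta_eq)
next
  case False
  let ?w = "nome (of_int x / of_nat N)"
  define \<rho> where "\<rho> = \<tau> + 24 * of_int x / of_nat N"
  have \<rho>: "Im \<rho> > 0" using assms by (simp add: \<rho>_def)
  have w: "nome \<rho> = nome \<tau> * ?w ^ 24"
    unfolding nome_frac_mult_nat by (simp add: \<rho>_def nome_add mult.commute)
  have "(\<lambda>n. pent_coeff n * nome \<rho> ^ n) sums euler_prod (nome \<rho>)"
    by (rule has_sum_imp_sums[OF euler_prod_has_sum_pent_coeff[OF norm_nome_less_1[OF \<rho>]]])
  hence "(\<lambda>n. ?w * (pent_coeff n * nome \<rho> ^ n)) sums (?w * euler_prod (nome \<rho>))"
    by (rule sums_mult)
  moreover have "?w * (pent_coeff n * nome \<rho> ^ n) =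
      pent_coeff n * nome (of_int ((24 * int n + 1) * x) / of_nat N) * nome \<tau> ^ n" for n
  proof -
    have "nome (of_int ((24 * int n + 1) * x) / of_nat N) = ?w ^ (24 * n + 1)"
      unfolding nome_frac_mult_nat by (simp add: mult.commute add.commute)
    thus ?thesis unfolding w by (simp add: power_mult_distrib power_mult)
  qed
  moreover have "eta \<rho> / nome (\<tau> / 24) = ?w * euler_prod (nome \<rho>)"
  proof -
    have "\<rho> / 24 = \<tau> / 24 + of_int x / of_nat N" by (simp add: \<rho>_def add_divide_distrib)
    thus ?thesis by (simp only: eta_eq nome_add) simp
  qed
  ultimately show ?thesis unfolding \<rho>_def[symmetric] by (simp only:)
qed

text \<open>The integer form of \<open>s_ell\<close>; the division is exact for primes above 3, as
  the next lemma shows.\<close>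

definition s_nat :: "nat \<Rightarrow> nat" where
  "s_nat l = (l\<^sup>2 - 1) div 24"

lemma s_nat:
  assumes "prime l" and "l > 3"
  shows "24 * s_nat l + 1 = l\<^sup>2"
proof -
  obtain u e where ue: "int l = 6 * u + e" "e = 1 \<or> e = - 1" "u \<ge> 1" using prime_mod_6[OF assms] .
  have "int (l\<^sup>2) = (6 * u + e)\<^sup>2" by (simp add: ue(1))
  also have "\<dots> = 12 * (u * (3 * u + e)) + 1" using ue(2) by (auto simp: power2_eq_square
      algebra_simps)
  finally have sq: "int (l\<^sup>2) = 12 * (u * (3 * u + e)) + 1" .
  moreover have "even (u * (3 * u + e))" using ue(2) by auto
  then obtain v where "u * (3 * u + e) = 2 * v" by (elim evenE)
  ultimately have "int (l\<^sup>2) = 24 * v + 1" by simp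
  hence "int (l\<^sup>2 - 1) = 24 * v" using assms by (simp add: of_nat_diff)
  hence "24 dvd l\<^sup>2 - 1" by (metis dvd_triv_left int_dvd_int_iff of_nat_numeral)
  hence "24 * s_nat l = l\<^sup>2 - 1" by (simp add: s_nat_def)
  moreover have "l\<^sup>2 \<ge> 1" using assms by simp
  ultimately show ?thesis by simp
qed

text \<open>(l^2-1)/24 is itself a pentagonal number, of index u or -u for l = 6u - 1 or 6u + 1.
  Hence coefficients can be read off at n = \<open>s_nat l\<close>, where 24n+1 = l^2.\<close>

lemma pent_coeff_s_nat:
  assumes "prime l" and "l > 3"
  shows "pent_coeff (s_nat l) = of_int (Legendre 3 (int l))"
proof -
  obtain u e where ue: "int l = 6 * u + e" "e = 1 \<or> e = - 1" "u \<ge> 1" using prime_mod_6[OF assms] .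
  have "24 * int (pent (- e * u)) + 1 = (6 * (- e * u) - 1)\<^sup>2" by (rule pent_square)
  also have "\<dots> = (int l)\<^sup>2" unfolding ue(1) using ue(2) by (auto simp: power2_eq_square
      algebra_simps)
  also have "\<dots> = 24 * int (s_nat l) + 1" using s_nat[OF assms] by (metis of_nat_1 of_nat_add
      of_nat_mult of_nat_numeral of_nat_power)
  finally have "pent (- e * u) = s_nat l" by simp
  hence "pent_coeff (s_nat l) = (-1) ^ nat \<bar>- e * u\<bar>" using pent_coeff_pent by metis
  also have "nat \<bar>- e * u\<bar> = nat u" using ue by auto
  finally show ?thesis using Legendre_3[OF assms ue(1,2)] by simp
qed

text \<open>The coefficients of q^s S(q^d) when S has the coefficients \<open>a\<close>.\<close>

definition dilated_coeff :: "nat \<Rightarrow> nat \<Rightarrow> (nat \<Rightarrow> complex) \<Rightarrow> nat \<Rightarrow> complex" where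
  "dilated_coeff d s a n = (if n \<ge> s \<and> d dvd n - s then a ((n - s) div d) else 0)"

lemma dilated_coeff_has_sum:
  assumes "d > 0" and "((\<lambda>n. a n * (q ^ d) ^ n) has_sum S) UNIV"
  shows "((\<lambda>n. dilated_coeff d s a n * q ^ n) has_sum q ^ s * S) UNIV"
proof -
  let ?h = "\<lambda>k. d * k + s"
  have inj: "inj ?h" using assms(1) by (auto simp: inj_def)
  have "((\<lambda>k. q ^ s * (a k * (q ^ d) ^ k)) has_sum q ^ s * S) UNIV"
    by (intro has_sum_cmult_right assms(2))
  moreover have "dilated_coeff d s a (?h k) * q ^ ?h k = q ^ s * (a k * (q ^ d) ^ k)" for k
    using assms(1) by (simp add: dilated_coeff_def power_add power_mult)
  ultimately have "((\<lambda>n. dilated_coeff d s a n * q ^ n) has_sum q ^ s * S) (range ?h)"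
    by (subst has_sum_reindex[OF inj]) (simp only: o_def)
  thus ?thesis
  proof (rule has_sum_cong_neutral[THEN iffD1, rotated -1])
    fix n assume "n \<in> UNIV - range ?h"
    moreover have "n \<in> range ?h" if n: "n \<ge> s" "d dvd n - s"
    proof -
      obtain k where "n - s = d * k" using n(2) by (auto elim: dvdE)
      hence "n = ?h k" using n(1) by simp
      thus ?thesis by blast
    qed
    ultimately show "dilated_coeff d s a n * q ^ n = 0" by (auto simp: dilated_coeff_def)
  qed auto
qed

lemma eta_dilated_sums:
  assumes "prime l" and "l > 3" and "Im \<tau> > 0"
  shows "(\<lambda>n. dilated_coeff (l\<^sup>2) (s_nat l) pent_coeff n * nome \<tau> ^ n) sums
    (eta ((of_nat l)\<^sup>2 * \<tau>) / nome (\<tau> / 24))"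
proof -
  have l0: "l\<^sup>2 > 0" using assms by simp
  have t: "Im (of_nat (l\<^sup>2) * \<tau>) > 0" using assms l0 by (simp del: of_nat_power)
  have "((\<lambda>n. pent_coeff n * (nome \<tau> ^ l\<^sup>2) ^ n) has_sum euler_prod (nome (of_nat (l\<^sup>2) * \<tau>))) UNIV"
    using euler_prod_has_sum_pent_coeff[OF norm_nome_less_1[OF t]] by (simp add: nome_of_nat_mult
        del: of_nat_power)
  from has_sum_imp_sums[OF dilated_coeff_has_sum[OF l0 this, of "s_nat l"]]
  have "(\<lambda>n. dilated_coeff (l\<^sup>2) (s_nat l) pent_coeff n * nome \<tau> ^ n) sums
      (nome \<tau> ^ s_nat l * euler_prod (nome (of_nat (l\<^sup>2) * \<tau>)))" .
  moreover have "of_nat (l\<^sup>2) * \<tau> / 24 = \<tau> / 24 + of_nat (s_nat l) * \<tau>"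
    using s_nat[OF assms(1,2), symmetric] by (simp add: field_simps del: of_nat_power)
  hence "eta (of_nat (l\<^sup>2) * \<tau>) / nome (\<tau> / 24) =
      nome \<tau> ^ s_nat l * euler_prod (nome (of_nat (l\<^sup>2) * \<tau>))"
    by (simp only: eta_eq nome_add nome_of_nat_mult) simp
  ultimately show ?thesis by simp
qed

lemma dilated_coeff_s: "d > 0 \<Longrightarrow> dilated_coeff d s a s = a 0"
  by (simp add: dilated_coeff_def)

lemma pent_coeff_0: "pent_coeff 0 = 1"
  using pent_coeff_pent[of 0] by (simp add: pent_def)

lemma coprime_1152_prime:
  assumes "prime l" and "l > 3"
  shows "coprime 1152 (int l)"
proof -
  have "\<not> l dvd 1152"
  proof
    assume "l dvd 1152"
    hence "l dvd 2 ^ 7 * 3 ^ 2" by simp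
    hence "l dvd 2 ^ 7 \<or> l dvd 3 ^ 2" using assms(1) prime_dvd_mult_iff by blast
    hence "l dvd 2 \<or> l dvd 3" using assms(1) prime_dvd_power by blast
    thus False using assms(2) by (auto dest: dvd_imp_le)
  qed
  hence "\<not> int l dvd 1152" by (metis int_dvd_int_iff of_nat_numeral)
  thus ?thesis using coprime_int_prime_iff[OF assms(1)] by blast
qed

lemma coprime_576_prime:
  assumes "prime l" and "l > 3"
  shows "coprime 576 (int l)"
proof -
  have "coprime (2 * 576) (int l)" using coprime_1152_prime[OF assms] by simp
  thus ?thesis by (simp only: coprime_mult_left_iff)
qed

lemma Legendre_3_nonzero:
  assumes "prime l" and "l > 3"
  shows "Legendre 3 (int l) \<noteq> 0"
  unfolding Legendre_eq_0_iff using assms zdvd_imp_le[of "int l" 3] by auto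

text \<open>The condition determines y modulo N from x, so every admissible pair is congruent to one
  listed by \<nu>.\<close>

lemma eta_mult_reduce:
  assumes N: "N > 1" and dvd: "int N dvd 576 * x * y + 1"
    and \<nu>: "bij_betw \<nu> (units N) (units N)" "\<And>x. x \<in> units N \<Longrightarrow> int N dvd 576 * x * \<nu> x + 1"
  shows "x mod int N \<in> units N" and "eta_mult N y x = eta_mult N (\<nu> (x mod int N)) (x mod int N)"
proof -
  define x' where "x' = x mod int N"
  have cop: "coprime (576 * x) (int N)"
  proof (rule coprimeI)
    fix c assume "c dvd 576 * x" "c dvd int N"
    hence "c dvd 576 * x * y + 1" "c dvd 576 * x * y" using dvd dvd_trans by auto
    thus "is_unit c" by (metis dvd_add_right_iff)
  qed
  hence "coprime x (int N)" by (simp only: coprime_mult_left_iff)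
  thus x': "x mod int N \<in> units N" using N by (simp add: units_def)
  have xx': "[x = x'] (mod int N)" by (simp add: x'_def cong_def)
  have "[576 * x * y + 1 = 576 * x' * \<nu> x' + 1] (mod int N)"
    using dvd \<nu>(2)[OF x'] unfolding x'_def by (metis cong_0_iff cong_sym cong_trans)
  moreover have "[576 * x' * \<nu> x' + 1 = 576 * x * \<nu> x' + 1] (mod int N)"
    by (intro cong_add cong_mult cong_refl cong_sym[OF xx'])
  ultimately have "[576 * x * y + 1 = 576 * x * \<nu> x' + 1] (mod int N)" by (rule cong_trans)
  hence "[576 * x * y = 576 * x * \<nu> x'] (mod int N)" by (simp only: cong_add_rcancel)
  hence "[y = \<nu> x'] (mod int N)" using cop by (simp only: cong_mult_lcancel)
  thus "eta_mult N y x = eta_mult N (\<nu> (x mod int N)) (x mod int N)"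
    using xx' N unfolding x'_def by (intro eta_mult_cong) auto
qed

text \<open>At n = \<open>s_nat l\<close> all phases have numerator divisible by l^2 and become 1.
  Comparing this one coefficient shows that the multipliers add up to their number; being of modulus
  1, they all equal 1.\<close>

theorem eta_mult_prime_square:
  assumes l: "prime l" "l > 3" and dvd: "int (l\<^sup>2) dvd 576 * x * y + 1"
  shows "eta_mult (l\<^sup>2) y x = 1"
proof -
  have l0: "l\<^sup>2 > 0" "l\<^sup>2 > 1" using l one_less_power[of l 2] by simp_all
  have "coprime 576 (int (l\<^sup>2))" using coprime_576_prime[OF l] by simp
  then obtain \<nu> where \<nu>: "bij_betw \<nu> (units (l\<^sup>2)) (units (l\<^sup>2))"
      "\<And>x. x \<in> units (l\<^sup>2) \<Longrightarrow> int (l\<^sup>2) dvd 576 * x * \<nu> x + 1"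
    using neg_inverse_bij[OF _ l0(2)] by blast
  define \<omega> where "\<omega> = (\<lambda>x. eta_mult (l\<^sup>2) (\<nu> x) x)"
  let ?\<chi> = "of_int (Legendre 3 (int l)) :: complex"
  have norm: "norm (\<omega> x) = 1" if "x \<in> units (l\<^sup>2)" for x
    unfolding \<omega>_def by (rule norm_eta_mult[OF l0(1) \<nu>(2)[OF that]])
  have "(\<lambda>n. pent_coeff n * (\<Sum>x\<in>units (l\<^sup>2). \<omega> x * nome (of_int ((24 * int n +
      1) * x) / of_nat (l\<^sup>2)))) =
      (\<lambda>n. of_nat (l\<^sup>2 - l) * ?\<chi> * dilated_coeff (l\<^sup>2) (s_nat l) pent_coeff n)"
  proof (rule power_series_unique)
    fix q :: complex assume "0 < norm q" "norm q < 1"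
    then obtain \<tau> where \<tau>: "Im \<tau> > 0" "nome \<tau> = q" by (rule ex_nome)
    \<comment> \<open>The common value must be a function of q, so it is named by one of the two
      series and not by the eta quotient at the chosen \<tau>.\<close>
    define f where "f = (\<lambda>q. \<Sum>n. of_nat (l\<^sup>2 -
        l) * ?\<chi> * dilated_coeff (l\<^sup>2) (s_nat l) pent_coeff n * q ^ n)"
    have "(\<lambda>n. of_nat (l\<^sup>2 - l) * ?\<chi> * (dilated_coeff (l\<^sup>2) (s_nat l) pent_coeff n *
        nome \<tau> ^ n)) sums
        (of_nat (l\<^sup>2 - l) * ?\<chi> * (eta ((of_nat l)\<^sup>2 * \<tau>) / nome (\<tau> / 24)))"
      by (intro sums_mult eta_dilated_sums l \<tau>)
    hence 1: "(\<lambda>n. of_nat (l\<^sup>2 - l) * ?\<chi> * dilated_coeff (l\<^sup>2) (s_nat l) pent_coeff n * q ^ n) sums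
        (of_nat (l\<^sup>2 - l) * ?\<chi> * (eta ((of_nat l)\<^sup>2 * \<tau>) / nome (\<tau> / 24)))"
      by (simp add: \<tau>(2) mult.assoc)
    thus "(\<lambda>n. of_nat (l\<^sup>2 - l) * ?\<chi> * dilated_coeff (l\<^sup>2) (s_nat l) pent_coeff n * q ^ n) sums f q"
      unfolding f_def using summable_sums sums_summable by blast
    have "(\<lambda>n. \<Sum>x\<in>units (l\<^sup>2). \<omega> x * (pent_coeff n * nome (of_int ((24 * int n +
        1) * x) / of_nat (l\<^sup>2)) * nome \<tau> ^ n)) sums
        (\<Sum>x\<in>units (l\<^sup>2). \<omega> x * (eta (\<tau> + 24 * of_int x / of_nat (l\<^sup>2)) / nome (\<tau> / 24)))"
      by (intro sums_sum sums_mult eta_shift_sums \<tau>)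
    also have "(\<Sum>x\<in>units (l\<^sup>2). \<omega> x * (eta (\<tau> + 24 * of_int x / of_nat (l\<^sup>2)) / nome (\<tau> / 24))) =
        (\<Sum>x\<in>units (l\<^sup>2). \<omega> x * eta (\<tau> + 24 * of_int x / of_nat (l\<^sup>2))) / nome (\<tau> / 24)"
      by (simp add: sum_divide_distrib)
    also have "\<dots> = of_nat (l\<^sup>2 - l) * ?\<chi> * (eta ((of_nat l)\<^sup>2 * \<tau>) / nome (\<tau> / 24))"
      using eta_mult_twisted_sum_prime_square[OF l \<tau>(1) \<nu>]
      unfolding \<omega>_def by (simp only: times_divide_eq_right)
    also have "\<dots> = f q" using sums_unique[OF 1] by (simp add: f_def)
    finally show "(\<lambda>n. pent_coeff n * (\<Sum>x\<in>units (l\<^sup>2). \<omega> x * nome (of_int ((24 * int n +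
        1) * x) / of_nat (l\<^sup>2))) * q ^ n) sums f q"
      by (simp add: \<tau>(2) sum_distrib_left sum_distrib_right mult_ac)
  qed
  from fun_cong[OF this, of "s_nat l"]
  have "?\<chi> * (\<Sum>x\<in>units (l\<^sup>2). \<omega> x * nome (of_int ((24 * int (s_nat l) + 1) * x) / of_nat (l\<^sup>2))) =
      ?\<chi> * of_nat (l\<^sup>2 - l)"
    unfolding pent_coeff_s_nat[OF l] dilated_coeff_s[OF l0(1)] pent_coeff_0 by (simp add: mult_ac)
  moreover have "?\<chi> \<noteq> 0" using Legendre_3_nonzero[OF l] by simp
  moreover have "nome (of_int ((24 * int (s_nat l) + 1) * x) / of_nat (l\<^sup>2)) = 1" for x
  proof -
    have "24 * int (s_nat l) + 1 = int (l\<^sup>2)" using s_nat[OF l] by linarith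
    thus ?thesis using nome_frac_eq_1_iff[OF l0(1)] by simp
  qed
  ultimately have sum: "(\<Sum>x\<in>units (l\<^sup>2). \<omega> x) = of_nat (card (units (l\<^sup>2)))"
    by (simp add: card_units_prime_square[OF l(1)])
  have Re_le: "Re (\<omega> x) \<le> 1" if "x \<in> units (l\<^sup>2)" for x
    using norm[OF that] complex_Re_le_cmod[of "\<omega> x"] by simp
  have "(\<Sum>x\<in>units (l\<^sup>2). 1 - Re (\<omega> x)) = 0"
    using arg_cong[OF sum, of Re] by (simp add: sum_subtractf)
  hence Re: "Re (\<omega> x) = 1" if "x \<in> units (l\<^sup>2)" for x
    using that Re_le by (subst (asm) sum_nonneg_eq_0_iff) auto
  have one: "\<omega> x = 1" if "x \<in> units (l\<^sup>2)" for x
    using Re[OF that] norm[OF that] by (simp add: complex_eq_iff cmod_def)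
  from eta_mult_reduce[OF l0(2) dvd \<nu>] show ?thesis using one by (auto simp: \<omega>_def)
qed

text \<open>The coefficients of \<open>eta_mult_twisted_sum_prime\<close> at pentagonal n give the
  transform of the multipliers at the squares (6k-1)^2. Since 6 is invertible modulo l, these
  represent all squares, and \<open>quadratic_fourier_transform\<close> settles the nonresidues. The
  third conclusion evaluates the Gauss sum up to the unknown \<omega>, which is the form in which it
  enters the Hecke operator.\<close>

theorem eta_mult_prime:
  assumes l: "prime l" "l > 3"
  obtains \<omega> where "norm \<omega> = 1"
    "\<And>x y. int l dvd 576 * x * y + 1 \<Longrightarrow> eta_mult l y x = of_int (Legendre x (int l)) * \<omega>"
    "\<And>m. (\<Sum>x\<in>units l. of_int (Legendre x (int l)) * \<omega> * nome (of_int (m * x) / of_nat l)) =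
          of_real (sqrt l) * of_int (Legendre 3 (int l)) * of_int (Legendre m (int l))"
proof -
  have l0: "l > 0" "l > 1" "l > 2" using l by simp_all
  obtain \<nu> where \<nu>: "bij_betw \<nu> (units l) (units l)"
      "\<And>x. x \<in> units l \<Longrightarrow> int l dvd 576 * x * \<nu> x + 1"
    using neg_inverse_bij[OF coprime_576_prime[OF l] l0(2)] by blast
  define \<omega> where "\<omega> = (\<lambda>x. eta_mult l (\<nu> x) x)"
  let ?\<chi> = "of_int (Legendre 3 (int l)) :: complex"
  define H where "H = (\<lambda>m. \<Sum>x\<in>units l. \<omega> x * nome (of_int (m * x) / of_nat l))"
  have norm: "norm (\<omega> x) = 1" if "x \<in> units l" for x
    unfolding \<omega>_def by (rule norm_eta_mult[OF l0(1) \<nu>(2)[OF that]])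
  have \<chi>2: "?\<chi>\<^sup>2 = 1"
    using Legendre_square[of "int l" 3] Legendre_3_nonzero[OF l] Legendre_eq_0_iff[of 3 "int l"]
    by (metis of_int_1 of_int_power)
  have "(\<lambda>n. of_real (sqrt l) * (pent_coeff n * H (24 * int n + 1))) =
      (\<lambda>n. of_nat l * ?\<chi> * pent_coeff n - of_nat l * dilated_coeff (l\<^sup>2) (s_nat l) pent_coeff n)"
  proof (rule power_series_unique)
    fix q :: complex assume "0 < norm q" "norm q < 1"
    then obtain \<tau> where \<tau>: "Im \<tau> > 0" "nome \<tau> = q" by (rule ex_nome)
    define f where "f = (\<lambda>q. \<Sum>n. (of_nat l * ?\<chi> * pent_coeff n -
        of_nat l * dilated_coeff (l\<^sup>2) (s_nat l) pent_coeff n) * q ^ n)"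
    have "(\<lambda>n. pent_coeff n * nome \<tau> ^ n) sums (eta \<tau> / nome (\<tau> / 24))"
      using eta_shift_sums[OF \<tau>(1), of 0 0] by simp
    hence "(\<lambda>n. of_nat l * ?\<chi> * (pent_coeff n * nome \<tau> ^ n) -
          of_nat l * (dilated_coeff (l\<^sup>2) (s_nat l) pent_coeff n * nome \<tau> ^ n)) sums
        (of_nat l * ?\<chi> * (eta \<tau> / nome (\<tau> / 24)) -
            of_nat l * (eta ((of_nat l)\<^sup>2 * \<tau>) / nome (\<tau> / 24)))"
      by (intro sums_diff sums_mult eta_dilated_sums l \<tau>)
    hence 1: "(\<lambda>n. (of_nat l * ?\<chi> * pent_coeff n -
        of_nat l * dilated_coeff (l\<^sup>2) (s_nat l) pent_coeff n) * q ^ n) sums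
        (of_nat l * ?\<chi> * (eta \<tau> / nome (\<tau> / 24)) -
            of_nat l * (eta ((of_nat l)\<^sup>2 * \<tau>) / nome (\<tau> / 24)))"
      by (simp only: \<tau>(2) mult.assoc left_diff_distrib)
    thus "(\<lambda>n. (of_nat l * ?\<chi> * pent_coeff n -
        of_nat l * dilated_coeff (l\<^sup>2) (s_nat l) pent_coeff n) * q ^ n) sums f q"
      unfolding f_def using summable_sums sums_summable by blast
    have "(\<lambda>n. of_real (sqrt l) * (\<Sum>x\<in>units l. \<omega> x * (pent_coeff n * nome (of_int ((24 * int n +
        1) * x) / of_nat l) * nome \<tau> ^ n))) sums
        (of_real (sqrt l) * (\<Sum>x\<in>units l. \<omega> x * (eta (\<tau> +
            24 * of_int x / of_nat l) / nome (\<tau> / 24))))"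
      by (intro sums_mult sums_sum eta_shift_sums \<tau>)
    also have "of_real (sqrt l) * (\<Sum>x\<in>units l. \<omega> x * (eta (\<tau> +
        24 * of_int x / of_nat l) / nome (\<tau> / 24))) =
        (of_real (sqrt l) * (\<Sum>x\<in>units l. \<omega> x * eta (\<tau> + 24 * of_int x / of_nat l))) / nome (\<tau> / 24)"
      by (simp add: sum_divide_distrib sum_distrib_left)
    also have "\<dots> = of_nat l * ?\<chi> * (eta \<tau> / nome (\<tau> / 24)) -
        of_nat l * (eta ((of_nat l)\<^sup>2 * \<tau>) / nome (\<tau> / 24))"
      using eta_mult_twisted_sum_prime[OF l \<tau>(1) \<nu>]
      unfolding \<omega>_def by (simp only: times_divide_eq_right diff_divide_distrib)
    also have "\<dots> = f q" using sums_unique[OF 1] by (simp add: f_def)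
    finally show "(\<lambda>n. of_real (sqrt l) * (pent_coeff n * H (24 * int n + 1)) * q ^ n) sums f q"
      by (simp add: \<tau>(2) H_def sum_distrib_left sum_distrib_right mult_ac)
  qed
  note coeff = fun_cong[OF this]
  have sqrt0: "of_real (sqrt l) \<noteq> (0::complex)" using l0 by simp
  have sqrt_sq: "of_nat l = of_real (sqrt l) * (of_real (sqrt l) :: complex)"
    by (simp flip: of_real_mult)
  have H_cong: "H m = H n" if "[m = n] (mod int l)" for m n
  proof -
    have "[m * x = n * x] (mod int l)" for x using that by (intro cong_mult) simp_all
    thus ?thesis unfolding H_def using nome_frac_cong by (metis (no_types, lifting))
  qed
  have H0: "H 0 = 0"
  proof -
    \<comment> \<open>At n = \<open>s_nat l\<close> both series on the right contribute, and since
      (3/l)^2 = 1 they cancel; here 24n+1 = l^2 represents 0.\<close>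
    have "of_real (sqrt l) * (?\<chi> * H (24 * int (s_nat l) + 1)) = of_nat l * ?\<chi> * ?\<chi> - of_nat l"
      using coeff[of "s_nat l"] l0 unfolding pent_coeff_s_nat[OF l]
      by (subst (asm) dilated_coeff_s) (simp_all add: pent_coeff_0)
    also have "\<dots> = 0" using \<chi>2 by (simp add: power2_eq_square mult.assoc)
    finally have "H (24 * int (s_nat l) + 1) = 0" using sqrt0 Legendre_3_nonzero[OF l] by simp
    moreover have "24 * int (s_nat l) + 1 = int (l\<^sup>2)" using s_nat[OF l] by linarith
    hence "[24 * int (s_nat l) + 1 = 0] (mod int l)" by (simp add: cong_0_iff power2_eq_square)
    ultimately show ?thesis using H_cong by metis
  qed
  have res: "H (r\<^sup>2) = of_real (sqrt l) * ?\<chi>" if r: "\<not> int l dvd r" for r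
  proof -
    have "coprime (6 * 96) (int l)" using coprime_576_prime[OF l] by simp
    hence "coprime 6 (int l)" by (simp only: coprime_mult_left_iff)
    then obtain z where z: "[6 * z = 1] (mod int l)" using cong_solve_coprime_int by blast
    \<comment> \<open>Chosen with 6k - 1 congruent to r, so that the pentagonal index k gives 24
      \<open>pent k\<close> + 1 congruent to r^2.\<close>
    define k where "k = z * (r + 1)"
    have "[6 * k = 1 * (r + 1)] (mod int l)" unfolding k_def mult.assoc[symmetric]
      by (intro cong_mult z cong_refl)
    hence "[6 * k - 1 = 1 * (r + 1) - 1] (mod int l)" by (intro cong_diff cong_refl)
    hence k: "[6 * k - 1 = r] (mod int l)" by simp
    have sq: "24 * int (pent k) + 1 = (6 * k - 1)\<^sup>2" by (rule pent_square)
    have kl: "\<not> int l dvd 24 * int (pent k) + 1"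
    proof
      assume "int l dvd 24 * int (pent k) + 1"
      hence "int l dvd 6 * k - 1" unfolding sq using l(1) by (simp add: prime_dvd_power_iff)
      thus False using k r by (simp add: cong_dvd_iff)
    qed
    \<comment> \<open>On the support of the dilated series 24n+1 is divisible by l, which is
      excluded here.\<close>
    have "dilated_coeff (l\<^sup>2) (s_nat l) pent_coeff (pent k) = 0"
    proof -
      have False if n: "pent k \<ge> s_nat l" "l\<^sup>2 dvd pent k - s_nat l"
      proof -
        obtain j where "pent k - s_nat l = l\<^sup>2 * j" using n(2) by (auto elim: dvdE)
        hence "pent k = s_nat l + l\<^sup>2 * j" using n(1) by simp
        hence "24 * pent k + 1 = l\<^sup>2 + 24 * (l\<^sup>2 * j)" using s_nat[OF l] by simp
        hence "l dvd 24 * pent k + 1" by (simp add: power2_eq_square)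
        hence "int l dvd int (24 * pent k + 1)" by (simp only: int_dvd_int_iff)
        thus False using kl by (simp add: add.commute)
      qed
      thus ?thesis by (auto simp: dilated_coeff_def)
    qed
    hence "pent_coeff (pent k) * (of_real (sqrt l) * H (24 * int (pent k) + 1)) =
        pent_coeff (pent k) * (of_real (sqrt l) * (of_real (sqrt l) * ?\<chi>))"
      using coeff[of "pent k"] sqrt_sq by (simp add: mult_ac)
    hence "H (24 * int (pent k) + 1) = of_real (sqrt l) * ?\<chi>"
      using sqrt0 by (simp add: pent_coeff_pent)
    moreover have "[24 * int (pent k) + 1 = r\<^sup>2] (mod int l)" unfolding sq by (rule cong_pow[OF k])
    ultimately show ?thesis using H_cong by metis
  qed
  have norm_c: "norm (of_real (sqrt l) * ?\<chi>) = sqrt l"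
  proof -
    have "norm (?\<chi>\<^sup>2) = 1" by (simp add: \<chi>2)
    hence "norm ?\<chi> = 1" using norm_ge_zero[of ?\<chi>] by (auto simp: norm_power power2_eq_1_iff)
    thus ?thesis by (simp add: norm_mult)
  qed
  have Hm: "(\<Sum>x\<in>units l. \<omega> x * nome (of_int (m * x) / of_nat l)) =
      of_real (sqrt l) * ?\<chi> * of_int (Legendre m (int l))" for m
    by (rule quadratic_fourier_transform[OF l(1) l0(3) _ norm_c])
       (fact norm, fact res[unfolded H_def], fact H0[unfolded H_def])
  note \<omega>x = quadratic_character_from_transform[OF l(1) l0(3) Hm]
  have one: "1 \<in> units l" using l0 units_prime[OF l(1)] by simp
  show ?thesis
  proof (rule that[of "\<omega> 1"])
    show "norm (\<omega> 1) = 1" by (rule norm[OF one])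
    show "eta_mult l y x = of_int (Legendre x (int l)) * \<omega> 1" if "int l dvd 576 * x * y + 1" for x y
    proof -
      note red = eta_mult_reduce[OF l0(2) that \<nu>]
      have "Legendre (x mod int l) (int l) = Legendre x (int l)" by (rule Legendre_cong) simp
      thus ?thesis using red \<omega>x[OF red(1)] by (simp add: \<omega>_def)
    qed
    show "(\<Sum>x\<in>units l. of_int (Legendre x (int l)) * \<omega> 1 * nome (of_int (m * x) / of_nat l)) =
          of_real (sqrt l) * ?\<chi> * of_int (Legendre m (int l))" for m
      unfolding Hm[symmetric] by (intro sum.cong refl) (simp add: \<omega>x[symmetric])
  qed
qed

section \<open>Modular functions on Gamma0(2)\<close>

lemma Im_SL2:
  assumes "Im \<tau> > 0" and "a * d - b * c = (1::int)"
  shows "Im ((of_int a * \<tau> + of_int b) / (of_int c * \<tau> + of_int d)) =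
         Im \<tau> / (norm (of_int c * \<tau> + of_int d))\<^sup>2"
proof -
  have "real_of_int (a * d - b * c) = 1" unfolding assms(2) by simp
  hence "real_of_int a * real_of_int d = 1 + real_of_int b * real_of_int c" by simp
  hence "Im \<tau> * (real_of_int a * real_of_int d) = Im \<tau> * (1 + real_of_int b * real_of_int c)"
    by (simp only:)
  thus ?thesis
    by (simp add: Im_divide cmod_power2 algebra_simps)
qed

lemma Im_SL2_pos:
  assumes "Im \<tau> > 0" and "a * d - b * c = (1::int)"
  shows "Im ((of_int a * \<tau> + of_int b) / (of_int c * \<tau> + of_int d)) > 0"
  unfolding Im_SL2[OF assms] using assms(1) SL2_denominator_nonzero[OF assms] by simp

text \<open>The interface to the modular part. \<open>F\<close> is the expansion at i\<infinity>
  with its pole of order at most s cleared, and \<open>Y\<close> is the expansion at the cusp 0,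
  whose width 2 accounts for \<tau>/2. Holomorphy, invariance under \<open>Gamma0 2\<close> and the
  behaviour at all cusps follow from these two functions alone.\<close>

definition level2_expansion ::
  "nat \<Rightarrow> (complex \<Rightarrow> complex) \<Rightarrow> (complex \<Rightarrow> complex) \<Rightarrow> (complex \<Rightarrow> complex) \<Rightarrow> bool" where
  "level2_expansion s F Y f \<longleftrightarrow> F holomorphic_on ball 0 1 \<and> Y holomorphic_on ball 0 1 \<and>
     (\<forall>\<tau>. Im \<tau> > 0 \<longrightarrow> f \<tau> = F (nome \<tau>) / nome \<tau> ^ s \<and> f (- 1 / \<tau>) = Y (nome (\<tau> / 2)))"

lemma level2_expansionD:
  assumes "level2_expansion s F Y f"
  shows "F holomorphic_on ball 0 1" "Y holomorphic_on ball 0 1"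
    "\<And>\<tau>. Im \<tau> > 0 \<Longrightarrow> f \<tau> = F (nome \<tau>) / nome \<tau> ^ s"
    "\<And>\<tau>. Im \<tau> > 0 \<Longrightarrow> f (- 1 / \<tau>) = Y (nome (\<tau> / 2))"
  using assms by (auto simp: level2_expansion_def)

lemma level2_holomorphic:
  assumes "level2_expansion s F Y f"
  shows "f holomorphic_on upper_half_plane"
proof -
  note D = level2_expansionD[OF assms]
  have "(\<lambda>\<tau>. F (nome \<tau>) / nome \<tau> ^ s) holomorphic_on upper_half_plane"
    by (intro holomorphic_intros holomorphic_on_disc_nome[OF D(1)]) (auto simp:
        upper_half_plane_def)
  thus ?thesis by (rule holomorphic_transform) (simp add: D(3) upper_half_plane_def)
qed

lemma level2_plus_int:
  assumes "level2_expansion s F Y f" and "Im \<tau> > 0"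
  shows "f (\<tau> + of_int n) = f \<tau>"
  using level2_expansionD(3)[OF assms(1)] assms(2) by (simp add: nome_add)

text \<open>The expansion in nome (\<tau>/2) says that f (-1/\<tau>) has period 2; the claim is the
  conjugate of this translation by inversion.\<close>

lemma level2_lower:
  assumes "level2_expansion s F Y f" and \<tau>: "Im \<tau> > 0"
  shows "f (\<tau> / (of_int (2 * k) * \<tau> + 1)) = f \<tau>"
proof -
  note D = level2_expansionD[OF assms(1)]
  have \<tau>0: "\<tau> \<noteq> 0" using \<tau> by auto
  define \<sigma> where "\<sigma> = - 1 / \<tau>"
  have \<sigma>: "Im \<sigma> > 0" unfolding \<sigma>_def by (rule Im_minus_inverse_pos[OF \<tau>])
  have \<sigma>': "Im (\<sigma> + of_int (- 2 * k)) > 0" using \<sigma> by simp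
  have "- 1 / (\<sigma> + of_int (- 2 * k)) = \<tau> / (of_int (2 * k) * \<tau> + 1)"
  proof -
    have "\<sigma> + of_int (- 2 * k) = - (of_int (2 * k) * \<tau> +
        1) / \<tau>" using \<tau>0 by (simp add: \<sigma>_def field_simps)
    moreover have "- 1 / (- X / \<tau>) = \<tau> / X" for X using \<tau>0 by simp
    ultimately show ?thesis by (simp only:)
  qed
  moreover have "- 1 / \<sigma> = \<tau>" by (simp add: \<sigma>_def)
  moreover have "f (- 1 / (\<sigma> + of_int (- 2 * k))) = f (- 1 / \<sigma>)"
  proof -
    have "nome ((\<sigma> + of_int (- 2 * k)) / 2) =
        nome (\<sigma> / 2 + of_int (- k))" by (simp add: add_divide_distrib diff_divide_distrib)
    also have "\<dots> = nome (\<sigma> / 2)" by (simp only: nome_add nome_of_int mult_1_right)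
    finally show ?thesis by (simp only: D(4)[OF \<sigma>] D(4)[OF \<sigma>'])
  qed
  ultimately show ?thesis by simp
qed

text \<open>A Euclidean algorithm with steps of two kinds: a translation reduces d modulo c, then a
  lower triangular matrix reduces c modulo 2d'. As c is even, d' is odd and hence nonzero, and the
  reduced entries satisfy |c'| \<le> |d'| < |c|.\<close>

lemma level2_invariant:
  fixes a b c d :: int
  assumes f: "level2_expansion s F Y f" and "a * d - b * c = 1" and "even c" and "Im \<tau> > 0"
  shows "f ((of_int a * \<tau> + of_int b) / (of_int c * \<tau> + of_int d)) = f \<tau>"
  using assms(2-)
proof (induction "nat \<bar>c\<bar>" arbitrary: a b c d \<tau> rule: less_induct)
  case less
  note \<tau> = \<open>Im \<tau> > 0\<close>
  show ?case
  proof (cases "c = 0")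
    case True
    hence "a * d = 1" using less.prems by simp
    hence ad: "a = d" "d = 1 \<or> d = - 1" by (auto simp: zmult_eq_1_iff)
    have "(of_int a * \<tau> + of_int b) / (of_int c * \<tau> + of_int d) = \<tau> + of_int (b * d)"
      using ad True by auto
    thus ?thesis by (simp only: level2_plus_int[OF f \<tau>])
  next
    case False
    define k where "k = d div c"
    define d' where "d' = d mod c"
    define b' where "b' = b - a * k"
    have d: "d = c * k + d'" by (simp add: k_def d'_def)
    have b: "b = b' + a * k" by (simp add: b'_def)
    have det': "a * d' - b' * c = 1" using less.prems(1) unfolding b d by (simp add: algebra_simps)
    have "odd d'" using det' less.prems(2) by (metis dvd_diff dvd_mult odd_one)
    hence d'0: "d' \<noteq> 0" by auto
    \<comment> \<open>The integer nearest to c/(2|d'|); rounding to nearest is what yields |c'|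
      \<le> |d'|.\<close>
    define Q where "Q = (c + \<bar>d'\<bar>) div (2 * \<bar>d'\<bar>)"
    define j where "j = - (Q * sgn d')"
    define c' where "c' = c + 2 * j * d'"
    have "d' * sgn d' = \<bar>d'\<bar>" by (simp add: abs_sgn)
    hence "c' = c - 2 * \<bar>d'\<bar> * Q" by (simp add: c'_def j_def algebra_simps)
    hence "c' + \<bar>d'\<bar> = (c + \<bar>d'\<bar>) mod (2 * \<bar>d'\<bar>)"
      by (simp add: Q_def minus_mult_div_eq_mod[symmetric])
    hence "\<bar>c'\<bar> \<le> \<bar>d'\<bar>"
      using pos_mod_bound[of "2 * \<bar>d'\<bar>" "c + \<bar>d'\<bar>"] pos_mod_sign[of "2 * \<bar>d'\<bar>" "c +
          \<bar>d'\<bar>"] d'0 by linarith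
    also have "\<dots> < \<bar>c\<bar>" using False by (simp add: d'_def abs_mod_less)
    finally have less_c: "nat \<bar>c'\<bar> < nat \<bar>c\<bar>" by simp
    define a' where "a' = a + 2 * j * b'"
    have det'': "a' * d' - b' * c' = 1" using det' by (simp add: a'_def c'_def algebra_simps)
    have "even c'" using less.prems(2) by (simp add: c'_def)
    define \<sigma> where "\<sigma> = \<tau> + of_int k"
    have \<sigma>: "Im \<sigma> > 0" using \<tau> by (simp add: \<sigma>_def)
    define \<rho> where "\<rho> = \<sigma> / (of_int (2 * (- j)) * \<sigma> + 1)"
    have det1: "1 * 1 - 0 * (2 * (- j)) = (1::int)" by simp
    have den: "of_int (2 * (- j)) * \<sigma> + 1 \<noteq> 0" using SL2_denominator_nonzero[OF \<sigma> det1] by simp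
    have \<rho>: "Im \<rho> > 0" using Im_SL2_pos[OF \<sigma> det1] by (simp add: \<rho>_def)
    have "(of_int a' * \<rho> + of_int b') = (of_int a * \<tau> + of_int b) / (of_int (2 * (- j)) * \<sigma> + 1)"
      using den by (simp add: \<rho>_def a'_def b field_simps) (simp add: \<sigma>_def algebra_simps)
    moreover have "(of_int c' * \<rho> + of_int d') =
        (of_int c * \<tau> + of_int d) / (of_int (2 * (- j)) * \<sigma> + 1)"
      using den by (simp add: \<rho>_def c'_def d field_simps) (simp add: \<sigma>_def algebra_simps)
    ultimately have "(of_int a * \<tau> + of_int b) / (of_int c * \<tau> + of_int d) =
        (of_int a' * \<rho> + of_int b') / (of_int c' * \<rho> + of_int d')"
      using den by simp
    hence "f ((of_int a * \<tau> + of_int b) / (of_int c * \<tau> + of_int d)) = f \<rho>"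
      using less.hyps[OF less_c det'' \<open>even c'\<close> \<rho>] by simp
    also have "\<dots> = f \<sigma>" unfolding \<rho>_def by (rule level2_lower[OF f \<sigma>])
    also have "\<dots> = f \<tau>" unfolding \<sigma>_def by (rule level2_plus_int[OF f \<tau>])
    finally show ?thesis .
  qed
qed

text \<open>The matrix is an element of \<open>Gamma0 2\<close> times inversion times translation by
  d. Translating by d itself makes the lower left entry of the first factor d (c-1), which is even
  for odd c.\<close>

lemma level2_odd:
  fixes a b c d :: int
  assumes f: "level2_expansion s F Y f" and det: "a * d - b * c =
      1" and c: "odd c" and \<tau>: "Im \<tau> > 0"
  shows "f ((of_int a * \<tau> + of_int b) / (of_int c * \<tau> + of_int d)) = Y (nome ((\<tau> + of_int d) / 2))"
proof -
  define \<rho> where "\<rho> = \<tau> + of_int d"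
  have \<rho>: "Im \<rho> > 0" "\<rho> \<noteq> 0" using \<tau> by (auto simp: \<rho>_def complex_eq_iff)
  have "- (b - d * a) * c - a * (- (d - d * c)) = a * d - b * c" by (simp add: algebra_simps)
  hence det': "- (b - d * a) * c - a * (- (d - d * c)) = 1" using det by simp
  have even: "even (- (d - d * c))" using c by auto
  have "(of_int (- (b - d * a)) * (- 1 / \<rho>) + of_int a) = (of_int a * \<tau> + of_int b) / \<rho>"
    using \<rho>(2) by (simp add: field_simps) (simp add: \<rho>_def algebra_simps)
  moreover have "(of_int (- (d - d * c)) * (- 1 / \<rho>) + of_int c) = (of_int c * \<tau> + of_int d) / \<rho>"
    using \<rho>(2) by (simp add: field_simps) (simp add: \<rho>_def algebra_simps)
  ultimately have "(of_int a * \<tau> + of_int b) / (of_int c * \<tau> + of_int d) =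
      (of_int (- (b - d * a)) * (- 1 / \<rho>) + of_int a) / (of_int (- (d - d * c)) * (- 1 / \<rho>) +
          of_int c)"
    using \<rho>(2) by simp
  also have "f \<dots> = f (- 1 / \<rho>)"
    by (rule level2_invariant[OF f det' even Im_minus_inverse_pos[OF \<rho>(1)]])
  also have "\<dots> = Y (nome (\<rho> / 2))" by (rule level2_expansionD(4)[OF f \<rho>(1)])
  finally show ?thesis by (simp add: \<rho>_def)
qed

section \<open>Reduction theory and the maximum modulus principle\<close>

lemma ex_SL2_Im_ge:
  assumes \<tau>: "Im \<tau> > 0"
  obtains a b c d :: int where "a * d - b * c = 1"
    "Im ((of_int a * \<tau> + of_int b) / (of_int c * \<tau> + of_int d)) \<ge> 1 / 2"
proof -
  \<comment> \<open>The pair (0, 1) has norm 1, so imposing this bound loses no minimiser and leaves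
    finitely many pairs. Minimising the norm maximises the imaginary part of the image of
    \<tau>.\<close>
  define S where "S = {(c, d). coprime (c::int) d \<and> norm (of_int c * \<tau> + of_int d) \<le> 1}"
  define C where "C = \<lceil>1 / Im \<tau>\<rceil>"
  define D where "D = \<lceil>1 + of_int C * norm \<tau>\<rceil>"
  have "S \<subseteq> {- C..C} \<times> {- D..D}"
  proof safe
    fix c d assume "(c, d) \<in> S"
    hence le: "norm (of_int c * \<tau> + of_int d) \<le> 1" by (simp add: S_def)
    have "\<bar>of_int c * Im \<tau>\<bar> \<le> 1" using abs_Im_le_cmod[of "of_int c * \<tau> + of_int d"] le by simp
    hence "\<bar>of_int c\<bar> \<le> 1 / Im \<tau>" using \<tau> by (simp add: abs_mult field_simps)
    hence c: "\<bar>c\<bar> \<le> C" unfolding C_def by linarith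
    thus "c \<in> {- C..C}" by auto
    have "\<bar>of_int d\<bar> = norm ((of_int c * \<tau> + of_int d) - of_int c * \<tau>)" by simp
    also have "\<dots> \<le> norm (of_int c * \<tau> + of_int d) +
        norm (of_int c * \<tau>)" by (rule norm_triangle_ineq4)
    also have "\<dots> \<le> 1 + of_int C * norm \<tau>"
      using le c by (intro add_mono) (auto simp: norm_mult intro!: mult_right_mono)
    finally have "\<bar>d\<bar> \<le> D" unfolding D_def by linarith
    thus "d \<in> {- D..D}" by auto
  qed
  hence "finite S" by (rule finite_subset) simp
  moreover have "(0, 1) \<in> S" by (simp add: S_def)
  hence "S \<noteq> {}" by blast
  ultimately obtain p where "p \<in> S" and "\<And>p'. p' \<in> S \<Longrightarrow>
      (\<lambda>(c, d). norm (of_int c * \<tau> + of_int d)) p \<le> (\<lambda>(c, d). norm (of_int c * \<tau> + of_int d)) p'"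
    using ex_min_if_finite[of "(\<lambda>(c, d). norm (of_int c * \<tau> +
        of_int d)) ` S"] by (force simp: not_less)
  then obtain c d where cd: "(c, d) \<in> S" and min: "\<And>c' d'. (c', d') \<in> S \<Longrightarrow>
      norm (of_int c * \<tau> + of_int d) \<le> norm (of_int c' * \<tau> + of_int d')"
    by (cases p) fastforce
  have cop: "coprime c d" and le1: "norm (of_int c * \<tau> + of_int d) \<le>
      1" using cd by (auto simp: S_def)
  obtain u v where uv: "u * c + v * d = 1" using bezout_int[of c d] cop by auto
  define \<rho>0 where "\<rho>0 = (of_int v * \<tau> + of_int (- u)) / (of_int c * \<tau> + of_int d)"
  define n where "n = - round (Re \<rho>0)"
  define a where "a = v + n * c"
  define b where "b = - u + n * d"
  have det: "a * d - b * c = 1" using uv by (simp add: a_def b_def algebra_simps)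
  define \<rho> where "\<rho> = (of_int a * \<tau> + of_int b) / (of_int c * \<tau> + of_int d)"
  note den = SL2_denominator_nonzero[OF \<tau> det]
  have "\<rho> = \<rho>0 + of_int n"
    using den by (simp add: \<rho>_def \<rho>0_def a_def b_def field_simps)
  hence Re: "\<bar>Re \<rho>\<bar> \<le> 1 / 2"
    using of_int_round_abs_le[of "Re \<rho>0"] by (simp add: n_def abs_minus_commute)
  \<comment> \<open>Otherwise |\<rho>|^2 \<le> 1/4 + 1/4 < 1, and the upper row (a, b) would be a
    coprime pair of smaller norm than (c, d).\<close>
  have "Im \<rho> \<ge> 1 / 2"
  proof (rule ccontr)
    assume "\<not> Im \<rho> \<ge> 1 / 2"
    moreover have "Im \<rho> > 0" unfolding \<rho>_def by (rule Im_SL2_pos[OF \<tau> det])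
    ultimately have "\<bar>Im \<rho>\<bar> \<le> 1 / 2" by simp
    have "(norm \<rho>)\<^sup>2 = (Re \<rho>)\<^sup>2 + (Im \<rho>)\<^sup>2" by (rule cmod_power2)
    also have "\<dots> \<le> (1 / 2)\<^sup>2 + (1 / 2)\<^sup>2"
      using Re \<open>\<bar>Im \<rho>\<bar> \<le> 1 / 2\<close> by (intro add_mono) (simp_all add: abs_le_square_iff[symmetric])
    also have "\<dots> < 1\<^sup>2" by (simp add: power2_eq_square)
    finally have "norm \<rho> < 1" by (rule power2_less_imp_less) simp
    moreover have "of_int a * \<tau> + of_int b = \<rho> * (of_int c * \<tau> +
        of_int d)" using den by (simp add: \<rho>_def)
    ultimately have lt: "norm (of_int a * \<tau> + of_int b) < norm (of_int c * \<tau> + of_int d)"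
      using den by (simp add: norm_mult)
    have "coprime a b"
    proof (rule coprimeI)
      fix e assume "e dvd a" "e dvd b"
      hence "e dvd a * d - b * c" by auto
      thus "is_unit e" using det by simp
    qed
    hence "(a, b) \<in> S" using lt le1 by (simp add: S_def)
    from min[OF this] lt show False by simp
  qed
  thus ?thesis using that det unfolding \<rho>_def by blast
qed

text \<open>Every value of f is attained near one of the two cusps, at a point whose nome stays away
  from the unit circle. This confines f to two compact discs.\<close>

lemma level2_value_cases:
  assumes f: "level2_expansion s F Y f" and \<tau>: "Im \<tau> > 0"
  obtains \<rho> where "Im \<rho> \<ge> 1 / 2" "f \<tau> = f \<rho>" | \<rho> where "Im \<rho> \<ge> 1 / 2" "f \<tau> = Y (nome (\<rho> / 2))"
proof -
  obtain a b c d :: int where det: "a * d - b * c = 1"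
    and Im: "Im ((of_int a * \<tau> + of_int b) / (of_int c * \<tau> + of_int d)) \<ge> 1 / 2"
    using ex_SL2_Im_ge[OF \<tau>] .
  define \<rho> where "\<rho> = (of_int a * \<tau> + of_int b) / (of_int c * \<tau> + of_int d)"
  have \<rho>: "Im \<rho> \<ge> 1 / 2" "Im \<rho> > 0" using Im by (simp_all add: \<rho>_def)
  have det': "d * a - (- b) * (- c) = 1" using det by (simp add: mult.commute)
  note den = SL2_denominator_nonzero[OF \<tau> det]
  have one: "of_int a * of_int d = 1 + of_int b * (of_int c :: complex)"
  proof -
    have "a * d = 1 + b * c" using det by simp
    hence "of_int (a * d) = (of_int (1 + b * c) :: complex)" by (simp only:)
    thus ?thesis by simp
  qed
  have "of_int d * \<rho> + of_int (- b) = \<tau> / (of_int c * \<tau> + of_int d)"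
  proof -
    have "of_int d * \<rho> + of_int (- b) =
        ((of_int a * of_int d) * \<tau> - of_int b * of_int c * \<tau>) / (of_int c * \<tau> + of_int d)"
      using den by (simp add: \<rho>_def field_simps)
    thus ?thesis unfolding one by (simp add: algebra_simps)
  qed
  moreover have "of_int (- c) * \<rho> + of_int a = 1 / (of_int c * \<tau> + of_int d)"
  proof -
    have "of_int (- c) * \<rho> + of_int a =
        (of_int a * of_int d - of_int b * of_int c) / (of_int c * \<tau> + of_int d)"
      using den by (simp add: \<rho>_def field_simps)
    thus ?thesis unfolding one by simp
  qed
  ultimately have inv: "(of_int d * \<rho> + of_int (- b)) / (of_int (- c) * \<rho> + of_int a) = \<tau>"
    using den by simp
  show ?thesis
  proof (cases "even c")
    case True
    hence "f \<tau> = f \<rho>" using level2_invariant[OF f det' _ \<rho>(2)] unfolding inv by simp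
    thus ?thesis using that(1) \<rho>(1) by blast
  next
    case False
    hence "f \<tau> = Y (nome ((\<rho> + of_int a) / 2))" using level2_odd[OF f det' _ \<rho>(2)] unfolding inv by
        simp
    thus ?thesis using that(2)[of "\<rho> + of_int a"] \<rho>(1) by simp
  qed
qed

lemma holomorphic_disc_max:
  assumes "F holomorphic_on ball 0 1" and "r < 1" and "r \<ge> 0"
  obtains x where "x \<in> cball 0 r" "\<And>z. z \<in> cball 0 r \<Longrightarrow> norm (F z) \<le> norm (F x)"
proof -
  have "continuous_on (cball 0 r) F"
    by (rule continuous_on_subset[OF holomorphic_on_imp_continuous_on[OF assms(1)]]) (use assms in
        auto)
  hence "continuous_on (cball 0 r) (\<lambda>z. norm (F z))" by (intro continuous_intros)
  moreover have "cball (0::complex) r \<noteq> {}" using assms by simp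
  ultimately show ?thesis using continuous_attains_sup[of "cball 0 r" "\<lambda>z. norm (F z)"] that by auto
qed

lemma holomorphic_disc_constant:
  assumes "F holomorphic_on ball 0 1" and "x \<in> ball 0 1"
    and "\<And>z. z \<in> ball 0 1 \<Longrightarrow> norm (F z) \<le> norm (F x)"
  obtains c where "\<And>z. z \<in> ball 0 1 \<Longrightarrow> F z = c"
  using maximum_modulus_principle[of F "ball 0 1" "ball 0 1" x] assms that
  by (auto simp: constant_on_def)

text \<open>With no pole at either cusp, |f| is bounded by the larger of the maxima of |F| and |Y|
  on fixed closed subdiscs. The function with the larger maximum attains it at an interior point of
  the unit disc and bounds all values there, so the maximum modulus principle makes it
  constant.\<close>

lemma level2_constant:
  assumes f: "level2_expansion 0 F Y f"
  obtains c where "\<And>\<tau>. Im \<tau> > 0 \<Longrightarrow> f \<tau> = c"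
proof -
  note D = level2_expansionD[OF f]
  have nome_F: "nome \<rho> \<in> cball 0 (exp (- pi))" if "Im \<rho> \<ge> 1 / 2" for \<rho>
    using that by (simp add: norm_nome)
  have nome_Y: "nome (\<rho> / 2) \<in> cball 0 (exp (- pi / 2))" if "Im \<rho> \<ge> 1 / 2" for \<rho>
    using that by (simp add: norm_nome)
  obtain x where x: "x \<in> cball 0 (exp (- pi))" "\<And>z. z \<in> cball 0 (exp (- pi)) \<Longrightarrow> norm (F z) \<le>
      norm (F x)"
    using holomorphic_disc_max[OF D(1), of "exp (- pi)"] by auto
  obtain y where y: "y \<in> cball 0 (exp (- pi / 2))" "\<And>z. z \<in> cball 0 (exp (- pi / 2)) \<Longrightarrow> norm (Y z) \<le>
      norm (Y y)"
    using holomorphic_disc_max[OF D(2), of "exp (- pi / 2)"] by auto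
  define M where "M = max (norm (F x)) (norm (Y y))"
  have bound: "norm (f \<tau>) \<le> M" if "Im \<tau> > 0" for \<tau>
  proof (rule level2_value_cases[OF f that])
    fix \<rho> assume \<rho>: "Im \<rho> \<ge> 1 / 2" "f \<tau> = f \<rho>"
    hence "f \<tau> = F (nome \<rho>)" using D(3)[of \<rho>] by simp
    thus ?thesis using x(2)[OF nome_F[OF \<rho>(1)]] by (simp add: M_def)
  next
    fix \<rho> assume \<rho>: "Im \<rho> \<ge> 1 / 2" "f \<tau> = Y (nome (\<rho> / 2))"
    thus ?thesis using y(2)[OF nome_Y[OF \<rho>(1)]] by (simp add: M_def)
  qed
  show ?thesis
  proof (cases "norm (F x) \<ge> norm (Y y)")
    case True
    have "norm (F z) \<le> norm (F x)" if z: "z \<in> ball 0 1" for z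
    proof (cases "z = 0")
      case False
      then obtain \<tau> where "Im \<tau> > 0" "nome \<tau> = z" using ex_nome[of z] z by auto
      thus ?thesis using bound[of \<tau>] D(3)[of \<tau>] True by (simp add: M_def)
    qed (simp add: x(2))
    moreover have "x \<in> ball 0 1"
    proof -
      have "norm x \<le> exp (- pi)" using x(1) by simp
      also have "\<dots> < 1" by simp
      finally show ?thesis by simp
    qed
    ultimately obtain c where c: "\<And>z. z \<in> ball 0 1 \<Longrightarrow> F z = c"
      using holomorphic_disc_constant[OF D(1)] by blast
    show ?thesis
    proof (rule that[of c])
      fix \<tau> assume "Im \<tau> > 0"
      thus "f \<tau> = c" using D(3)[of \<tau>] c[of "nome \<tau>"] norm_nome_less_1[of \<tau>] by simp
    qed
  next
    case False
    have "norm (Y z) \<le> norm (Y y)" if z: "z \<in> ball 0 1" for z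
    proof (cases "z = 0")
      case nz: False
      then obtain \<sigma> where \<sigma>: "Im \<sigma> > 0" "nome \<sigma> = z" using ex_nome[of z] z by auto
      have "Im (2 * \<sigma>) > 0" using \<sigma> by simp
      from D(4)[OF this] bound[OF Im_minus_inverse_pos[OF this]] show ?thesis
        using False \<sigma> by (simp add: M_def)
    qed (simp add: y(2))
    moreover have "y \<in> ball 0 1"
    proof -
      have "norm y \<le> exp (- pi / 2)" using y(1) by simp
      also have "\<dots> < 1" by simp
      finally show ?thesis by simp
    qed
    ultimately obtain c where c: "\<And>z. z \<in> ball 0 1 \<Longrightarrow> Y z = c"
      using holomorphic_disc_constant[OF D(2)] by blast
    show ?thesis
    proof (rule that[of c])
      fix \<tau> assume \<tau>: "Im \<tau> > 0"
      define \<sigma> where "\<sigma> = - 1 / \<tau>"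
      have \<sigma>: "Im \<sigma> > 0" unfolding \<sigma>_def by (rule Im_minus_inverse_pos[OF \<tau>])
      have "f \<tau> = f (- 1 / \<sigma>)" by (simp add: \<sigma>_def)
      also have "\<dots> = c" using D(4)[OF \<sigma>] c[of "nome (\<sigma> / 2)"] norm_nome_less_1[of "\<sigma> / 2"] \<sigma> by simp
      finally show "f \<tau> = c" .
    qed
  qed
qed

section \<open>The Hauptmodul and polynomial representation\<close>

lemma norm_power2_less_1: "norm q < 1 \<Longrightarrow> norm (q\<^sup>2 :: complex) < 1"
  by (simp add: norm_power power_less_one_iff)

lemma euler_prod_square_holomorphic: "(\<lambda>q. euler_prod (q\<^sup>2)) holomorphic_on ball 0 1"
proof -
  have "(euler_prod \<circ> (\<lambda>q. q\<^sup>2)) holomorphic_on ball 0 1"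
    by (intro holomorphic_on_compose_gen[OF _ euler_prod_holomorphic])
       (auto intro!: holomorphic_intros norm_power2_less_1)
  thus ?thesis by (simp add: o_def)
qed

lemma nome_double: "nome (2 * \<tau>) = (nome \<tau>)\<^sup>2"
  using nome_of_nat_mult[of 2 \<tau>] by simp

text \<open>A simple pole at i\<infinity> and a zero at the cusp 0. The factor 2^12 comes from the
  scaling factor sqrt (1/2) in the inversion of eta (2\<tau>), raised to the 24th power in the
  denominator.\<close>

lemma level2_expansion_inverse_Phi2:
  "level2_expansion 1 (\<lambda>q. (euler_prod q / euler_prod (q\<^sup>2)) ^ 24)
     (\<lambda>x. 2 ^ 12 * x * (euler_prod (x\<^sup>2) / euler_prod x) ^ 24) (\<lambda>\<tau>. inverse (Phi2 \<tau>))"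
  unfolding level2_expansion_def
proof (intro conjI allI impI)
  have nz: "euler_prod q \<noteq> 0" "euler_prod (q\<^sup>2) \<noteq> 0" if "q \<in> ball 0 1" for q
    using that by (auto intro!: euler_prod_nonzero norm_power2_less_1)
  show "(\<lambda>q. (euler_prod q / euler_prod (q\<^sup>2)) ^ 24) holomorphic_on ball 0 1"
    using nz by (intro holomorphic_intros euler_prod_holomorphic euler_prod_square_holomorphic)
  show "(\<lambda>x. 2 ^ 12 * x * (euler_prod (x\<^sup>2) / euler_prod x) ^ 24) holomorphic_on ball 0 1"
    using nz by (intro holomorphic_intros euler_prod_holomorphic euler_prod_square_holomorphic)
  fix \<tau> :: complex assume \<tau>: "Im \<tau> > 0"
  have p24: "nome (x / 24) ^ 24 = nome x" for x
    using nome_of_nat_mult[of 24 "x / 24"] by simp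
  show "inverse (Phi2 \<tau>) = (euler_prod (nome \<tau>) / euler_prod ((nome \<tau>)\<^sup>2)) ^ 24 / nome \<tau> ^ 1"
  proof -
    have "eta \<tau> ^ 24 = nome \<tau> * euler_prod (nome \<tau>) ^ 24"
      by (simp only: eta_eq power_mult_distrib p24)
    moreover have "eta (2 * \<tau>) ^ 24 = (nome \<tau>)\<^sup>2 * euler_prod ((nome \<tau>)\<^sup>2) ^ 24"
      by (simp only: eta_eq power_mult_distrib p24 nome_double)
    ultimately show ?thesis
      unfolding Phi2_def power_divide by (simp add: power2_eq_square)
  qed
  have t2: "Im (\<tau> / 2) > 0" using \<tau> by simp
  have r0: "csqrt (- \<i> * \<tau>) \<noteq> 0" using \<tau> by auto
  have e1: "eta (- 1 / \<tau>) = csqrt (- \<i> * \<tau>) * eta \<tau>" by (rule eta_inversion[OF \<tau>])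
  have e2: "eta (2 * (- 1 / \<tau>)) = of_real (sqrt (1 / 2)) * csqrt (- \<i> * \<tau>) * eta (\<tau> / 2)"
    using eta_inversion_scaled[OF \<tau>, of "1 / 2"] by simp
  have s24: "(of_real (sqrt (1 / 2)) :: complex) ^ 24 = 1 / 2 ^ 12"
  proof -
    have "sqrt (1 / 2) ^ 24 = (sqrt (1 / 2) ^ 2) ^ 12" by (simp only: power_mult[symmetric]) simp
    also have "\<dots> = 1 / 2 ^ 12" by (simp add: power_divide)
    finally have "complex_of_real (sqrt (1 / 2) ^ 24) = of_real (1 / 2 ^ 12)" by (simp only:)
    thus ?thesis by (simp only: of_real_power of_real_divide) simp
  qed
  have "inverse (Phi2 (- 1 / \<tau>)) = 2 ^ 12 * (eta \<tau> / eta (\<tau> / 2)) ^ 24"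
    unfolding Phi2_def e1 e2 using r0 eta_nonzero[OF \<tau>] eta_nonzero[OF t2]
    by (simp only: power_divide power_mult_distrib s24) (simp add: field_simps)
  also have "(eta \<tau> / eta (\<tau> / 2)) ^ 24 = nome (\<tau> / 2) *
      (euler_prod ((nome (\<tau> / 2))\<^sup>2) / euler_prod (nome (\<tau> / 2))) ^ 24"
  proof -
    have "nome \<tau> = (nome (\<tau> / 2))\<^sup>2" using nome_double[of "\<tau> / 2"] by simp
    hence "eta \<tau> ^ 24 = (nome (\<tau> / 2))\<^sup>2 * euler_prod ((nome (\<tau> / 2))\<^sup>2) ^ 24"
      by (simp only: eta_eq power_mult_distrib p24)
    moreover have "eta (\<tau> / 2) ^ 24 = nome (\<tau> / 2) * euler_prod (nome (\<tau> / 2)) ^ 24"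
      by (simp only: eta_eq power_mult_distrib p24)
    ultimately show ?thesis unfolding power_divide by (simp add: power2_eq_square)
  qed
  finally show "inverse (Phi2 (- 1 / \<tau>)) = 2 ^ 12 * nome (\<tau> / 2) *
      (euler_prod ((nome (\<tau> / 2))\<^sup>2) / euler_prod (nome (\<tau> / 2))) ^ 24" by (simp add: mult.assoc)
qed

lemma euler_prod_0: "euler_prod 0 = 1"
  by (simp add: euler_prod_def)

text \<open>Induction on the bound for the pole order. Subtracting F 0 times the corresponding power
  of the Hauptmodul cancels the leading term, since K 0 = 1, and the expansion at the cusp 0 stays
  holomorphic because the Hauptmodul is holomorphic there.\<close>

lemma level2_polynomial:
  assumes "level2_expansion s F Y f"
  shows "\<exists>P :: complex poly. \<forall>\<tau>. Im \<tau> > 0 \<longrightarrow> f \<tau> = poly P (inverse (Phi2 \<tau>))"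
  using assms
proof (induction s arbitrary: F Y f)
  case 0
  then obtain c where "\<And>\<tau>. Im \<tau> > 0 \<Longrightarrow> f \<tau> = c" using level2_constant by blast
  thus ?case by (intro exI[of _ "[:c:]"]) simp
next
  case (Suc s)
  note D = level2_expansionD[OF Suc.prems]
  define K where "K = (\<lambda>q::complex. (euler_prod q / euler_prod (q\<^sup>2)) ^ 24)"
  define L where "L = (\<lambda>x::complex. 2 ^ 12 * x * (euler_prod (x\<^sup>2) / euler_prod x) ^ 24)"
  note D' = level2_expansionD[OF level2_expansion_inverse_Phi2]
  have K0: "K 0 = 1" by (simp add: K_def euler_prod_0)
  define t where "t = (\<lambda>\<tau>. inverse (Phi2 \<tau>))"
  define G where "G = (\<lambda>q. F q - F 0 * K q ^ Suc s)"
  have hol_G: "G holomorphic_on ball 0 1" unfolding G_def K_def by (intro holomorphic_intros D D')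
  have G0: "G 0 = 0" by (simp add: G_def K0)
  \<comment> \<open>G(q)/q, with the removable singularity at 0 filled by the derivative; this
    lowers the exponent of the pole by one.\<close>
  define F' where "F' = (\<lambda>q. if q = 0 then deriv G 0 else (G q - G 0) / (q - 0))"
  have hol_F': "F' holomorphic_on ball 0 1" unfolding F'_def
    by (rule pole_lemma_open[OF hol_G]) auto
  have "level2_expansion s F' (\<lambda>x. Y x - F 0 * L x ^ Suc s) (\<lambda>\<tau>. f \<tau> - F 0 * t \<tau> ^ Suc s)"
    unfolding level2_expansion_def
  proof (intro conjI allI impI)
    show "F' holomorphic_on ball 0 1" by (rule hol_F')
    show "(\<lambda>x. Y x - F 0 * L x ^ Suc s) holomorphic_on ball 0 1" unfolding L_def by (intro
        holomorphic_intros D D')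
    fix \<tau> :: complex assume \<tau>: "Im \<tau> > 0"
    show "f (- 1 / \<tau>) - F 0 * t (- 1 / \<tau>) ^ Suc s =
        Y (nome (\<tau> / 2)) - F 0 * L (nome (\<tau> / 2)) ^ Suc s"
      by (simp only: t_def L_def D(4)[OF \<tau>] D'(4)[OF \<tau>])
    have "f \<tau> - F 0 * t \<tau> ^ Suc s = G (nome \<tau>) / nome \<tau> ^ Suc s"
    proof -
      have "t \<tau> = K (nome \<tau>) / nome \<tau>" using D'(3)[OF \<tau>] by (simp only: t_def K_def power_one_right)
      thus ?thesis unfolding G_def D(3)[OF \<tau>]
        by (simp only: power_divide diff_divide_distrib times_divide_eq_right)
    qed
    also have "\<dots> = F' (nome \<tau>) / nome \<tau> ^ s" by (simp add: F'_def G0)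
    finally show "f \<tau> - F 0 * t \<tau> ^ Suc s = F' (nome \<tau>) / nome \<tau> ^ s" .
  qed
  from Suc.IH[OF this] obtain P where P: "\<And>\<tau>. Im \<tau> > 0 \<Longrightarrow> f \<tau> - F 0 * t \<tau> ^ Suc s = poly P (t \<tau>)"
    unfolding t_def by blast
  have "f \<tau> = poly (P + Polynomial.monom (F 0) (Suc s)) (t \<tau>)" if "Im \<tau> > 0" for \<tau>
    using P[OF that] by (simp add: poly_monom algebra_simps)
  thus ?case unfolding t_def by blast
qed

section \<open>Cusps of \<open>Gamma0 2\<close> and the charts there\<close>

lemma SL2Z_iff:
  fixes A :: "int ^ 2 ^ 2"
  shows "A \<in> SL2Z \<longleftrightarrow> A $ 1 $ 1 * A $ 2 $ 2 - A $ 1 $ 2 * A $ 2 $ 1 = 1"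
  by (simp add: SL2Z_def det_2)

text \<open>If the entry is even, the inverse of \<open>A\<close> lies in \<open>Gamma0 2\<close>
  and is the witness. Conversely, members of \<open>Gamma0 2\<close> have even lower left and odd
  lower right entry, so they preserve the parity of the denominator of a cusp.\<close>

lemma cusps_equivalent_infinity_iff:
  fixes A :: "int ^ 2 ^ 2"
  assumes "A \<in> SL2Z"
  shows "cusps_equivalent 2 A (mat 1) \<longleftrightarrow> even (A $ 2 $ 1)"
proof
  assume "cusps_equivalent 2 A (mat 1)"
  then obtain C where C: "C \<in> Gamma0 2"
    "column 1 (C ** A) = column 1 (mat 1) \<or> column 1 (C ** A) = - column 1 (mat 1)"
    by (auto simp: cusps_equivalent_def)
  have "column 1 (C ** A) $ 2 = column 1 (mat 1 :: int ^ 2 ^ 2) $ 2 \<or> column 1 (C ** A) $ 2 =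
      (- column 1 (mat 1 :: int ^ 2 ^ 2)) $ 2"
    using C(2) by metis
  hence "column 1 (C ** A) $ 2 = 0" by (simp add: column_def mat_def)
  hence eq: "C $ 2 $ 1 * A $ 1 $ 1 + C $ 2 $ 2 * A $ 2 $ 1 = 0"
    by (simp add: column_def matrix_matrix_mult_def sum_2)
  have even: "even (C $ 2 $ 1)" and det: "C $ 1 $ 1 * C $ 2 $ 2 - C $ 1 $ 2 * C $ 2 $ 1 = 1"
    using C(1) by (auto simp: Gamma0_def SL2Z_iff)
  have "odd (C $ 2 $ 2)" using det even by (metis dvd_diff dvd_mult odd_one)
  moreover have "even (C $ 2 $ 2 * A $ 2 $ 1)" using eq even
    by (metis dvd_0_right dvd_add_right_iff dvd_mult2)
  ultimately show "even (A $ 2 $ 1)" by simp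
next
  assume even: "even (A $ 2 $ 1)"
  define C :: "int ^ 2 ^ 2" where
    "C = vector [vector [A $ 2 $ 2, - A $ 1 $ 2], vector [- A $ 2 $ 1, A $ 1 $ 1]]"
  have "C \<in> Gamma0 2"
    using assms even by (simp add: Gamma0_def SL2Z_iff C_def mult.commute)
  moreover have "column 1 (C ** A) = column 1 (mat 1)"
    using assms
    by (simp add: vec_eq_iff forall_2 column_def matrix_matrix_mult_def sum_2 C_def mat_def
        SL2Z_iff algebra_simps)
  ultimately show "cusps_equivalent 2 A (mat 1)" unfolding cusps_equivalent_def by blast
qed

lemma cusp_chart_point:
  assumes "q \<noteq> 0" and "norm q < 1"
  defines "\<tau> \<equiv> of_nat 2 * Ln q / (2 * of_real pi * \<i>)"
  shows "nome (\<tau> / 2) = q" "nome \<tau> = q\<^sup>2" "Im \<tau> > 0"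
proof -
  show 1: "nome (\<tau> / 2) = q" using assms(1) by (simp add: nome_def \<tau>_def)
  show "nome \<tau> = q\<^sup>2" using nome_double[of "\<tau> / 2"] by (simp add: 1)
  have "exp (- 2 * pi * Im (\<tau> / 2)) < 1" using 1 assms(2) norm_nome[of "\<tau> / 2"] by simp
  thus "Im \<tau> > 0" by (simp add: zero_less_mult_iff)
qed

lemma eventually_punctured_disc: "eventually (\<lambda>q::complex. q \<noteq> 0 \<and> norm q < 1) (at 0)"
  by (auto simp: eventually_at dist_norm intro!: exI[of _ 1])

text \<open>The chart variable at level 2 is a square root of the nome, so at cusps equivalent to
  i\<infinity> pole orders are doubled.\<close>

lemma level2_cusp_chart_even:
  fixes A :: "int ^ 2 ^ 2"
  assumes f: "level2_expansion s F Y f" and A: "A \<in> SL2Z" "even (A $ 2 $ 1)"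
  shows "eventually (\<lambda>q. cusp_chart 2 f A q = F (q\<^sup>2) / (q\<^sup>2) ^ s) (at 0)"
  using eventually_punctured_disc
proof eventually_elim
  case (elim q)
  note p = cusp_chart_point[of q]
  show ?case
    using level2_invariant[OF f A(1)[unfolded SL2Z_iff] A(2) p(3)] level2_expansionD(3)[OF f p(3)]
        p(2) elim
    by (simp add: cusp_chart_def moebius_def)
qed

text \<open>Here the chart variable is that of \<open>Y\<close>, up to the sign caused by the
  translation in \<open>level2_odd\<close>.\<close>

lemma level2_cusp_chart_odd:
  fixes A :: "int ^ 2 ^ 2"
  assumes f: "level2_expansion s F Y f" and A: "A \<in> SL2Z" "odd (A $ 2 $ 1)"
  shows "eventually (\<lambda>q. cusp_chart 2 f A q = Y (q * nome (of_int (A $ 2 $ 2) / 2))) (at 0)"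
  using eventually_punctured_disc
proof eventually_elim
  case (elim q)
  note p = cusp_chart_point[of q]
  show ?case
    using level2_odd[OF f A(1)[unfolded SL2Z_iff] A(2) p(3)] p(1) elim
    by (simp add: cusp_chart_def moebius_def add_divide_distrib nome_add)
qed

lemma analytic_at_0_disc:
  assumes "G holomorphic_on ball 0 1"
  shows "G analytic_on {0}"
  using assms by (metis analytic_at centre_in_ball open_ball zero_less_one)

lemma chart_even_holomorphic:
  assumes "F holomorphic_on ball 0 1"
  shows "(\<lambda>q. F (q\<^sup>2)) holomorphic_on ball 0 1"
proof -
  have "(F \<circ> (\<lambda>q. q\<^sup>2)) holomorphic_on ball 0 1"
    by (intro holomorphic_on_compose_gen[OF _ assms])
       (auto intro!: holomorphic_intros norm_power2_less_1)
  thus ?thesis by (simp add: o_def)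
qed

lemma chart_odd_holomorphic:
  assumes "Y holomorphic_on ball 0 1" and "norm c = 1"
  shows "(\<lambda>q. Y (q * c)) holomorphic_on ball 0 1"
proof -
  have "(Y \<circ> (\<lambda>q. q * c)) holomorphic_on ball 0 1"
    by (intro holomorphic_on_compose_gen[OF _ assms(1)])
       (auto intro!: holomorphic_intros simp: norm_mult assms(2))
  thus ?thesis by (simp add: o_def)
qed

lemma level2_meromorphic_at_cusp:
  fixes A :: "int ^ 2 ^ 2"
  assumes f: "level2_expansion s F Y f" and A: "A \<in> SL2Z"
  shows "meromorphic_at_cusp 2 f A"
proof (cases "even (A $ 2 $ 1)")
  case True
  have "(\<lambda>q. F (q\<^sup>2) / (q\<^sup>2) ^ s) meromorphic_on {0}"
    by (intro meromorphic_intros analytic_on_imp_meromorphic_on analytic_at_0_disc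
              chart_even_holomorphic level2_expansionD(1)[OF f])
  moreover have "cusp_chart 2 f A meromorphic_on {0} \<longleftrightarrow> (\<lambda>q. F (q\<^sup>2) / (q\<^sup>2) ^ s) meromorphic_on {0}"
    by (rule meromorphic_on_cong) (simp_all only: singleton_iff level2_cusp_chart_even[OF f A True])
  ultimately show ?thesis by (simp only: meromorphic_at_cusp_def)
next
  case False
  have "(\<lambda>q. Y (q * nome (of_int (A $ 2 $ 2) / 2))) meromorphic_on {0}"
    by (intro analytic_on_imp_meromorphic_on analytic_at_0_disc
              chart_odd_holomorphic level2_expansionD(2)[OF f] norm_nome_of_int_divide)
  moreover have "cusp_chart 2 f A meromorphic_on {0} \<longleftrightarrow>
      (\<lambda>q. Y (q * nome (of_int (A $ 2 $ 2) / 2))) meromorphic_on {0}"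
    by (rule meromorphic_on_cong) (simp_all only: singleton_iff level2_cusp_chart_odd[OF f A False])
  ultimately show ?thesis by (simp only: meromorphic_at_cusp_def)
qed

lemma level2_pole_at_cusp_iff:
  fixes A :: "int ^ 2 ^ 2"
  assumes f: "level2_expansion s F Y f" and A: "A \<in> SL2Z" and s: "s > 0" and F0: "F 0 \<noteq> 0"
  shows "pole_at_cusp 2 f A \<longleftrightarrow> even (A $ 2 $ 1)"
proof (cases "even (A $ 2 $ 1)")
  case True
  have an: "(\<lambda>q. F (q\<^sup>2)) analytic_on {0}"
    by (intro analytic_at_0_disc chart_even_holomorphic level2_expansionD(1)[OF f])
  have "((\<lambda>q. F (q\<^sup>2)) \<longlongrightarrow> F (0\<^sup>2)) (at 0)"
    using analytic_at_imp_isCont[OF an] by (simp add: isCont_def)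
  hence 1: "((\<lambda>q. F (q\<^sup>2)) \<longlongrightarrow> F 0) (at 0)" by simp
  have "filterlim (\<lambda>q::complex. (q\<^sup>2) ^ s) (at 0) (at 0)"
    using s by (auto simp: filterlim_at eventually_at_filter intro!: tendsto_eq_intros)
  from filterlim_divide_at_infinity[OF 1 this F0]
  have "is_pole (\<lambda>q. F (q\<^sup>2) / (q\<^sup>2) ^ s) 0" by (simp add: is_pole_def)
  thus ?thesis unfolding pole_at_cusp_def
    using is_pole_cong[OF level2_cusp_chart_even[OF f A True] refl] True by simp
next
  case False
  have an: "(\<lambda>q. Y (q * nome (of_int (A $ 2 $ 2) / 2))) analytic_on {0}"
    by (intro analytic_at_0_disc chart_odd_holomorphic level2_expansionD(2)[OF f]
        norm_nome_of_int_divide)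
  have "\<not> is_pole (\<lambda>q. Y (q * nome (of_int (A $ 2 $ 2) / 2))) 0"
    using analytic_at_imp_no_pole[OF an] .
  thus ?thesis unfolding pole_at_cusp_def
    using is_pole_cong[OF level2_cusp_chart_odd[OF f A False] refl] False by simp
qed

lemma level2_weakly_holomorphic:
  assumes f: "level2_expansion s F Y f"
  shows "weakly_holomorphic_modular_function 2 f"
  unfolding weakly_holomorphic_modular_function_def
proof (intro conjI ballI)
  show "f holomorphic_on upper_half_plane" by (rule level2_holomorphic[OF f])
  show "f (moebius A \<tau>) = f \<tau>" if "A \<in> Gamma0 2" "\<tau> \<in> upper_half_plane" for A \<tau>
    unfolding moebius_def using that
    by (intro level2_invariant[OF f]) (auto simp: Gamma0_def SL2Z_iff upper_half_plane_def)
  show "meromorphic_at_cusp 2 f A" if "A \<in> SL2Z" for A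
    by (rule level2_meromorphic_at_cusp[OF f that])
qed

section \<open>The Hecke operator under inversion\<close>

definition g_fun :: "complex \<Rightarrow> complex" where
  "g_fun \<tau> = eta \<tau> ^ 3 / eta (2 * \<tau>) ^ 2"

definition h_fun :: "complex \<Rightarrow> complex" where
  "h_fun \<tau> = eta \<tau> ^ 3 / eta (\<tau> / 2) ^ 2"

text \<open>Plays for \<open>h_fun\<close> the role of \<open>B_fun\<close> for
  \<open>g_fun\<close>, in the local variable nome (\<tau>/2) of the cusp 0.\<close>

definition C_fun :: "complex \<Rightarrow> complex" where
  "C_fun x = euler_prod (x\<^sup>2) ^ 3 / euler_prod x ^ 2"

lemma g_fun_eq: "g_fun \<tau> = nome (- \<tau> / 24) * B_fun (nome \<tau>)"
proof -
  have "nome (\<tau> / 24) ^ 3 / nome (2 * \<tau> / 24) ^ 2 = nome (- \<tau> / 24)"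
    unfolding nome_of_nat_mult[symmetric] nome_diff[symmetric] by (simp add: field_simps)
  thus ?thesis
    unfolding g_fun_def eta_eq B_fun_def nome_double power_mult_distrib
    by (metis (no_types, lifting) times_divide_times_eq)
qed

lemma h_fun_eq: "h_fun \<tau> = nome (\<tau> / 12) * C_fun (nome (\<tau> / 2))"
proof -
  have "nome (\<tau> / 24) ^ 3 / nome (\<tau> / 2 / 24) ^ 2 = nome (\<tau> / 12)"
    unfolding nome_of_nat_mult[symmetric] nome_diff[symmetric] by (simp add: field_simps)
  moreover have "nome \<tau> = (nome (\<tau> / 2))\<^sup>2" using nome_double[of "\<tau> / 2"] by simp
  ultimately show ?thesis
    unfolding h_fun_def eta_eq C_fun_def power_mult_distrib
    by (metis (no_types, lifting) times_divide_times_eq)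
qed

lemma C_fun_holomorphic: "C_fun holomorphic_on ball 0 1"
  unfolding C_fun_def
  by (intro holomorphic_intros euler_prod_holomorphic euler_prod_square_holomorphic)
     (auto dest: euler_prod_nonzero)

lemma C_fun_nonzero: "norm x < 1 \<Longrightarrow> C_fun x \<noteq> 0"
  using euler_prod_nonzero[of x] euler_prod_nonzero[OF norm_power2_less_1[of x]] by (simp add:
      C_fun_def)

lemma B_fun_nonzero: "norm x < 1 \<Longrightarrow> B_fun x \<noteq> 0"
  using euler_prod_nonzero[of x] euler_prod_nonzero[OF norm_power2_less_1[of x]] by (simp add:
      B_fun_def)

text \<open>Three square roots from the numerator over two from the denominator leave one, in
  accordance with weight 1/2. The 2 in front comes from the squared sqrt (c/2) in the
  denominator.\<close>

lemma g_fun_inversion: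
  assumes \<tau>: "Im \<tau> > 0" and c: "c > 0"
  shows "g_fun (- 1 / (of_real c * \<tau>)) = 2 * of_real (sqrt c) * csqrt (- \<i> * \<tau>) *
      h_fun (of_real c * \<tau>)"
proof -
  let ?r = "csqrt (- \<i> * \<tau>)"
  have r0: "?r \<noteq> 0" using \<tau> by auto
  have "eta (- 1 / (of_real (c / 2) * \<tau>)) = of_real (sqrt (c / 2)) * ?r * eta (of_real (c / 2) * \<tau>)"
    using c by (intro eta_inversion_scaled[OF \<tau>]) simp
  hence e2: "eta (2 * (- 1 / (of_real c * \<tau>))) =
      of_real (sqrt (c / 2)) * ?r * eta (of_real c * \<tau> / 2)"
    by simp
  have sc: "(of_real (sqrt (c / 2)) :: complex)\<^sup>2 = (of_real (sqrt c))\<^sup>2 / 2"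
    using c by (simp flip: of_real_power)
  have s0: "(of_real (sqrt c) :: complex) \<noteq> 0" using c by simp
  show ?thesis
    unfolding g_fun_def h_fun_def eta_inversion_scaled[OF \<tau> c] e2 power_mult_distrib sc
    using r0 s0 by (simp add: power2_eq_square power3_eq_cube divide_simps)
qed

text \<open>Doubling the argument in the denominator is absorbed into y, so the numerator uses the
  pair (2x, y) and the denominator the pair (x, 2y). Both are admissible under the same condition,
  and the shift on the right becomes 48 = 2 * 24.\<close>

lemma g_fun_cusp:
  assumes N: "N > 0" and dvd: "int N dvd 1152 * x * y + 1" and \<tau>: "Im \<tau> > 0"
  shows "g_fun (24 * of_int y / of_nat N - 1 / ((of_nat N)\<^sup>2 * \<tau>)) =
    eta_mult N y (2 * x) ^ 3 / eta_mult N (2 * y) x ^ 2 *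
    (2 * of_real (sqrt N) * csqrt (- \<i> * \<tau>) * h_fun (\<tau> + 48 * of_int x / of_nat N))"
proof -
  let ?r = "csqrt (- \<i> * \<tau>)" and ?\<sigma> = "24 * of_int y / of_nat N - 1 / ((of_nat N)\<^sup>2 * \<tau>)"
  have r0: "?r \<noteq> 0" using \<tau> by auto
  have t2: "Im (\<tau> / 2) > 0" using \<tau> by simp
  have d1: "int N dvd 576 * (2 * x) * y + 1" and d2: "int N dvd 576 * x * (2 * y) + 1"
    using dvd by (simp_all add: mult_ac)
  have e1: "eta ?\<sigma> = eta_mult N y (2 * x) * of_real (sqrt N) * ?r * eta (\<tau> +
      48 * of_int x / of_nat N)"
    using eta_mult_eq[OF N d1 \<tau>] by simp
  have "2 * ?\<sigma> = 24 * of_int (2 * y) / of_nat N - 1 / ((of_nat N)\<^sup>2 * (\<tau> / 2))"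
    by (simp add: algebra_simps)
  hence e2: "eta (2 * ?\<sigma>) = eta_mult N (2 * y) x * of_real (sqrt N) * csqrt (- \<i> * (\<tau> / 2)) *
      eta ((\<tau> + 48 * of_int x / of_nat N) / 2)"
    using eta_mult_eq[OF N d2 t2] by (simp add: add_divide_distrib)
  have r2: "(csqrt (- \<i> * (\<tau> / 2)))\<^sup>2 = ?r\<^sup>2 / 2" by (simp only: power2_csqrt) simp
  have s0: "(of_real (sqrt N) :: complex) \<noteq> 0" using N by simp
  have m0: "eta_mult N (2 * y) x \<noteq> 0" using norm_eta_mult[OF N d2] by auto
  show ?thesis
    unfolding g_fun_def h_fun_def e1 e2 power_mult_distrib r2
    using r0 s0 m0 by (simp add: power2_eq_square power3_eq_cube divide_simps)
qed

lemma g_fun_cusp_prime_square: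
  assumes l: "prime l" "l > 3" and dvd: "int (l\<^sup>2) dvd 1152 * x * y + 1" and \<tau>: "Im \<tau> > 0"
  shows "g_fun (24 * of_int y / of_nat (l\<^sup>2) - 1 / ((of_nat (l\<^sup>2))\<^sup>2 * \<tau>)) =
    2 * of_nat l * csqrt (- \<i> * \<tau>) * h_fun (\<tau> + 48 * of_int x / of_nat (l\<^sup>2))"
proof -
  have "int (l\<^sup>2) dvd 576 * (2 * x) * y + 1" "int (l\<^sup>2) dvd 576 * x * (2 * y) + 1"
    using dvd by (simp_all add: mult_ac)
  hence "eta_mult (l\<^sup>2) y (2 * x) = 1" "eta_mult (l\<^sup>2) (2 * y) x = 1"
    using eta_mult_prime_square[OF l] by blast+
  moreover have "l\<^sup>2 > 0" using l by simp
  ultimately show ?thesis using g_fun_cusp[OF _ dvd \<tau>] by simp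
qed

text \<open>
  \<open>hecke_g\<close> is the Hecke operator of index \<open>l\<^sup>2\<close> applied to \<open>g_fun\<close>, written as a sum over cosets;
  \<open>hecke_h\<close> is its image under \<open>\<tau> \<mapsto> - 1 / \<tau>\<close>.
\<close>

definition hecke_g :: "nat \<Rightarrow> complex \<Rightarrow> complex \<Rightarrow> complex" where
  "hecke_g l \<omega> \<tau> = (\<Sum>b\<in>{0..<int (l\<^sup>2)}. g_fun ((\<tau> + 24 * of_int b) / of_nat (l\<^sup>2))) / of_nat l +
     (\<Sum>y\<in>units l. of_int (Legendre (- y) (int l)) * cnj \<omega> * g_fun (\<tau> +
         24 * of_int y / of_nat l)) / of_real (sqrt l) +
     g_fun (of_nat (l\<^sup>2) * \<tau>)"

definition hecke_h :: "nat \<Rightarrow> complex \<Rightarrow> complex \<Rightarrow> complex" where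
  "hecke_h l \<omega> \<tau> = (\<Sum>b\<in>{0..<int (l\<^sup>2)}. h_fun ((\<tau> + 48 * of_int b) / of_nat (l\<^sup>2))) / of_nat l +
     (\<Sum>x\<in>units l. of_int (Legendre (2 * x) (int l)) * \<omega> * h_fun (\<tau> +
         48 * of_int x / of_nat l)) / of_real (sqrt l) +
     h_fun (of_nat (l\<^sup>2) * \<tau>)"

text \<open>Inversion maps the shifts b coprime to l among themselves, exchanges the nonzero shifts
  b = l c with the shifts y/l, and exchanges b = 0 with the term at l^2 \<tau>. Going from l c to
  the middle family produces (2x/l) \<omega>, because squares of Legendre symbols are 1; in the
  opposite direction \<open>cnj \<omega>\<close> cancels the \<omega> that arises.\<close>

lemma hecke_inversion:
  assumes l: "prime l" "l > 3" and \<omega>: "norm \<omega> = 1"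
    "\<And>x y. int l dvd 576 * x * y + 1 \<Longrightarrow> eta_mult l y x = of_int (Legendre x (int l)) * \<omega>"
    and \<tau>: "Im \<tau> > 0"
  shows "hecke_g l \<omega> (- 1 / \<tau>) = 2 * csqrt (- \<i> * \<tau>) * hecke_h l \<omega> \<tau>"
proof -
  let ?r = "csqrt (- \<i> * \<tau>)" and ?L = "\<lambda>x. of_int (Legendre x (int l)) :: complex"
  define R where "R = (of_real (sqrt l) :: complex)"
  have l0: "l > 0" "l > 1" "l > 2" "l\<^sup>2 > 0" "l\<^sup>2 > 1" using l one_less_power[of l 2] by simp_all
  have cl: "of_nat l \<noteq> (0::complex)" using l0 by simp
  have R0: "R \<noteq> 0" and RR: "R * R = of_nat l" using l0 by (simp_all add: R_def flip: of_real_mult)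
  have \<tau>0: "\<tau> \<noteq> 0" using \<tau> by auto
  \<comment> \<open>This rescaling brings arguments of the form (-1/\<tau> + 24 b)/l^2 into the
    shape required by \<open>g_fun_cusp\<close>.\<close>
  define \<tau>' where "\<tau>' = \<tau> / of_nat (l\<^sup>2)"
  have \<tau>': "Im \<tau>' > 0" using \<tau> l0 by (simp add: \<tau>'_def flip: of_nat_power)
  have r': "csqrt (- \<i> * \<tau>') = ?r / of_nat l"
  proof -
    have "- \<i> * \<tau>' = of_real (1 / (real l)\<^sup>2) * (- \<i> * \<tau>)" by (simp add: \<tau>'_def)
    also have "csqrt \<dots> = of_real (sqrt (1 / (real l)\<^sup>2)) * ?r"
      by (rule csqrt_of_real_mult) (use \<tau> l0 in auto)
    finally show ?thesis by (simp add: real_sqrt_divide)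
  qed
  obtain \<nu> where \<nu>: "bij_betw \<nu> (units l) (units l)" "\<And>x. x \<in> units l \<Longrightarrow>
      int l dvd 1152 * x * \<nu> x + 1"
    using neg_inverse_bij[OF coprime_1152_prime[OF l] l0(2)] by blast
  have "coprime 1152 (int (l\<^sup>2))" using coprime_1152_prime[OF l] by simp
  then obtain \<nu>' where \<nu>': "bij_betw \<nu>' (units (l\<^sup>2)) (units (l\<^sup>2))"
      "\<And>x. x \<in> units (l\<^sup>2) \<Longrightarrow> int (l\<^sup>2) dvd 1152 * x * \<nu>' x + 1"
    using neg_inverse_bij[OF _ l0(5)] by blast
  have L1: "?L x * ?L x = 1" if "\<not> int l dvd x" for x
    using Legendre_square[OF that] by (metis of_int_1 of_int_mult power2_eq_square)
  have ndvd: "\<not> int l dvd x" if "x \<in> units l" for x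
    using that coprime_int_prime_iff[OF l(1)] by (simp add: units_def)
  have ndvd2: "\<not> int l dvd 2 * x" if "x \<in> units l" for x
  proof -
    have "coprime (2 * 576) (int l)" using coprime_1152_prime[OF l] by simp
    hence "coprime 2 (int l)" by (simp only: coprime_mult_left_iff)
    thus ?thesis using ndvd[OF that] by (simp add: coprime_dvd_mult_right_iff coprime_commute)
  qed
  \<comment> \<open>Since 1152 = 24^2 * 2, the number 2 x \<nu>(x) is -1 up to a square modulo l.
    This matches the twist by -y in \<open>hecke_g\<close> with the twist by 2x in
    \<open>hecke_h\<close>.\<close>
  have L\<nu>: "?L (- \<nu> x) = ?L (2 * x)" if x: "x \<in> units l" for x
  proof -
    have "\<nu> x \<in> units l" using \<nu>(1) x by (auto simp: bij_betw_def)
    have "int l dvd 24\<^sup>2 * (2 * x * \<nu> x) + 1" using \<nu>(2)[OF x] by (simp add: mult_ac)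
    hence "[24\<^sup>2 * (2 * x * \<nu> x) = - 1] (mod int l)" by (simp add: cong_iff_dvd_diff)
    hence "Legendre (24\<^sup>2 * (2 * x * \<nu> x)) (int l) = Legendre (- 1) (int l)" by (rule Legendre_cong)
    moreover have "Legendre (24\<^sup>2) (int l) = 1"
    proof -
      have "coprime (24 * 24) (int l)" using coprime_576_prime[OF l] by simp
      hence "\<not> int l dvd 24" using coprime_int_prime_iff[OF l(1), of 24] by (simp only:
          coprime_mult_left_iff) simp
      from Legendre_square[OF this] show ?thesis by (simp only: power2_eq_square Legendre_mult[OF
          l(1) l0(3)])
    qed
    ultimately have e: "?L (2 * x) * ?L (\<nu> x) = ?L (- 1)"
      by (simp only: Legendre_mult[OF l(1) l0(3)] mult_1 of_int_mult[symmetric])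
    have "?L (- \<nu> x) = ?L (- 1) * ?L (\<nu> x)"
      using Legendre_mult[OF l(1) l0(3), of "- 1" "\<nu> x"] by simp
    also have "\<dots> = ?L (2 * x) * (?L (\<nu> x) * ?L (\<nu> x))" by (simp only: e[symmetric] mult.assoc)
    also have "\<dots> = ?L (2 * x)" using L1[OF ndvd[OF \<open>\<nu> x \<in> units l\<close>]] by simp
    finally show ?thesis .
  qed
  have gl: "g_fun (24 * of_int (\<nu> x) / of_nat l - 1 / ((of_nat l)\<^sup>2 * t)) =
      ?L (2 * x) * \<omega> * (2 * R * csqrt (- \<i> * t) * h_fun (t + 48 * of_int x / of_nat l))"
    if x: "x \<in> units l" and t: "Im t > 0" for x t
  proof -
    have "int l dvd 576 * (2 * x) * \<nu> x + 1" "int l dvd 576 * x * (2 * \<nu> x) + 1"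
      using \<nu>(2)[OF x] by (simp_all add: mult_ac)
    hence m: "eta_mult l (\<nu> x) (2 * x) = ?L (2 * x) * \<omega>" "eta_mult l (2 * \<nu> x) x = ?L x * \<omega>"
      using \<omega>(2) by blast+
    have "\<omega> \<noteq> 0" using \<omega>(1) by auto
    hence "(?L (2 * x) * \<omega>) ^ 3 / (?L x * \<omega>) ^ 2 =
        (?L (2 * x) * ?L (2 * x)) * ?L (2 * x) * \<omega> / (?L x * ?L x)"
      by (simp add: power2_eq_square power3_eq_cube divide_simps)
    also have "\<dots> = ?L (2 * x) * \<omega>" unfolding L1[OF ndvd[OF x]] L1[OF ndvd2[OF x]] by simp
    finally show ?thesis unfolding g_fun_cusp[OF l0(1) \<nu>(2)[OF x] t] m R_def by simp
  qed
  have "(\<Sum>b\<in>{0..<int (l\<^sup>2)}. g_fun ((- 1 / \<tau> + 24 * of_int b) / of_nat (l\<^sup>2))) =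
      (\<Sum>x\<in>units (l\<^sup>2). 2 * ?r * h_fun ((\<tau> + 48 * of_int x) / of_nat (l\<^sup>2))) +
      (2 * of_nat l * ?r * h_fun (of_nat (l\<^sup>2) * \<tau>) +
       (\<Sum>x\<in>units l. ?L (2 * x) * \<omega> * (2 * R * ?r * h_fun (\<tau> + 48 * of_int x / of_nat l))))"
  proof -
    have "(\<Sum>b\<in>units (l\<^sup>2). g_fun ((- 1 / \<tau> + 24 * of_int b) / of_nat (l\<^sup>2))) =
        (\<Sum>x\<in>units (l\<^sup>2). g_fun ((- 1 / \<tau> + 24 * of_int (\<nu>' x)) / of_nat (l\<^sup>2)))"
      by (rule sum.reindex_bij_betw[OF \<nu>'(1), symmetric])
    also have "\<dots> = (\<Sum>x\<in>units (l\<^sup>2). 2 * ?r * h_fun ((\<tau> + 48 * of_int x) / of_nat (l\<^sup>2)))"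
    proof (intro sum.cong refl)
      fix x assume x: "x \<in> units (l\<^sup>2)"
      have "(- 1 / \<tau> + 24 * of_int (\<nu>' x)) / of_nat (l\<^sup>2) =
          24 * of_int (\<nu>' x) / of_nat (l\<^sup>2) - 1 / ((of_nat (l\<^sup>2))\<^sup>2 * \<tau>')"
        using cl \<tau>0 by (simp add: \<tau>'_def field_simps power2_eq_square)
      hence "g_fun ((- 1 / \<tau> + 24 * of_int (\<nu>' x)) / of_nat (l\<^sup>2)) =
          2 * of_nat l * csqrt (- \<i> * \<tau>') * h_fun (\<tau>' + 48 * of_int x / of_nat (l\<^sup>2))"
        using g_fun_cusp_prime_square[OF l \<nu>'(2)[OF x] \<tau>'] by simp
      also have "\<tau>' + 48 * of_int x / of_nat (l\<^sup>2) = (\<tau> + 48 * of_int x) / of_nat (l\<^sup>2)"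
        by (simp add: \<tau>'_def add_divide_distrib)
      finally show "g_fun ((- 1 / \<tau> + 24 * of_int (\<nu>' x)) / of_nat (l\<^sup>2)) =
          2 * ?r * h_fun ((\<tau> + 48 * of_int x) / of_nat (l\<^sup>2))"
        unfolding r' using cl by simp
    qed
    moreover have "(\<Sum>c\<in>{0..<int l}. g_fun ((- 1 / \<tau> + 24 * of_int (int l * c)) / of_nat (l\<^sup>2))) =
        2 * of_nat l * ?r * h_fun (of_nat (l\<^sup>2) * \<tau>) +
        (\<Sum>x\<in>units l. ?L (2 * x) * \<omega> * (2 * R * ?r * h_fun (\<tau> + 48 * of_int x / of_nat l)))"
    proof -
      have eq: "(- 1 / \<tau> + 24 * of_int (int l * c)) / of_nat (l\<^sup>2) =
          24 * of_int c / of_nat l - 1 / ((of_nat l)\<^sup>2 * \<tau>)" for c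
        using cl \<tau>0 by (simp add: field_simps power2_eq_square)
      have set: "{0..<int l} = insert 0 (units l)" using units_prime[OF l(1)] l0 by auto
      have "(\<Sum>x\<in>units l. ?L (2 * x) * \<omega> * (2 * R * ?r * h_fun (\<tau> + 48 * of_int x / of_nat l))) =
          (\<Sum>x\<in>units l. g_fun (24 * of_int (\<nu> x) / of_nat l - 1 / ((of_nat l)\<^sup>2 * \<tau>)))"
        by (intro sum.cong refl) (simp only: gl[OF _ \<tau>])
      also have "\<dots> = (\<Sum>y\<in>units l. g_fun (24 * of_int y / of_nat l - 1 / ((of_nat l)\<^sup>2 * \<tau>)))"
        by (rule sum.reindex_bij_betw[OF \<nu>(1)])
      moreover have "g_fun (- 1 / ((of_nat l)\<^sup>2 * \<tau>)) =
          2 * of_nat l * ?r * h_fun (of_nat (l\<^sup>2) * \<tau>)"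
        using g_fun_inversion[OF \<tau>, of "(real l)\<^sup>2"] l0 by simp
      moreover have "0 \<notin> units l" using units_prime[OF l(1)] by simp
      ultimately show ?thesis unfolding eq set by simp
    qed
    ultimately show ?thesis unfolding sum_prime_square_residues[OF l(1)] by simp
  qed
  moreover have "(\<Sum>y\<in>units l. ?L (- y) * cnj \<omega> * g_fun (- 1 / \<tau> + 24 * of_int y / of_nat l)) =
      2 * ?r / R * (\<Sum>x\<in>units l. h_fun ((\<tau> + 48 * of_int (int l * x)) / of_nat (l\<^sup>2)))"
  proof -
    have "(\<Sum>y\<in>units l. ?L (- y) * cnj \<omega> * g_fun (- 1 / \<tau> + 24 * of_int y / of_nat l)) =
        (\<Sum>x\<in>units l. ?L (- \<nu> x) * cnj \<omega> * g_fun (- 1 / \<tau> + 24 * of_int (\<nu> x) / of_nat l))"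
      by (rule sum.reindex_bij_betw[OF \<nu>(1), symmetric])
    also have "\<dots> = (\<Sum>x\<in>units l. 2 * ?r / R * h_fun ((\<tau> + 48 * of_int (int l * x)) / of_nat (l\<^sup>2)))"
    proof (intro sum.cong refl)
      fix x assume x: "x \<in> units l"
      have "- 1 / \<tau> + 24 * of_int (\<nu> x) / of_nat l =
          24 * of_int (\<nu> x) / of_nat l - 1 / ((of_nat l)\<^sup>2 * \<tau>')"
        using cl by (simp add: \<tau>'_def)
      moreover have "\<tau>' + 48 * of_int x / of_nat l = (\<tau> + 48 * of_int (int l * x)) / of_nat (l\<^sup>2)"
        using cl by (simp add: \<tau>'_def field_simps power2_eq_square)
      ultimately have "g_fun (- 1 / \<tau> + 24 * of_int (\<nu> x) / of_nat l) = ?L (2 * x) * \<omega> *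
          (2 * R * (?r / of_nat l) * h_fun ((\<tau> + 48 * of_int (int l * x)) / of_nat (l\<^sup>2)))"
        using gl[OF x \<tau>'] unfolding r' by simp
      hence "?L (- \<nu> x) * cnj \<omega> * g_fun (- 1 / \<tau> + 24 * of_int (\<nu> x) / of_nat l) =
          (?L (2 * x) * ?L (2 * x)) * (\<omega> * cnj \<omega>) *
          (2 * R * (?r / of_nat l) * h_fun ((\<tau> + 48 * of_int (int l * x)) / of_nat (l\<^sup>2)))"
        unfolding L\<nu>[OF x] by (simp only: mult_ac)
      also have "\<omega> * cnj \<omega> = 1" using \<omega>(1) complex_norm_square[of \<omega>] by simp
      finally show "?L (- \<nu> x) * cnj \<omega> * g_fun (- 1 / \<tau> + 24 * of_int (\<nu> x) / of_nat l) =
          2 * ?r / R * h_fun ((\<tau> + 48 * of_int (int l * x)) / of_nat (l\<^sup>2))"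
        unfolding L1[OF ndvd2[OF x]] RR[symmetric] using R0 by simp
    qed
    finally show ?thesis by (simp only: sum_distrib_left)
  qed
  moreover have "g_fun (of_nat (l\<^sup>2) * (- 1 / \<tau>)) = 2 * ?r / of_nat l * h_fun (\<tau> / of_nat (l\<^sup>2))"
    using g_fun_inversion[OF \<tau>', of 1] r' cl by (simp add: \<tau>'_def field_simps)
  ultimately have "hecke_g l \<omega> (- 1 / \<tau>) =
      ((\<Sum>x\<in>units (l\<^sup>2). 2 * ?r * h_fun ((\<tau> + 48 * of_int x) / of_nat (l\<^sup>2))) +
      (2 * of_nat l * ?r * h_fun (of_nat (l\<^sup>2) * \<tau>) +
       (\<Sum>x\<in>units l. ?L (2 * x) * \<omega> * (2 * R * ?r * h_fun (\<tau> +
           48 * of_int x / of_nat l))))) / of_nat l +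
      2 * ?r / R * (\<Sum>x\<in>units l. h_fun ((\<tau> + 48 * of_int (int l * x)) / of_nat (l\<^sup>2))) / R +
      2 * ?r / of_nat l * h_fun (\<tau> / of_nat (l\<^sup>2))"
    unfolding hecke_g_def R_def by (simp only:)
  also have "\<dots> = 2 * ?r * hecke_h l \<omega> \<tau>"
  proof -
    define S1 where "S1 = (\<Sum>x\<in>units (l\<^sup>2). h_fun ((\<tau> + 48 * of_int x) / of_nat (l\<^sup>2)))"
    define S2 where "S2 = (\<Sum>x\<in>units l. h_fun ((\<tau> + 48 * of_int (int l * x)) / of_nat (l\<^sup>2)))"
    define S3 where "S3 = (\<Sum>x\<in>units l. ?L (2 * x) * \<omega> * h_fun (\<tau> + 48 * of_int x / of_nat l))"
    have e1: "(\<Sum>x\<in>units (l\<^sup>2). 2 * ?r * h_fun ((\<tau> + 48 * of_int x) / of_nat (l\<^sup>2))) = 2 * ?r * S1"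
      by (simp only: S1_def sum_distrib_left)
    have e3: "(\<Sum>x\<in>units l. ?L (2 * x) * \<omega> * (2 * R * ?r * h_fun (\<tau> + 48 * of_int x / of_nat l))) =
        2 * R * ?r * S3"
      by (simp only: S3_def sum_distrib_left mult_ac)
    have set: "{0..<int l} = insert 0 (units l)" using units_prime[OF l(1)] l0 by auto
    have "(\<Sum>c\<in>{0..<int l}. h_fun ((\<tau> + 48 * of_int (int l * c)) / of_nat (l\<^sup>2))) =
        h_fun (\<tau> / of_nat (l\<^sup>2)) + S2"
      unfolding set S2_def using units_prime[OF l(1)] by simp
    hence e2: "(\<Sum>b\<in>{0..<int (l\<^sup>2)}. h_fun ((\<tau> + 48 * of_int b) / of_nat (l\<^sup>2))) =
        S1 + (h_fun (\<tau> / of_nat (l\<^sup>2)) + S2)"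
      unfolding sum_prime_square_residues[OF l(1)] S1_def by simp
    have "(2 * r * S1 + (2 * n * r * X + 2 * R * r * S3)) / n + 2 * r / R * S2 / R + 2 * r / n * Z =
        2 * r * ((S1 + (Z + S2)) / n + S3 / R + X)" if "R * R = n" for n r X Z
      unfolding that[symmetric] using R0 by (simp add: divide_simps) (simp add: algebra_simps)
    from this[OF RR] show ?thesis
      unfolding hecke_h_def e1 e2 e3 S2_def[symmetric] S3_def[symmetric] R_def[symmetric] by blast
  qed
  finally show ?thesis .
qed

section \<open>Expansions at the cusps\<close>

text \<open>Convergence at a point of larger modulus gives absolute convergence, hence unordered
  summability, which is stable under the reindexing to come.\<close>

lemma disc_sums_imp_has_sum:
  fixes c :: "nat \<Rightarrow> complex"
  assumes "\<And>q. norm q < 1 \<Longrightarrow> (\<lambda>k. c k * q ^ k) sums f q" and "norm q < 1"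
  shows "((\<lambda>k. c k * q ^ k) has_sum f q) UNIV"
proof -
  define r where "r = complex_of_real ((1 + norm q) / 2)"
  have "norm r = (1 + norm q) / 2" unfolding r_def by (simp only: norm_of_real) simp
  hence r: "norm q < norm r" "norm r < 1" using assms(2) by simp_all
  have "summable (\<lambda>k. c k * r ^ k)" using assms(1)[OF r(2)] by (rule sums_summable)
  hence "summable (\<lambda>k. norm (c k * q ^ k))" using r(1) by (rule powser_insidea)
  thus ?thesis by (rule norm_summable_imp_has_sum[OF _ assms(1)[OF assms(2)]])
qed

text \<open>A function of \<tau> determines values only on the punctured disc; its series supplies
  the missing point and with it holomorphy at the cusp.\<close>

lemma disc_function_from_nome_series:
  assumes "\<And>\<tau>. Im \<tau> > 0 \<Longrightarrow> ((\<lambda>j. c j * nome \<tau> ^ j) has_sum f \<tau>) UNIV"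
  obtains \<Phi> where "\<Phi> holomorphic_on ball 0 1" "\<Phi> 0 = c 0" "\<And>\<tau>. Im \<tau> > 0 \<Longrightarrow> f \<tau> = \<Phi> (nome \<tau>)"
proof -
  define \<Phi> where "\<Phi> = (\<lambda>q. \<Sum>j. c j * q ^ j)"
  have sums: "(\<lambda>j. c j * q ^ j) sums \<Phi> q" if q1: "norm q < 1" for q
  proof (cases "q = 0")
    case True
    have "(\<lambda>j. c j * 0 ^ j) sums c 0" by (rule powser_sums_zero)
    thus ?thesis unfolding \<Phi>_def True using summable_sums sums_summable by blast
  next
    case False
    then obtain \<tau> where "Im \<tau> > 0" "nome \<tau> = q" using ex_nome[of q] q1 by auto
    thus ?thesis unfolding \<Phi>_def using has_sum_imp_sums[OF assms] summable_sums sums_summable by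
        blast
  qed
  show ?thesis
  proof (rule that[of \<Phi>])
    show "\<Phi> holomorphic_on ball 0 1" by (rule power_series_holomorphic[of 0]) (use sums in auto)
    show "\<Phi> 0 = c 0" using sums_unique2[OF sums[of 0] powser_sums_zero] by simp
    show "f \<tau> = \<Phi> (nome \<tau>)" if "Im \<tau> > 0" for \<tau>
      using sums_unique2[OF has_sum_imp_sums[OF assms[OF that]] sums[OF norm_nome_less_1[OF that]]]
          .
  qed
qed

lemma nome_power_eq: "nome x * nome y ^ k = nome (x + of_nat k * y)"
  by (simp only: nome_add nome_of_nat_mult)

text \<open>The exponent is written \<open>24 * int k + (- 1)\<close> to fit the pattern M k + B of
  \<open>progression_has_sum\<close>.\<close>

lemma g_fun_has_sum:
  assumes "Im \<tau> > 0"
  shows "((\<lambda>k. beta (of_nat k) * nome (of_int (24 * int k + (- 1)) * \<tau> / 24)) has_sum g_fun \<tau>) UNIV"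
proof -
  have "((\<lambda>k. nome (- \<tau> / 24) * (beta (of_nat k) * nome \<tau> ^ k)) has_sum
      nome (- \<tau> / 24) * B_fun (nome \<tau>)) UNIV"
    by (intro has_sum_cmult_right disc_sums_imp_has_sum beta_sums_B_fun norm_nome_less_1 assms)
  moreover have "nome (- \<tau> / 24) * (beta (of_nat k) * nome \<tau> ^ k) =
      beta (of_nat k) * nome (of_int (24 * int k + (- 1)) * \<tau> / 24)" for k
  proof -
    have "- \<tau> / 24 + of_nat k * \<tau> = of_int (24 * int k + (- 1)) * \<tau> / 24" by (simp add: field_simps)
    thus ?thesis using nome_power_eq[of "- \<tau> / 24" \<tau> k] by (simp only: mult.left_commute)
  qed
  ultimately show ?thesis by (simp only: g_fun_eq)
qed

definition C_coeff :: "nat \<Rightarrow> complex" where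
  "C_coeff k = fps_nth (fps_expansion C_fun 0) k"

lemma C_fun_has_sum:
  assumes "norm x < 1"
  shows "((\<lambda>k. C_coeff k * x ^ k) has_sum C_fun x) UNIV"
proof (rule disc_sums_imp_has_sum[OF _ assms])
  fix q :: complex assume "norm q < 1"
  thus "(\<lambda>k. C_coeff k * q ^ k) sums C_fun q"
    using holomorphic_power_series[OF C_fun_holomorphic, of q]
    by (simp add: C_coeff_def fps_expansion_def)
qed

lemma h_fun_has_sum:
  assumes "Im \<tau> > 0"
  shows "((\<lambda>k. C_coeff k * nome (of_int (6 * int k + 1) * \<tau> / 12)) has_sum h_fun \<tau>) UNIV"
proof -
  have "((\<lambda>k. nome (\<tau> / 12) * (C_coeff k * nome (\<tau> / 2) ^ k)) has_sum
      nome (\<tau> / 12) * C_fun (nome (\<tau> / 2))) UNIV"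
    using assms by (intro has_sum_cmult_right C_fun_has_sum norm_nome_less_1) simp
  moreover have "nome (\<tau> / 12) * (C_coeff k * nome (\<tau> / 2) ^ k) =
      C_coeff k * nome (of_int (6 * int k + 1) * \<tau> / 12)" for k
  proof -
    have "\<tau> / 12 + of_nat k * (\<tau> / 2) = of_int (6 * int k + 1) * \<tau> / 12" by (simp add: field_simps)
    thus ?thesis using nome_power_eq[of "\<tau> / 12" "\<tau> / 2" k] by (simp only: mult.left_commute)
  qed
  ultimately show ?thesis by (simp only: h_fun_eq)
qed

text \<open>Orthogonality of additive characters, stated once for both cusps: D = 24 and t = 1 for
  \<open>g_fun\<close>, D = 12 and t = 4 for \<open>h_fun\<close>, whose shifts are 48 = 12 * 4.
  Since t is coprime to N, it does not change which exponents survive.\<close>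

lemma progression_has_sum:
  fixes a :: "nat \<Rightarrow> complex" and M B t :: int and D :: complex
  assumes N: "N > 0" and t: "coprime t (int N)" and D: "D \<noteq> 0"
    and series: "\<And>b. b \<in> {0..<int N} \<Longrightarrow>
      ((\<lambda>k. a k * nome (of_int (M * int k + B) * ((\<tau> +
          D * of_int (t * b)) / of_nat N) / D)) has_sum f b) UNIV"
  shows "((\<lambda>k. of_nat N * (a k * nome (of_int (M * int k + B) * \<tau> / (D * of_nat N)))) has_sum
      (\<Sum>b\<in>{0..<int N}. f b)) {k. int N dvd M * int k + B}"
proof -
  have "nome (of_int (M * int k + B) * ((\<tau> + D * of_int (t * b)) / of_nat N) / D) =
      nome (of_int (M * int k + B) * \<tau> / (D * of_nat N)) *
      nome (of_int ((M * int k + B) * t * b) / of_nat N)" for k b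
    unfolding nome_add[symmetric] using D N by (intro arg_cong[of _ _ nome]) (simp add: field_simps)
  hence eq: "a k * nome (of_int (M * int k + B) * ((\<tau> + D * of_int (t * b)) / of_nat N) / D) =
      a k * nome (of_int (M * int k + B) * \<tau> / (D * of_nat N)) *
      nome (of_int ((M * int k + B) * t * b) / of_nat N)" for k b
    by (simp only: mult.assoc)
  have "((\<lambda>k. \<Sum>b\<in>{0..<int N}. a k * nome (of_int (M * int k + B) * \<tau> / (D * of_nat N)) *
      nome (of_int ((M * int k + B) * t * b) / of_nat N)) has_sum (\<Sum>b\<in>{0..<int N}. f b)) UNIV"
    unfolding eq[symmetric] by (rule has_sum_finite_sum[OF _ series]) auto
  hence "((\<lambda>k. a k * nome (of_int (M * int k + B) * \<tau> / (D * of_nat N)) *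
      (if int N dvd (M * int k + B) * t then of_nat N else 0)) has_sum (\<Sum>b\<in>{0..<int N}. f b)) UNIV"
    unfolding sum_distrib_left[symmetric] sum_nome_frac[OF N] .
  moreover have "int N dvd (M * int k + B) * t \<longleftrightarrow> int N dvd M * int k + B" for k
    using t by (simp add: coprime_dvd_mult_left_iff coprime_commute)
  ultimately have "((\<lambda>k. a k * nome (of_int (M * int k + B) * \<tau> / (D * of_nat N)) *
      (if int N dvd M * int k + B then of_nat N else 0)) has_sum
          (\<Sum>b\<in>{0..<int N}. f b)) UNIV" by simp
  thus ?thesis by (rule has_sum_cong_neutral[THEN iffD1, rotated -1]) (auto simp: mult_ac)
qed

section \<open>The expansion at the cusp 0\<close>

lemma s_nat_pos:
  assumes "prime l" and "l > 3"
  shows "s_nat l > 0"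
proof (rule ccontr)
  assume "\<not> s_nat l > 0"
  hence "l\<^sup>2 = 1" using s_nat[OF assms] by simp
  thus False using assms by simp
qed

lemma s_nat_int:
  assumes "prime l" and "l > 3"
  shows "int (l\<^sup>2) = 24 * int (s_nat l) + 1"
  using s_nat[OF assms] by linarith

text \<open>All three families have exponents in 1/12 plus nonnegative multiples of 1/2, as
  \<open>h_fun\<close> itself has. For the first family this holds because l^2 dividing 6k+1 leaves
  a positive quotient congruent to 1 modulo 6. Hence no negative powers occur, and the Hecke image
  has no pole relative to \<open>h_fun\<close>.\<close>

lemma hecke_h_expansion:
  assumes l: "prime l" "l > 3"
  obtains \<Phi> where "\<Phi> holomorphic_on ball 0 1"
    "\<And>\<tau>. Im \<tau> > 0 \<Longrightarrow> hecke_h l \<omega> \<tau> = nome (\<tau> / 12) * \<Phi> (nome (\<tau> / 2))"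
proof -
  let ?s = "s_nat l" and ?L = "\<lambda>x. of_int (Legendre x (int l)) :: complex"
  have l0: "l > 0" "l\<^sup>2 > 0" using l by simp_all
  have cl: "of_nat l \<noteq> (0::complex)" using l0 by simp
  define w where "w = (\<lambda>k. (\<Sum>x\<in>units l. ?L (2 * x) * \<omega> * nome (of_int ((6 * int k +
      1) * (4 * x)) / of_nat l)) / of_real (sqrt l))"
  \<comment> \<open>The offset 4 s is (l^2-1)/6: the equation 6k+1 = l^2 (6j+1) means k = l^2 j + 4
    s. In the last term the same offset appears as the lowest exponent.\<close>
  define c where "c = (\<lambda>j. of_nat l * C_coeff (l\<^sup>2 * j + 4 * ?s) + C_coeff j * w j +
      dilated_coeff (l\<^sup>2) (4 * ?s) C_coeff j)"
  have key: "((\<lambda>j. c j * nome (\<tau> / 2) ^ j) has_sum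
      hecke_h l \<omega> \<tau> / nome (\<tau> / 12)) UNIV" if \<tau>: "Im \<tau> > 0" for \<tau>
  proof -
    let ?x = "nome (\<tau> / 2)" and ?P = "nome (\<tau> / 12)"
    have Px: "nome (of_int (6 * int j + 1) * \<tau> / 12) = ?P * ?x ^ j" for j
      unfolding nome_power_eq by (simp add: field_simps)
    have "((\<lambda>j. of_nat l * C_coeff (l\<^sup>2 * j + 4 * ?s) * ?x ^ j) has_sum
        (\<Sum>b\<in>{0..<int (l\<^sup>2)}. h_fun ((\<tau> + 48 * of_int b) / of_nat (l\<^sup>2))) / of_nat l / ?P) UNIV"
    proof -
      let ?K = "{k. int (l\<^sup>2) dvd 6 * int k + 1}" and ?\<psi> = "\<lambda>j. l\<^sup>2 * j + 4 * ?s"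
      have "coprime (4 * 288) (int l)" using coprime_1152_prime[OF l] by simp
      hence "coprime 4 (int l)" by (simp only: coprime_mult_left_iff)
      hence cop: "coprime 4 (int (l\<^sup>2))" by simp
      have "((\<lambda>k. of_nat (l\<^sup>2) * (C_coeff k * nome (of_int (6 * int k +
          1) * \<tau> / (12 * of_nat (l\<^sup>2))))) has_sum
          (\<Sum>b\<in>{0..<int (l\<^sup>2)}. h_fun ((\<tau> + 12 * of_int (4 * b)) / of_nat (l\<^sup>2)))) ?K"
      proof (rule progression_has_sum[OF l0(2) cop])
        fix b
        have "Im ((\<tau> + 12 * of_int (4 * b)) / of_nat (l\<^sup>2)) > 0"
          using \<tau> l0 by (simp add: Im_divide_of_nat del: of_nat_power)
        thus "((\<lambda>k. C_coeff k * nome (of_int (6 * int k + 1) * ((\<tau> +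
            12 * of_int (4 * b)) / of_nat (l\<^sup>2)) / 12)) has_sum
            h_fun ((\<tau> + 12 * of_int (4 * b)) / of_nat (l\<^sup>2))) UNIV" by (rule h_fun_has_sum)
      qed simp
      moreover have \<psi>: "6 * int (?\<psi> j) + 1 = int (l\<^sup>2) * (6 * int j + 1)" for j
      proof -
        have "6 * int (?\<psi> j) + 1 = int (l\<^sup>2) * (6 * int j) + (24 * int ?s + 1)" by simp
        thus ?thesis unfolding s_nat_int[OF l, symmetric] by (simp only: distrib_left mult_1_right)
      qed
      have "?K = range ?\<psi>"
      proof (intro equalityI subsetI)
        fix k assume "k \<in> ?K"
        then obtain m where m: "6 * int k + 1 = int (l\<^sup>2) * m" by (auto elim: dvdE)
        have "m > 0"
        proof (rule ccontr)
          assume "\<not> m > 0"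
          hence "int (l\<^sup>2) * m \<le> 0" by (simp add: mult_nonneg_nonpos)
          thus False using m by linarith
        qed
        have "m = 6 * (int k - 4 * int ?s * m) +
            1" using m unfolding s_nat_int[OF l] by (simp add: algebra_simps)
        then obtain i where i: "m = 6 * i + 1" by blast
        have "i \<ge> 0" using i \<open>m > 0\<close> by linarith
        then obtain j where j: "i = int j" by (metis nonneg_int_cases)
        have "6 * int (?\<psi> j) + 1 = 6 * int k + 1" unfolding \<psi> m i j ..
        moreover have "X = Z" if "6 * X + 1 = 6 * Z + 1" for X Z :: int using that by simp
        ultimately have "int (?\<psi> j) = int k" by blast
        hence "k = ?\<psi> j" by (simp only: of_nat_eq_iff)
        thus "k \<in> range ?\<psi>" by blast
      next
        fix k assume "k \<in> range ?\<psi>"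
        then obtain j where k: "k = ?\<psi> j" by blast
        show "k \<in> ?K" unfolding k mem_Collect_eq \<psi> by (rule dvd_triv_left)
      qed
      moreover have "inj ?\<psi>" using l0 by (auto simp: inj_def)
      ultimately have "((\<lambda>j. of_nat (l\<^sup>2) * (C_coeff (?\<psi> j) * nome (of_int (6 * int (?\<psi> j) +
          1) * \<tau> / (12 * of_nat (l\<^sup>2))))) has_sum
          (\<Sum>b\<in>{0..<int (l\<^sup>2)}. h_fun ((\<tau> + 12 * of_int (4 * b)) / of_nat (l\<^sup>2)))) UNIV"
        by (simp only: has_sum_reindex o_def)
      moreover have "of_nat (l\<^sup>2) * (C_coeff (?\<psi> j) * nome (of_int (6 * int (?\<psi> j) +
          1) * \<tau> / (12 * of_nat (l\<^sup>2)))) =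
          (of_nat l * ?P) * (of_nat l * C_coeff (?\<psi> j) * ?x ^ j)" for j
      proof -
        have "of_int (6 * int (?\<psi> j) + 1) * \<tau> / (12 * of_nat (l\<^sup>2)) =
            of_int (6 * int j + 1) * \<tau> / 12"
          unfolding \<psi> using cl by simp
        hence "nome (of_int (6 * int (?\<psi> j) + 1) * \<tau> / (12 * of_nat (l\<^sup>2))) =
            ?P * ?x ^ j" using Px by (simp only:)
        thus ?thesis by (simp add: power2_eq_square)
      qed
      ultimately have "((\<lambda>j. (of_nat l * ?P) * (of_nat l * C_coeff (?\<psi> j) * ?x ^ j)) has_sum
          (\<Sum>b\<in>{0..<int (l\<^sup>2)}. h_fun ((\<tau> + 12 * of_int (4 *
              b)) / of_nat (l\<^sup>2)))) UNIV" by (simp only:)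
      from has_sum_cmult_right[OF this, of "1 / (of_nat l * ?P)"] show ?thesis
        using cl by (simp add: mult.assoc)
    qed
    moreover have "((\<lambda>j. C_coeff j * w j * ?x ^ j) has_sum
        (\<Sum>x\<in>units l. ?L (2 * x) * \<omega> * h_fun (\<tau> +
            48 * of_int x / of_nat l)) / of_real (sqrt l) / ?P) UNIV"
    proof -
      have "((\<lambda>j. (\<Sum>x\<in>units l. ?L (2 * x) * \<omega> *
            (C_coeff j * nome (of_int (6 * int j + 1) * (\<tau> +
                48 * of_int x / of_nat l) / 12)))) has_sum
          (\<Sum>x\<in>units l. ?L (2 * x) * \<omega> * h_fun (\<tau> + 48 * of_int x / of_nat l))) UNIV"
        using \<tau> by (intro has_sum_finite_sum has_sum_cmult_right h_fun_has_sum) simp_all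
      moreover have "(\<Sum>x\<in>units l. ?L (2 * x) * \<omega> *
            (C_coeff j * nome (of_int (6 * int j + 1) * (\<tau> + 48 * of_int x / of_nat l) / 12))) =
          (of_real (sqrt l) * ?P) * (C_coeff j * w j * ?x ^ j)" for j
      proof -
        have eq: "nome (of_int (6 * int j + 1) * (\<tau> + 48 * of_int x / of_nat l) / 12) =
            ?P * ?x ^ j * nome (of_int ((6 * int j + 1) * (4 * x)) / of_nat l)" for x
          unfolding Px[symmetric] nome_add[symmetric] using cl
          by (intro arg_cong[of _ _ nome]) (simp add: field_simps)
        have w: "(\<Sum>x\<in>units l. ?L (2 * x) * \<omega> * nome (of_int ((6 * int j +
            1) * (4 * x)) / of_nat l)) =
            of_real (sqrt l) * w j"
          using l0 by (simp add: w_def)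
        have "(\<Sum>x\<in>units l. ?L (2 * x) * \<omega> *
              (C_coeff j * nome (of_int (6 * int j + 1) * (\<tau> + 48 * of_int x / of_nat l) / 12))) =
            C_coeff j * (?P * ?x ^ j) *
            (\<Sum>x\<in>units l. ?L (2 * x) * \<omega> * nome (of_int ((6 * int j + 1) * (4 * x)) / of_nat l))"
          unfolding sum_distrib_left by (intro sum.cong refl) (simp only: eq, simp only: mult_ac)
        thus ?thesis unfolding w by (simp only: mult.assoc mult.commute mult.left_commute)
      qed
      ultimately have "((\<lambda>j. (of_real (sqrt l) * ?P) * (C_coeff j * w j * ?x ^ j)) has_sum
          (\<Sum>x\<in>units l. ?L (2 * x) * \<omega> * h_fun (\<tau> + 48 * of_int x / of_nat l))) UNIV" by (simp only:)
      from has_sum_cmult_right[OF this, of "1 / (of_real (sqrt l) * ?P)"] show ?thesis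
        using l0 by (simp add: mult.assoc)
    qed
    moreover have "((\<lambda>j. dilated_coeff (l\<^sup>2) (4 * ?s) C_coeff j * ?x ^ j) has_sum
        h_fun (of_nat (l\<^sup>2) * \<tau>) / ?P) UNIV"
    proof -
      have "norm (nome (\<tau> / 2)) < 1" using \<tau> by (intro norm_nome_less_1) simp
      hence "norm (?x ^ l\<^sup>2) < 1" using l0 by (simp add: norm_power power_less_one_iff)
      from dilated_coeff_has_sum[OF l0(2) C_fun_has_sum[OF this], of "4 * ?s"]
      have "((\<lambda>j. dilated_coeff (l\<^sup>2) (4 * ?s) C_coeff j * ?x ^ j) has_sum
          ?x ^ (4 * ?s) * C_fun (?x ^ l\<^sup>2)) UNIV" .
      moreover have "h_fun (of_nat (l\<^sup>2) * \<tau>) = ?P * (?x ^ (4 * ?s) * C_fun (?x ^ l\<^sup>2))"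
      proof -
        have "of_nat (l\<^sup>2) * \<tau> / 12 = \<tau> / 12 + of_nat (4 * ?s) * (\<tau> / 2)"
          unfolding s_nat[OF l, symmetric] by (simp add: field_simps)
        moreover have "of_nat (l\<^sup>2) * \<tau> / 2 = of_nat (l\<^sup>2) * (\<tau> / 2)" by simp
        ultimately show ?thesis by (simp only: h_fun_eq nome_add nome_of_nat_mult mult.assoc)
      qed
      ultimately show ?thesis by simp
    qed
    ultimately have "((\<lambda>j. of_nat l * C_coeff (l\<^sup>2 * j + 4 * ?s) * ?x ^ j +
        C_coeff j * w j * ?x ^ j +
        dilated_coeff (l\<^sup>2) (4 * ?s) C_coeff j * ?x ^ j) has_sum
        (\<Sum>b\<in>{0..<int (l\<^sup>2)}. h_fun ((\<tau> + 48 * of_int b) / of_nat (l\<^sup>2))) / of_nat l / ?P +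
        (\<Sum>x\<in>units l. ?L (2 * x) * \<omega> * h_fun (\<tau> +
            48 * of_int x / of_nat l)) / of_real (sqrt l) / ?P +
        h_fun (of_nat (l\<^sup>2) * \<tau>) / ?P) UNIV"
      by (intro has_sum_add)
    thus ?thesis by (simp only: hecke_h_def c_def add_divide_distrib distrib_right)
  qed
  have "((\<lambda>j. c j * nome \<tau> ^ j) has_sum hecke_h l \<omega> (2 * \<tau>) / nome (2 *
      \<tau> / 12)) UNIV" if "Im \<tau> > 0" for \<tau>
    using key[of "2 * \<tau>"] that by simp
  from disc_function_from_nome_series[OF this] obtain \<Phi> where \<Phi>: "\<Phi> holomorphic_on ball 0 1"
    "\<And>\<tau>. Im \<tau> > 0 \<Longrightarrow> hecke_h l \<omega> (2 * \<tau>) / nome (2 * \<tau> / 12) = \<Phi> (nome \<tau>)" by auto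
  have "hecke_h l \<omega> \<tau> = nome (\<tau> / 12) * \<Phi> (nome (\<tau> / 2))" if "Im \<tau> > 0" for \<tau>
    using \<Phi>(2)[of "\<tau> / 2"] that by (simp add: field_simps)
  thus ?thesis using that \<Phi>(1) by blast
qed

section \<open>The expansion at i\<infinity> and the identification of
  \<open>W_tilde\<close>\<close>

lemma s_ell_eq:
  assumes "prime l" and "l > 3"
  shows "s_ell l = of_nat (s_nat l)"
proof -
  have "(of_nat (24 * s_nat l + 1) :: rat) = of_nat (l\<^sup>2)" by (simp only: s_nat[OF assms])
  thus ?thesis by (simp add: s_ell_def field_simps)
qed

lemma beta_of_int_neg: "n < 0 \<Longrightarrow> beta (of_int n) = 0"
  by (auto simp: beta_def Nats_def)

lemma nome_powi: "nome \<tau> powi n = nome (of_int n * \<tau>)"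
proof (cases "n \<ge> 0")
  case True
  then obtain k where "n = int k" by (metis nonneg_int_cases)
  thus ?thesis by (simp add: nome_of_nat_mult)
next
  case False
  then obtain k where "n = - int k" by (metis nonpos_int_cases linear)
  thus ?thesis by (simp add: nome_of_nat_mult nome_minus power_int_minus)
qed

lemma nome_powi_shift: "nome (- \<tau> / 24) * nome \<tau> powi n = nome (of_int (24 * n + (- 1)) * \<tau> / 24)"
  unfolding nome_powi nome_add[symmetric] by (simp add: field_simps)

text \<open>Complex conjugation of the hypothesis turns \<omega> into \<open>cnj \<omega>\<close>
  and m into -m; the twist by -y contributes another factor (-1/l), which restores (m/l). Thus the
  middle family of \<open>hecke_g\<close> has coefficients without \<omega>.\<close>

lemma twisted_character_sum:
  assumes l: "prime l" "l > 3"
    and \<omega>: "\<And>m. (\<Sum>x\<in>units l. of_int (Legendre x (int l)) * \<omega> * nome (of_int (m * x) / of_nat l)) =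
          of_real (sqrt l) * of_int (Legendre 3 (int l)) * of_int (Legendre m (int l))"
  shows "(\<Sum>y\<in>units l. of_int (Legendre (- y) (int l)) * cnj \<omega> * nome (of_int (m * y) / of_nat l)) =
    of_real (sqrt l) * of_int (Legendre 3 (int l)) * of_int (Legendre m (int l))"
proof -
  let ?L = "\<lambda>x. of_int (Legendre x (int l)) :: complex"
  have l2: "l > 2" using l by simp
  have L1: "?L (- x) = ?L (- 1) * ?L x" for x
    using Legendre_mult[OF l(1) l2, of "- 1" x] by simp
  have "cnj (\<Sum>x\<in>units l. ?L x * \<omega> * nome (of_int (- m * x) / of_nat l)) =
      (\<Sum>x\<in>units l. ?L x * cnj \<omega> * nome (of_int (m * x) / of_nat l))"
    by (simp only: cnj_sum complex_cnj_mult complex_cnj_of_int cnj_nome_frac) simp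
  hence "(\<Sum>x\<in>units l. ?L x * cnj \<omega> * nome (of_int (m * x) / of_nat l)) =
      of_real (sqrt l) * ?L 3 * ?L (- m)"
    unfolding \<omega> by simp
  hence "?L (- 1) * (\<Sum>x\<in>units l. ?L x * cnj \<omega> * nome (of_int (m * x) / of_nat l)) =
      of_real (sqrt l) * ?L 3 * (?L (- 1) * ?L (- m))" by simp
  moreover have "?L (- 1) * ?L (- m) = ?L m" using L1[of "- m"] by simp
  moreover have "(\<Sum>y\<in>units l. ?L (- y) * cnj \<omega> * nome (of_int (m * y) / of_nat l)) =
      ?L (- 1) * (\<Sum>x\<in>units l. ?L x * cnj \<omega> * nome (of_int (m * x) / of_nat l))"
    unfolding sum_distrib_left by (intro sum.cong refl, subst L1) (simp only: mult.assoc)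
  ultimately show ?thesis by simp
qed

text \<open>The three families of \<open>hecke_g\<close> yield \<open>t1\<close>, \<open>t2\<close>
  and \<open>t3\<close>, in this order. The series \<open>c\<close> is the one of
  \<open>W_tilde\<close> with its index moved to start at 0.\<close>

lemma W_tilde_eq:
  assumes l: "prime l" "l > 3"
    and \<omega>: "\<And>m. (\<Sum>x\<in>units l. of_int (Legendre x (int l)) * \<omega> * nome (of_int (m * x) / of_nat l)) =
          of_real (sqrt l) * of_int (Legendre 3 (int l)) * of_int (Legendre m (int l))"
  obtains c :: "nat \<Rightarrow> complex" where "c 0 = beta 0"
    "\<And>\<tau>. Im \<tau> > 0 \<Longrightarrow> ((\<lambda>j. c j * nome \<tau> ^ j) has_sum
        nome \<tau> ^ s_nat l * (B_fun (nome \<tau>) * W_tilde l \<tau>)) UNIV"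
    "\<And>\<tau>. Im \<tau> > 0 \<Longrightarrow> W_tilde l \<tau> = hecke_g l \<omega> \<tau> / g_fun \<tau>"
proof -
  let ?s = "s_nat l" and ?L = "\<lambda>x. of_int (Legendre x (int l)) :: complex"
  have l0: "l > 0" "l\<^sup>2 > 0" "l\<^sup>2 > 1" using l one_less_power[of l 2] by simp_all
  have cl: "of_nat l \<noteq> (0::complex)" using l0 by simp
  define S where "S = {n::int. of_int n \<ge> - s_ell l}"
  have S: "S = {- int ?s..}"
  proof -
    have "of_int n \<ge> - s_ell l \<longleftrightarrow> (of_int n :: rat) \<ge> of_int (- int ?s)" for n
      by (simp add: s_ell_eq[OF l])
    thus ?thesis unfolding S_def by (simp only: of_int_le_iff) auto
  qed
  define t1 where "t1 = (\<lambda>n::int. of_nat l * beta (of_nat l ^ 2 * of_int n - s_ell l) :: complex)"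
  define t2 where "t2 = (\<lambda>n::int. ?L 3 * ?L (24 * n - 1) * beta (of_int n))"
  define t3 where "t3 = (\<lambda>n::int. beta ((of_int n + s_ell l) / of_nat l ^ 2))"
  have arg1: "of_nat l ^ 2 * of_int n - s_ell l = (of_int (int (l\<^sup>2) * n - int ?s) :: rat)" for n
    by (simp add: s_ell_eq[OF l])
  have total: "((\<lambda>n. (t1 n + t2 n + t3 n) * nome \<tau> powi n) has_sum
      hecke_g l \<omega> \<tau> / nome (- \<tau> / 24)) S"
    if \<tau>: "Im \<tau> > 0" for \<tau>
  proof -
    let ?P = "nome (- \<tau> / 24)"
    have "((\<lambda>n. t1 n * nome \<tau> powi n) has_sum
        (\<Sum>b\<in>{0..<int (l\<^sup>2)}. g_fun ((\<tau> + 24 * of_int b) / of_nat (l\<^sup>2))) / of_nat l / ?P) S"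
    proof -
      let ?K = "{k. int (l\<^sup>2) dvd 24 * int k + (- 1)}" and ?\<psi> = "\<lambda>n. nat (int (l\<^sup>2) * n - int ?s)"
      have "((\<lambda>k. of_nat (l\<^sup>2) * (beta (of_nat k) * nome (of_int (24 * int k +
          (- 1)) * \<tau> / (24 * of_nat (l\<^sup>2))))) has_sum
          (\<Sum>b\<in>{0..<int (l\<^sup>2)}. g_fun ((\<tau> + 24 * of_int (1 * b)) / of_nat (l\<^sup>2)))) ?K"
      proof (rule progression_has_sum[OF l0(2)])
        fix b
        have "Im ((\<tau> + 24 * of_int (1 * b)) / of_nat (l\<^sup>2)) > 0"
          using \<tau> l0 by (simp add: Im_divide_of_nat del: of_nat_power)
        thus "((\<lambda>k. beta (of_nat k) * nome (of_int (24 * int k + (- 1)) * ((\<tau> +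
            24 * of_int (1 * b)) / of_nat (l\<^sup>2)) / 24)) has_sum
            g_fun ((\<tau> + 24 * of_int (1 * b)) / of_nat (l\<^sup>2))) UNIV" by (rule g_fun_has_sum)
      qed simp_all
      moreover have pos: "int (l\<^sup>2) * n - int ?s > 0" if "n \<ge> 1" for n
      proof -
        have "int (l\<^sup>2) * 1 \<le> int (l\<^sup>2) * n" using that by (intro mult_left_mono) simp_all
        thus ?thesis using s_nat_int[OF l] by linarith
      qed
      have \<psi>: "24 * int (?\<psi> n) + (- 1) = int (l\<^sup>2) * (24 * n + (- 1))" if "n \<ge> 1" for n
      proof -
        have "int (?\<psi> n) = int (l\<^sup>2) * n - int ?s" using pos[OF that] by simp
        hence "24 * int (?\<psi> n) + (- 1) = int (l\<^sup>2) * (24 * n) - (24 * int ?s + 1)" by simp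
        thus ?thesis unfolding s_nat_int[OF l, symmetric] by (simp add: right_diff_distrib)
      qed
      \<comment> \<open>Solutions of 24k - 1 = l^2 (24n - 1) have n \<ge> 1. For n \<le> 0 the
        argument l^2 n - s is negative, where \<open>beta\<close> vanishes, so the sum extends to
        \<open>S\<close> afterwards.\<close>
      have "?K = ?\<psi> ` {1..}"
      proof (intro equalityI subsetI)
        fix k assume "k \<in> ?K"
        then obtain m where m: "24 * int k + (- 1) = int (l\<^sup>2) * m" by (auto elim: dvdE)
        \<comment> \<open>At k = 0 the number 24k - 1 is negative, and the quotient m could not be
          positive.\<close>
        have "k \<noteq> 0"
        proof
          assume "k = 0"
          hence "int (l\<^sup>2) dvd 1" using m by (metis add_0 dvd_minus_iff dvd_triv_left
              mult_zero_right of_nat_0)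
          hence "l\<^sup>2 dvd 1" by (metis int_dvd_int_iff of_nat_1)
          hence "l\<^sup>2 \<le> 1" by (rule dvd_imp_le) simp
          thus False using l0(3) by (meson not_less)
        qed
        have "m > 0"
        proof (rule ccontr)
          assume "\<not> m > 0"
          hence "int (l\<^sup>2) * m \<le> 0" by (simp add: mult_nonneg_nonpos)
          thus False using m \<open>k \<noteq> 0\<close> by linarith
        qed
        have "m = 24 * (int k - int ?s * m) +
            (- 1)" using m unfolding s_nat_int[OF l] by (simp add: algebra_simps)
        then obtain n where n: "m = 24 * n + (- 1)" by blast
        have n1: "n \<ge> 1" using n \<open>m > 0\<close> by linarith
        have "24 * int (?\<psi> n) + (- 1) = 24 * int k + (- 1)" unfolding \<psi>[OF n1] m n ..
        moreover have "X = Z" if "24 * X + (- 1) = 24 * Z + (- 1)" for X Z :: int using that by simp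
        ultimately have "int (?\<psi> n) = int k" by blast
        hence "k = ?\<psi> n" by (simp only: of_nat_eq_iff)
        thus "k \<in> ?\<psi> ` {1..}" using n1 by blast
      next
        fix k assume "k \<in> ?\<psi> ` {1..}"
        then obtain n where k: "k = ?\<psi> n" "n \<ge> 1" by auto
        show "k \<in> ?K" unfolding k(1) mem_Collect_eq \<psi>[OF k(2)] by (rule dvd_triv_left)
      qed
      moreover have "inj_on ?\<psi> {1..}"
      proof (rule inj_onI)
        fix m n assume mn: "m \<in> {1..}" "n \<in> {1..}" "?\<psi> m = ?\<psi> n"
        have "0 \<le> int (l\<^sup>2) * m - int ?s" "0 \<le> int (l\<^sup>2) * n - int ?s"
          using mn(1,2) less_imp_le[OF pos] by blast+
        hence "int (l\<^sup>2) * m - int ?s = int (l\<^sup>2) * n -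
            int ?s" using mn(3) by (simp only: eq_nat_nat_iff)
        thus "m = n" using l0 by simp
      qed
      ultimately have "((\<lambda>n. of_nat (l\<^sup>2) * (beta (of_nat (?\<psi> n)) * nome (of_int (24 * int (?\<psi> n) +
          (- 1)) * \<tau> / (24 * of_nat (l\<^sup>2))))) has_sum
          (\<Sum>b\<in>{0..<int (l\<^sup>2)}. g_fun ((\<tau> + 24 * of_int (1 * b)) / of_nat (l\<^sup>2)))) {1..}"
        by (simp only: has_sum_reindex o_def)
      moreover have "of_nat (l\<^sup>2) * (beta (of_nat (?\<psi> n)) * nome (of_int (24 * int (?\<psi> n) +
          (- 1)) * \<tau> / (24 * of_nat (l\<^sup>2)))) =
          (of_nat l * ?P) * (t1 n * nome \<tau> powi n)" if n: "n \<in> {1..}" for n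
      proof -
        have "of_int (24 * int (?\<psi> n) + (- 1)) * \<tau> / (24 * of_nat (l\<^sup>2)) =
            of_int (24 * n + (- 1)) * \<tau> / 24"
          using n cl by (subst \<psi>) simp_all
        hence "nome (of_int (24 * int (?\<psi> n) + (- 1)) * \<tau> / (24 * of_nat (l\<^sup>2))) =
            ?P * nome \<tau> powi n"
          using nome_powi_shift by (simp only:)
        moreover have "(of_nat (?\<psi> n) :: rat) = of_int (int (l\<^sup>2) * n - int ?s)"
          using pos[of n] n by (metis atLeast_iff int_nat_eq less_imp_le of_int_of_nat_eq)
        hence "t1 n = of_nat l * beta (of_nat (?\<psi> n))" unfolding t1_def arg1 by (simp only:)
        ultimately show ?thesis by (simp add: power2_eq_square)
      qed
      ultimately have "((\<lambda>n. (of_nat l * ?P) * (t1 n * nome \<tau> powi n)) has_sum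
          (\<Sum>b\<in>{0..<int (l\<^sup>2)}. g_fun ((\<tau> + 24 * of_int (1 * b)) / of_nat (l\<^sup>2)))) {1..}"
        using has_sum_cong[of "{1..}"] by (metis (no_types, lifting))
      from has_sum_cmult_right[OF this, of "1 / (of_nat l * ?P)"]
      have "((\<lambda>n. t1 n * nome \<tau> powi n) has_sum
          (\<Sum>b\<in>{0..<int (l\<^sup>2)}. g_fun ((\<tau> + 24 * of_int b) / of_nat (l\<^sup>2))) / of_nat l / ?P) {1..}"
        using cl by (simp add: mult.assoc)
      thus ?thesis
      proof (rule has_sum_cong_neutral[THEN iffD1, rotated -1])
        fix n assume "n \<in> S - {1..}"
        hence n: "n \<le> 0" by simp
        have "int (l\<^sup>2) * n \<le> 0" using n by (simp add: mult_nonneg_nonpos)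
        hence "int (l\<^sup>2) * n - int ?s < 0" using s_nat_pos[OF l] by linarith
        thus "t1 n * nome \<tau> powi n = 0" unfolding t1_def arg1 by (simp add: beta_of_int_neg del:
            of_int_diff of_int_mult)
      next
        fix n assume "n \<in> {1..} - S"
        thus "t1 n * nome \<tau> powi n = 0" unfolding S by auto
      qed simp
    qed
    moreover have "((\<lambda>n. t2 n * nome \<tau> powi n) has_sum
        (\<Sum>y\<in>units l. ?L (- y) * cnj \<omega> * g_fun (\<tau> +
            24 * of_int y / of_nat l)) / of_real (sqrt l) / ?P) S"
    proof -
      have "((\<lambda>k. (\<Sum>y\<in>units l. ?L (- y) * cnj \<omega> *
            (beta (of_nat k) * nome (of_int (24 * int k + (- 1)) * (\<tau> +
                24 * of_int y / of_nat l) / 24)))) has_sum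
          (\<Sum>y\<in>units l. ?L (- y) * cnj \<omega> * g_fun (\<tau> + 24 * of_int y / of_nat l))) UNIV"
        using \<tau> by (intro has_sum_finite_sum has_sum_cmult_right g_fun_has_sum) simp_all
      moreover have "(\<Sum>y\<in>units l. ?L (- y) * cnj \<omega> *
            (beta (of_nat k) * nome (of_int (24 * int k + (- 1)) * (\<tau> +
                24 * of_int y / of_nat l) / 24))) =
          (of_real (sqrt l) * ?P) * (t2 (int k) * nome \<tau> powi (int k))" for k
      proof -
        have eq: "nome (of_int (24 * int k + (- 1)) * (\<tau> + 24 * of_int y / of_nat l) / 24) =
            ?P * nome \<tau> powi (int k) * nome (of_int ((24 * int k + (- 1)) * y) / of_nat l)" for y
          unfolding nome_powi_shift nome_add[symmetric] using cl
          by (intro arg_cong[of _ _ nome]) (simp add: field_simps)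
        have "(\<Sum>y\<in>units l. ?L (- y) * cnj \<omega> *
              (beta (of_nat k) * nome (of_int (24 * int k + (- 1)) * (\<tau> +
                  24 * of_int y / of_nat l) / 24))) =
            beta (of_nat k) * (?P * nome \<tau> powi (int k)) *
            (\<Sum>y\<in>units l. ?L (- y) * cnj \<omega> * nome (of_int ((24 * int k + (- 1)) * y) / of_nat l))"
          unfolding sum_distrib_left by (intro sum.cong refl) (simp only: eq, simp only: mult_ac)
        thus ?thesis unfolding twisted_character_sum[OF l \<omega>] t2_def by simp
      qed
      ultimately have "((\<lambda>k. (of_real (sqrt l) * ?P) * (t2 (int k) * nome \<tau> powi (int k))) has_sum
          (\<Sum>y\<in>units l. ?L (- y) * cnj \<omega> * g_fun (\<tau> +
              24 * of_int y / of_nat l))) UNIV" by (simp only:)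
      from has_sum_cmult_right[OF this, of "1 / (of_real (sqrt l) * ?P)"]
      have "((\<lambda>k. t2 (int k) * nome \<tau> powi (int k)) has_sum
          (\<Sum>y\<in>units l. ?L (- y) * cnj \<omega> * g_fun (\<tau> +
              24 * of_int y / of_nat l)) / of_real (sqrt l) / ?P) UNIV"
        using l0 by (simp add: mult.assoc)
      hence "((\<lambda>n. t2 n * nome \<tau> powi n) has_sum
          (\<Sum>y\<in>units l. ?L (- y) * cnj \<omega> * g_fun (\<tau> +
              24 * of_int y / of_nat l)) / of_real (sqrt l) / ?P) (range int)"
        by (subst has_sum_reindex) (simp_all add: o_def inj_def)
      thus ?thesis
      proof (rule has_sum_cong_neutral[THEN iffD1, rotated -1])
        fix n assume "n \<in> S - range int"
        hence "n < 0" by (metis DiffD2 nonneg_int_cases not_le rangeI)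
        thus "t2 n * nome \<tau> powi n = 0" by (simp add: t2_def beta_of_int_neg)
      next
        fix n assume "n \<in> range int - S"
        thus "t2 n * nome \<tau> powi n = 0" unfolding S by auto
      qed simp
    qed
    moreover have "((\<lambda>n. t3 n * nome \<tau> powi n) has_sum g_fun (of_nat (l\<^sup>2) * \<tau>) / ?P) S"
    proof -
      let ?\<psi> = "\<lambda>k. int (l\<^sup>2) * int k - int ?s"
      have "Im (of_nat (l\<^sup>2) * \<tau>) > 0" using \<tau> l0 by (simp del: of_nat_power)
      from has_sum_cmult_right[OF g_fun_has_sum[OF this], of "1 / ?P"]
      have "((\<lambda>k. 1 / ?P * (beta (of_nat k) * nome (of_int (24 * int k +
          (- 1)) * (of_nat (l\<^sup>2) * \<tau>) / 24))) has_sum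
          g_fun (of_nat (l\<^sup>2) * \<tau>) / ?P) UNIV" by simp
      moreover have "1 / ?P * (beta (of_nat k) * nome (of_int (24 * int k +
          (- 1)) * (of_nat (l\<^sup>2) * \<tau>) / 24)) =
          t3 (?\<psi> k) * nome \<tau> powi ?\<psi> k" for k
      proof -
        have "(24 * int k + (- 1)) * int (l\<^sup>2) =
            24 * ?\<psi> k + (24 * int ?s - int (l\<^sup>2))" by (simp add: algebra_simps)
        also have "\<dots> = 24 * ?\<psi> k + (- 1)" using s_nat_int[OF l] by simp
        finally have "of_int ((24 * int k + (- 1)) * int (l\<^sup>2)) =
            (of_int (24 * ?\<psi> k + (- 1)) :: complex)"
          by (simp only:)
        hence "of_int (24 * int k + (- 1)) * (of_nat (l\<^sup>2) * \<tau>) / 24 =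
            of_int (24 * ?\<psi> k + (- 1)) * \<tau> / 24"
          by (metis mult.assoc of_int_mult of_int_of_nat_eq)
        hence "nome (of_int (24 * int k + (- 1)) * (of_nat (l\<^sup>2) * \<tau>) / 24) = ?P * nome \<tau> powi ?\<psi> k"
          by (simp only: nome_powi_shift)
        moreover have "(of_int (?\<psi> k) + s_ell l) / of_nat l ^ 2 = (of_nat k :: rat)"
          using l0 by (simp add: s_ell_eq[OF l])
        ultimately show ?thesis unfolding t3_def by simp
      qed
      ultimately have "((\<lambda>k. t3 (?\<psi> k) * nome \<tau> powi ?\<psi> k) has_sum
          g_fun (of_nat (l\<^sup>2) * \<tau>) / ?P) UNIV"
        by (simp only:)
      moreover have inj: "inj ?\<psi>" using l0 by (auto simp: inj_def)
      ultimately have "((\<lambda>n. t3 n * nome \<tau> powi n) has_sum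
          g_fun (of_nat (l\<^sup>2) * \<tau>) / ?P) (range ?\<psi>)"
        by (subst has_sum_reindex[OF inj]) (simp only: o_def)
      thus ?thesis
      proof (rule has_sum_cong_neutral[THEN iffD1, rotated -1])
        fix n assume n: "n \<in> S - range ?\<psi>"
        \<comment> \<open>Off this progression the argument of \<open>beta\<close> is not a natural
          number, and \<open>beta\<close> is 0 there by its definition.\<close>
        have "(of_int n + s_ell l) / of_nat l ^ 2 \<notin> (\<nat> :: rat set)"
        proof
          assume "(of_int n + s_ell l) / of_nat l ^ 2 \<in> (\<nat> :: rat set)"
          then obtain k where "(of_int n + s_ell l) / of_nat l ^ 2 =
              (of_nat k :: rat)" by (auto simp: Nats_def)
          hence "of_int n = (of_nat l ^ 2 * of_nat k -
              s_ell l :: rat)" using l0 by (simp add: field_simps)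
          also have "\<dots> = of_int (?\<psi> k)" using arg1[of "int k"] by simp
          finally have "n = ?\<psi> k" by (simp only: of_int_eq_iff)
          thus False using n by blast
        qed
        thus "t3 n * nome \<tau> powi n = 0" by (simp add: t3_def beta_def)
      next
        fix n assume "n \<in> range ?\<psi> - S"
        thus "t3 n * nome \<tau> powi n = 0" unfolding S by auto
      qed simp
    qed
    ultimately have "((\<lambda>n. t1 n * nome \<tau> powi n + t2 n * nome \<tau> powi n +
        t3 n * nome \<tau> powi n) has_sum
        (\<Sum>b\<in>{0..<int (l\<^sup>2)}. g_fun ((\<tau> + 24 * of_int b) / of_nat (l\<^sup>2))) / of_nat l / ?P +
        (\<Sum>y\<in>units l. ?L (- y) * cnj \<omega> * g_fun (\<tau> +
            24 * of_int y / of_nat l)) / of_real (sqrt l) / ?P +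
        g_fun (of_nat (l\<^sup>2) * \<tau>) / ?P) S"
      by (intro has_sum_add)
    thus ?thesis by (simp only: hecke_g_def add_divide_distrib distrib_right)
  qed
  have W: "B_fun (nome \<tau>) * W_tilde l \<tau> = hecke_g l \<omega> \<tau> / nome (- \<tau> / 24)" if \<tau>: "Im \<tau> > 0" for \<tau>
  proof -
    have "infsum (\<lambda>n. (t1 n + t2 n + t3 n) * nome \<tau> powi n) S = hecke_g l \<omega> \<tau> / nome (- \<tau> / 24)"
      by (rule infsumI[OF total[OF \<tau>]])
    moreover have "W_tilde l \<tau> = 1 / B_fun (nome \<tau>) * infsum (\<lambda>n. (t1 n + t2 n +
        t3 n) * nome \<tau> powi n) S"
      unfolding W_tilde_def t1_def t2_def t3_def S_def ..
    ultimately show ?thesis using B_fun_nonzero[OF norm_nome_less_1[OF \<tau>]] by simp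
  qed
  define c where "c = (\<lambda>j. t1 (int j - int ?s) + t2 (int j - int ?s) + t3 (int j - int ?s))"
  show ?thesis
  proof (rule that[of c])
    \<comment> \<open>At the lowest index n = -s the first two terms evaluate \<open>beta\<close> at
      negative integers, and the third evaluates it at 0. So the leading coefficient is
      \<open>beta 0\<close>.\<close>
    have "t1 (- int ?s) = 0"
    proof -
      have "int (l\<^sup>2) * (- int ?s) - int ?s = - int (l\<^sup>2 * ?s + ?s)" by simp
      also have "\<dots> < 0" using s_nat_pos[OF l] by (simp only: neg_less_0_iff_less of_nat_0_less_iff)
      finally have "int (l\<^sup>2) * (- int ?s) - int ?s < 0" .
      thus ?thesis unfolding t1_def arg1 by (simp add: beta_of_int_neg del: of_int_diff of_int_mult)
    qed
    moreover have "t2 (- int ?s) = 0"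
      using beta_of_int_neg[of "- int ?s"] s_nat_pos[OF l] by (simp add: t2_def del: of_int_minus)
    moreover have "t3 (- int ?s) = beta 0" by (simp add: t3_def s_ell_eq[OF l])
    ultimately show "c 0 = beta 0" by (simp add: c_def)
    fix \<tau> :: complex assume \<tau>: "Im \<tau> > 0"
    have "B_fun (nome \<tau>) * W_tilde l \<tau> / B_fun (nome \<tau>) =
        hecke_g l \<omega> \<tau> / nome (- \<tau> / 24) / B_fun (nome \<tau>)"
      by (simp only: W[OF \<tau>])
    thus "W_tilde l \<tau> = hecke_g l \<omega> \<tau> / g_fun \<tau>"
      using B_fun_nonzero[OF norm_nome_less_1[OF \<tau>]] by (simp add: g_fun_eq)
    let ?\<psi> = "\<lambda>j. int j - int ?s"
    have inj: "inj ?\<psi>" by (simp add: inj_def)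
    have range: "range ?\<psi> = S" unfolding S
    proof (intro equalityI subsetI)
      fix n assume "n \<in> {- int ?s..}"
      hence "n = ?\<psi> (nat (n + int ?s))" by simp
      thus "n \<in> range ?\<psi>" by blast
    qed auto
    have "((\<lambda>j. c j * nome \<tau> powi ?\<psi> j) has_sum hecke_g l \<omega> \<tau> / nome (- \<tau> / 24)) UNIV"
      using total[OF \<tau>] unfolding range[symmetric] by (subst (asm) has_sum_reindex[OF inj]) (simp
          only: o_def c_def)
    from has_sum_cmult_right[OF this, of "nome \<tau> ^ ?s"]
    have "((\<lambda>j. nome \<tau> ^ ?s * (c j * nome \<tau> powi ?\<psi> j)) has_sum
        nome \<tau> ^ ?s * (B_fun (nome \<tau>) * W_tilde l \<tau>)) UNIV"
      by (simp only: W[OF \<tau>])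
    moreover have "nome \<tau> ^ ?s * (c j * nome \<tau> powi ?\<psi> j) = c j * nome \<tau> ^ j" for j
      by (simp add: power_int_diff)
    ultimately show "((\<lambda>j. c j * nome \<tau> ^ j) has_sum
        nome \<tau> ^ ?s * (B_fun (nome \<tau>) * W_tilde l \<tau>)) UNIV"
      by (simp only:)
  qed
qed

text \<open>The Hecke image of \<open>g_fun\<close> and \<open>g_fun\<close> itself acquire the same
  factor 2 csqrt (-\<i>\<tau>) under inversion, so it cancels and leaves a function of nome
  (\<tau>/2). The nonvanishing of F 0, which is \<open>beta 0\<close> over \<open>B_fun 0\<close>,
  makes the pole at i\<infinity> genuine, of order exactly \<open>s_nat l\<close>.\<close>

lemma W_tilde_level2_expansion:
  assumes l: "prime l" "l > 3"
  obtains F Y where "level2_expansion (s_nat l) F Y (W_tilde l)" "F 0 \<noteq> 0"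
proof -
  obtain \<omega> where \<omega>: "norm \<omega> = 1"
    "\<And>x y. int l dvd 576 * x * y + 1 \<Longrightarrow> eta_mult l y x = of_int (Legendre x (int l)) * \<omega>"
    "\<And>m. (\<Sum>x\<in>units l. of_int (Legendre x (int l)) * \<omega> * nome (of_int (m * x) / of_nat l)) =
          of_real (sqrt l) * of_int (Legendre 3 (int l)) * of_int (Legendre m (int l))"
    using eta_mult_prime[OF l] by blast
  obtain c where c: "c 0 = beta 0"
    "\<And>\<tau>. Im \<tau> > 0 \<Longrightarrow> ((\<lambda>j. c j * nome \<tau> ^ j) has_sum
        nome \<tau> ^ s_nat l * (B_fun (nome \<tau>) * W_tilde l \<tau>)) UNIV"
    "\<And>\<tau>. Im \<tau> > 0 \<Longrightarrow> W_tilde l \<tau> = hecke_g l \<omega> \<tau> / g_fun \<tau>"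
    using W_tilde_eq[OF l \<omega>(3)] by blast
  obtain \<Phi> where \<Phi>: "\<Phi> holomorphic_on ball 0 1" "\<Phi> 0 = c 0"
    "\<And>\<tau>. Im \<tau> > 0 \<Longrightarrow> nome \<tau> ^ s_nat l * (B_fun (nome \<tau>) * W_tilde l \<tau>) = \<Phi> (nome \<tau>)"
    using disc_function_from_nome_series[OF c(2)] by blast
  obtain \<Psi> where \<Psi>: "\<Psi> holomorphic_on ball 0 1"
    "\<And>\<tau>. Im \<tau> > 0 \<Longrightarrow> hecke_h l \<omega> \<tau> = nome (\<tau> / 12) * \<Psi> (nome (\<tau> / 2))"
    using hecke_h_expansion[OF l] by blast
  have "level2_expansion (s_nat l) (\<lambda>q. \<Phi> q / B_fun q) (\<lambda>x. \<Psi> x / C_fun x) (W_tilde l)"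
    unfolding level2_expansion_def
  proof (intro conjI allI impI)
    show "(\<lambda>q. \<Phi> q / B_fun q) holomorphic_on ball 0 1"
      by (intro holomorphic_intros \<Phi>(1) B_fun_holomorphic) (auto dest: B_fun_nonzero)
    show "(\<lambda>x. \<Psi> x / C_fun x) holomorphic_on ball 0 1"
      by (intro holomorphic_intros \<Psi>(1) C_fun_holomorphic) (auto dest: C_fun_nonzero)
    fix \<tau> :: complex assume \<tau>: "Im \<tau> > 0"
    show "W_tilde l \<tau> = \<Phi> (nome \<tau>) / B_fun (nome \<tau>) / nome \<tau> ^ s_nat l"
      using \<Phi>(3)[OF \<tau>, symmetric] B_fun_nonzero[OF norm_nome_less_1[OF \<tau>]] by simp
    have r0: "csqrt (- \<i> * \<tau>) \<noteq> 0" using \<tau> by auto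
    have "W_tilde l (- 1 / \<tau>) = hecke_g l \<omega> (- 1 / \<tau>) / g_fun (- 1 / \<tau>)"
      by (rule c(3)[OF Im_minus_inverse_pos[OF \<tau>]])
    also have "g_fun (- 1 / \<tau>) = 2 * csqrt (- \<i> * \<tau>) * h_fun \<tau>"
      using g_fun_inversion[OF \<tau>, of 1] by simp
    also have "hecke_g l \<omega> (- 1 / \<tau>) = 2 * csqrt (- \<i> * \<tau>) * hecke_h l \<omega> \<tau>"
      by (rule hecke_inversion[OF l \<omega>(1,2) \<tau>])
    also have "2 * csqrt (- \<i> * \<tau>) * hecke_h l \<omega> \<tau> / (2 * csqrt (- \<i> * \<tau>) * h_fun \<tau>) =
        hecke_h l \<omega> \<tau> / h_fun \<tau>"
      using r0 by simp
    also have "\<dots> = \<Psi> (nome (\<tau> / 2)) / C_fun (nome (\<tau> / 2))"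
      unfolding \<Psi>(2)[OF \<tau>] h_fun_eq by simp
    finally show "W_tilde l (- 1 / \<tau>) = \<Psi> (nome (\<tau> / 2)) / C_fun (nome (\<tau> / 2))" .
  qed
  moreover have "\<Phi> 0 / B_fun 0 \<noteq> 0"
  proof -
    have "beta 0 = B_fun 0"
      using sums_unique2[OF beta_sums_B_fun[of 0] powser_sums_zero] by simp
    thus ?thesis using B_fun_nonzero[of 0] by (simp add: \<Phi>(2) c(1))
  qed
  ultimately show ?thesis using that[of "\<lambda>q. \<Phi> q / B_fun q"] by blast
qed

theorem theorem4p10:
  fixes l :: nat
  assumes "prime l" and "l > 3"
  shows "weakly_holomorphic_modular_function 2 (W_tilde l)
    \<and> (\<forall>A\<in>SL2Z. pole_at_cusp 2 (W_tilde l) A \<longleftrightarrow> cusps_equivalent 2 A (mat 1))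
    \<and> (\<exists>P :: complex poly. \<forall>\<tau>\<in>upper_half_plane. W_tilde l \<tau> = poly P (inverse (Phi2 \<tau>)))"
proof -
  obtain F Y where FY: "level2_expansion (s_nat l) F Y (W_tilde l)" "F 0 \<noteq> 0"
    using W_tilde_level2_expansion[OF assms] .
  have "pole_at_cusp 2 (W_tilde l) A \<longleftrightarrow> cusps_equivalent 2 A (mat 1)" if "A \<in> SL2Z" for A
    using level2_pole_at_cusp_iff[OF FY(1) that s_nat_pos[OF assms] FY(2)]
      cusps_equivalent_infinity_iff[OF that] by simp
  moreover have "\<exists>P :: complex poly. \<forall>\<tau>\<in>upper_half_plane. W_tilde l \<tau> = poly P (inverse (Phi2 \<tau>))"
    using level2_polynomial[OF FY(1)] by (simp add: upper_half_plane_def)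
  ultimately show ?thesis using level2_weakly_holomorphic[OF FY(1)] by blast
qed

end
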